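(* Let $a>0$, $k\in\mathbb{R}$, $\sigma>0$, $v=2a/\sigma^2$, $T>0$, and let $X^x_t$ be the CIR process starting from $x\in\mathbb{R}_+$. Then for all $L\in\mathbb{N}^*$ and $t\in[0,T]$, $$\mathbb{E}\big[(X^x_t)^L\big]=\sum_{j=0}^L\delta^{cir}_{j,L}(v)\Big(\frac{\sigma^2\psi_k(t)}{2}\Big)^{L-j}e^{-jkt}x^j,\qquad\text{where }\ \delta^{cir}_{j,L}(v)=\binom Lj\prod_{q=j}^{L-1}(q+v).$$
   Context: $\mathbb{R}_+=[0,\infty)$, $\mathbb{N}^*=\mathbb{N}\setminus\{0\}$. The CIR process solves $dX^x_t=(a-kX^x_t)dt+\sigma\sqrt{X^x_t}\,dW_t$, $X^x_0=x$, with $W$ a standard Brownian motion. $\psi_k(t)=\frac{1-e^{-kt}}{k}$ for $k\ne0$, $\psi_0(t)=t$. Empty products equal $1$. *)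

theory Defs
  imports "HOL-Probability.Probability"
begin

section \<open>Filtered Brownian motion\<close>

text \<open>
  Time is the half-line \<open>{0..}\<close> inside \<^typ>\<open>real\<close>; a filtration indexed by \<open>{0..}\<close> is viewed as one
  indexed by \<^typ>\<open>real\<close> by giving negative times the sigma-algebra of time \<open>0\<close>. Neither completeness
  nor right-continuity of the filtration is required, so filtrations satisfying the usual conditions
  are a special case.
\<close>

locale brownian_motion = prob_space M + filtration "space M" F
  for M :: "'a measure" and F :: "real \<Rightarrow> 'a measure" +
  fixes W :: "real \<Rightarrow> 'a \<Rightarrow> real"
  assumes subalg: "\<And>t. subalgebra M (F t)"
    and W_adapted: "\<And>t. 0 \<le> t \<Longrightarrow> W t \<in> borel_measurable (F t)"
    and W_start: "AE \<omega> in M. W 0 \<omega> = 0"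
    and W_continuous: "AE \<omega> in M. continuous_on {0..} (\<lambda>t. W t \<omega>)"
    and W_indep_increments: "\<And>s t. 0 \<le> s \<Longrightarrow> s < t \<Longrightarrow>
      indep_set (sets (F s)) (sets (vimage_algebra (space M) (\<lambda>\<omega>. W t \<omega> - W s \<omega>) borel))"
    and W_normal_increments: "\<And>s t. 0 \<le> s \<Longrightarrow> s < t \<Longrightarrow>
      distributed M lborel (\<lambda>\<omega>. W t \<omega> - W s \<omega>) (normal_density 0 (sqrt (t - s)))"


section \<open>The Ito integral\<close>

definition tendsto_in_prob ::
    "'a measure \<Rightarrow> (nat \<Rightarrow> 'a \<Rightarrow> real) \<Rightarrow> ('a \<Rightarrow> real) \<Rightarrow> bool" where
  "tendsto_in_prob M Y Z \<longleftrightarrow>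
     (\<forall>n. Y n \<in> borel_measurable M) \<and> Z \<in> borel_measurable M \<and>
     (\<forall>\<epsilon>>0. (\<lambda>n. measure M {\<omega> \<in> space M. \<epsilon> < \<bar>Y n \<omega> - Z \<omega>\<bar>}) \<longlonglongrightarrow> 0)"

text \<open>
  The triple \<open>(m, \<tau>, \<xi>)\<close> encodes the simple process
  \<open>\<Sum>i<m. \<xi> i * indicator {\<tau> i<..\<tau> (i+1)}\<close> with \<open>\<xi> i\<close> bounded and \<open>F (\<tau> i)\<close>-measurable.
\<close>

definition simple_process ::
    "'a measure \<Rightarrow> (real \<Rightarrow> 'a measure) \<Rightarrow> nat \<Rightarrow> (nat \<Rightarrow> real) \<Rightarrow> (nat \<Rightarrow> 'a \<Rightarrow> real) \<Rightarrow> bool" where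
  "simple_process M F m \<tau> \<xi> \<longleftrightarrow>
     0 \<le> \<tau> 0 \<and> (\<forall>i<m. \<tau> i < \<tau> (Suc i)) \<and>
     (\<forall>i<m. \<xi> i \<in> borel_measurable (F (\<tau> i)) \<and> (\<exists>C. \<forall>\<omega>\<in>space M. \<bar>\<xi> i \<omega>\<bar> \<le> C))"

definition simple_value ::
    "nat \<Rightarrow> (nat \<Rightarrow> real) \<Rightarrow> (nat \<Rightarrow> 'a \<Rightarrow> real) \<Rightarrow> real \<Rightarrow> 'a \<Rightarrow> real" where
  "simple_value m \<tau> \<xi> s \<omega> = (\<Sum>i<m. \<xi> i \<omega> * indicator {\<tau> i<..\<tau> (Suc i)} s)"

definition simple_integral ::
    "(real \<Rightarrow> 'a \<Rightarrow> real) \<Rightarrow> nat \<Rightarrow> (nat \<Rightarrow> real) \<Rightarrow> (nat \<Rightarrow> 'a \<Rightarrow> real) \<Rightarrow> real \<Rightarrow> 'a \<Rightarrow> real" where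
  "simple_integral W m \<tau> \<xi> t \<omega> =
     (\<Sum>i<m. \<xi> i \<omega> * (W (min (\<tau> (Suc i)) t) \<omega> - W (min (\<tau> i) t) \<omega>))"

definition progressive_on ::
    "(real \<Rightarrow> 'a measure) \<Rightarrow> (real \<Rightarrow> 'a \<Rightarrow> real) \<Rightarrow> real \<Rightarrow> bool" where
  "progressive_on F H t \<longleftrightarrow>
     (\<forall>u\<in>{0..t}. (\<lambda>(s, \<omega>). H s \<omega>) \<in> borel_measurable (restrict_space borel {0..u} \<Otimes>\<^sub>M F u))"

text \<open>
  \<open>has_ito_integral M F W H t I\<close> states that \<open>I\<close> is (a version of) the Ito integral of \<open>H\<close> against
  \<open>W\<close> over \<open>[0, t]\<close>, for progressive \<open>H\<close> whose paths are almost surely square integrable on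
  \<open>[0, t]\<close>. The integral is a random variable determined up to null sets, hence a relation.
\<close>

definition has_ito_integral ::
    "'a measure \<Rightarrow> (real \<Rightarrow> 'a measure) \<Rightarrow> (real \<Rightarrow> 'a \<Rightarrow> real) \<Rightarrow>
     (real \<Rightarrow> 'a \<Rightarrow> real) \<Rightarrow> real \<Rightarrow> ('a \<Rightarrow> real) \<Rightarrow> bool" where
  "has_ito_integral M F W H t I \<longleftrightarrow>
     progressive_on F H t \<and>
     (AE \<omega> in M. set_integrable lborel {0..t} (\<lambda>s. (H s \<omega>)\<^sup>2)) \<and>
     (\<exists>m \<tau> \<xi>.
        (\<forall>n. simple_process M F (m n) (\<tau> n) (\<xi> n)) \<and>
        tendsto_in_prob M
          (\<lambda>n \<omega>. LINT s:{0..t}|lborel. (simple_value (m n) (\<tau> n) (\<xi> n) s \<omega> - H s \<omega>)\<^sup>2) (\<lambda>_. 0) \<and>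
        tendsto_in_prob M (\<lambda>n. simple_integral W (m n) (\<tau> n) (\<xi> n) t) I)"


section \<open>The CIR process\<close>

text \<open>
  Solutions take values in \<open>[0, \<infinity>)\<close> almost surely; this has to be said because \<^const>\<open>sqrt\<close> is an odd
  function on all of \<^typ>\<open>real\<close>. The process \<open>J t\<close> below stands for the Ito integral of
  \<open>\<sigma> * sqrt (X s)\<close> over \<open>[0, t]\<close>.
\<close>

locale cir_process = brownian_motion M F W
  for M :: "'a measure" and F :: "real \<Rightarrow> 'a measure" and W :: "real \<Rightarrow> 'a \<Rightarrow> real" +
  fixes a k \<sigma> x :: real and X :: "real \<Rightarrow> 'a \<Rightarrow> real"
  assumes X_adapted: "\<And>t. 0 \<le> t \<Longrightarrow> X t \<in> borel_measurable (F t)"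
    and X_continuous: "AE \<omega> in M. continuous_on {0..} (\<lambda>t. X t \<omega>)"
    and X_nonneg: "AE \<omega> in M. \<forall>t\<ge>0. 0 \<le> X t \<omega>"
    and X_start: "AE \<omega> in M. X 0 \<omega> = x"
    and X_sde: "\<exists>J. (\<forall>t\<ge>0. has_ito_integral M F W (\<lambda>s \<omega>. \<sigma> * sqrt (X s \<omega>)) t (J t)) \<and>
      (AE \<omega> in M. \<forall>t\<ge>0. X t \<omega> = X 0 \<omega> + (LINT s:{0..t}|lborel. a - k * X s \<omega>) + J t \<omega>)"

definition psi :: "real \<Rightarrow> real \<Rightarrow> real" where
  "psi k t = (if k = 0 then t else (1 - exp (- k * t)) / k)"

definition delta_cir :: "nat \<Rightarrow> nat \<Rightarrow> real \<Rightarrow> real" where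
  "delta_cir j L v = real (L choose j) * (\<Prod>q = j..<L. real q + v)"

end

theory Submission
  imports Defs
begin

text \<open>
  Write \<open>A f y = (a - k * y) * f' y + \<sigma>\<^sup>2 / 2 * y * f'' y\<close>. For bounded smooth \<open>f\<close> with bounded \<open>A f\<close>,
  \<open>E f(X(t)) = f(x) + \<integral>\<^sub>0\<^sup>t E (A f)(X(s)) ds\<close>. Instead of an Ito formula for \<open>X\<close> this uses the Euler sums
  \<open>x + \<Sum>i. (a - k * X(t\<^sub>i)) * h + \<sigma> * sqrt (X(t\<^sub>i)) * (W(t\<^sub>i + h) - W(t\<^sub>i))\<close>: they converge to \<open>X\<close> in probability,
  by a Lenglart-type inequality for simple processes, and a Taylor expansion of order two of \<open>f\<close>
  along them only involves Gaussian increments that are independent of the past.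

  Applied to bounded truncations of \<open>y^n\<close> the identity yields, by Gronwall and Fatou, finiteness of
  all moments, and then by dominated convergence the linear system
  \<open>m\<^sub>n' = - k n m\<^sub>n + \<sigma>\<^sup>2 / 2 * n * (n - 1 + v) m\<^sub>n\<^sub>-\<^sub>1\<close> with \<open>m\<^sub>n(0) = x^n\<close>. The closed formula solves the
  same system because \<open>\<psi>\<^sub>k' = 1 - k \<psi>\<^sub>k\<close>.
\<close>

section \<open>Discrete stochastic integrals\<close>

text \<open>The Ito integral is given only as a limit in probability along some sequence of simple
  processes, so it must first be compared with sums whose form is known.
  \<open>lenglart_discrete\<close> does this without moment assumptions: integrals are close in
  probability as soon as the integrands are close in probability in L2 of time. The Euler sums take
  their coefficients from \<open>X\<close> itself, not from the scheme, so errors do not propagate;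
  and (sqrt y - sqrt z)^2 <= |y - z| bounds the quadratic variation error by the integrated path
  error although sqrt is not Lipschitz at 0. Unbounded coefficients are tamed by stopping on the
  grid. One Taylor step then costs O(h^(3/2)), hence O(sqrt h) over t/h steps. Euler sums may become
  negative, so test functions must be smooth on the whole line; together with the need for bounds
  uniform in the truncation this leads to y / (1 + eps y^2). Even powers of it are nonnegative, so
  Fatou's lemma yields even moments first and the others follow by domination. The moment system is
  triangular and is solved by induction on the order with an integrating factor.\<close>

context brownian_motion
begin

lemma measurable_F_M: "Y \<in> measurable (F s) N \<Longrightarrow> Y \<in> measurable M N"
  using measurable_from_subalg[OF subalg] .

lemma measurable_F_mono: "Y \<in> measurable (F s) N \<Longrightarrow> s \<le> u \<Longrightarrow> Y \<in> measurable (F u) N"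
  using sets_F_mono[of s u] space_F by (auto simp: measurable_def)

lemma W_measurable: "0 \<le> t \<Longrightarrow> W t \<in> borel_measurable M"
  using W_adapted measurable_F_M by blast

text \<open>Independence passes to smaller sigma-algebras: the one generated by \<open>Y\<close>
  lies in \<open>F s\<close>, and the one generated by a function of the increment lies in that of
  the increment.\<close>

lemma indep_var_increment:
  fixes Y :: "'a \<Rightarrow> real" and \<phi> :: "real \<Rightarrow> real"
  assumes "0 \<le> s" "s < t" and Y: "Y \<in> borel_measurable (F s)" and \<phi>: "\<phi> \<in> borel_measurable borel"
  shows "indep_var borel Y borel (\<lambda>\<omega>. \<phi> (W t \<omega> - W s \<omega>))"
  unfolding indep_var_eq
proof (intro conjI)
  let ?V = "vimage_algebra (space M) (\<lambda>\<omega>. W t \<omega> - W s \<omega>) borel"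
  show "random_variable borel Y" using measurable_F_M[OF Y] .
  show "random_variable borel (\<lambda>\<omega>. \<phi> (W t \<omega> - W s \<omega>))"
    using W_measurable assms(1,2) by (intro measurable_compose[OF _ \<phi>] borel_measurable_diff) auto
  have dW: "(\<lambda>\<omega>. W t \<omega> - W s \<omega>) \<in> borel_measurable ?V"
    by (rule measurable_vimage_algebra1) auto
  have "(\<lambda>\<omega>. \<phi> (W t \<omega> - W s \<omega>)) \<in> borel_measurable ?V"
    using \<phi> dW by measurable
  then have 2: "sigma_sets (space M) {(\<lambda>\<omega>. \<phi> (W t \<omega> - W s \<omega>)) -` A \<inter> space M |A. A \<in> sets borel} \<subseteq> sets ?V"
    by (intro sets.sigma_sets_subset[of _ ?V, simplified]) (auto dest: measurable_sets)
  have "Y -` A \<inter> space M \<in> sets (F s)" if "A \<in> sets borel" for A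
    using measurable_sets[OF Y that] space_F by simp
  then have 1: "sigma_sets (space M) {Y -` A \<inter> space M |A. A \<in> sets borel} \<subseteq> sets (F s)"
    using sets.sigma_sets_subset[of "{Y -` A \<inter> space M |A. A \<in> sets borel}" "F s"] space_F[of s] by auto
  show "indep_set (sigma_sets (space M) {Y -` A \<inter> space M |A. A \<in> sets borel})
     (sigma_sets (space M) {(\<lambda>\<omega>. \<phi> (W t \<omega> - W s \<omega>)) -` A \<inter> space M |A. A \<in> sets borel})"
    unfolding indep_set_def
  proof (rule indep_sets_mono_sets[OF W_indep_increments[OF assms(1,2), unfolded indep_set_def]])
    fix i :: bool
    show "case_bool (sigma_sets (space M) {Y -` A \<inter> space M |A. A \<in> sets borel})
        (sigma_sets (space M) {(\<lambda>\<omega>. \<phi> (W t \<omega> - W s \<omega>)) -` A \<inter> space M |A. A \<in> sets borel}) i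
      \<subseteq> case_bool (sets (F s)) (sets ?V) i"
      using 1 2 by (cases i) (simp_all only: bool.case)
  qed
qed

text \<open>All values are moments of the centred normal law with standard deviation
  \<open>sqrt (t - s)\<close>. The cubic one will bound Taylor remainders, where only the order in
  \<open>t - s\<close> matters, so its factor \<open>sqrt (2 / pi)\<close> is rounded up to
  1.\<close>

lemma increment_moments:
  assumes "0 \<le> s" "s < t"
  shows integrable_increment_power: "integrable M (\<lambda>\<omega>. (W t \<omega> - W s \<omega>) ^ n)"
    and expectation_increment: "expectation (\<lambda>\<omega>. W t \<omega> - W s \<omega>) = 0"
    and expectation_increment_square: "expectation (\<lambda>\<omega>. (W t \<omega> - W s \<omega>)\<^sup>2) = t - s"
    and integrable_increment_cube: "integrable M (\<lambda>\<omega>. \<bar>W t \<omega> - W s \<omega>\<bar> ^ 3)"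
    and expectation_increment_cube: "expectation (\<lambda>\<omega>. \<bar>W t \<omega> - W s \<omega>\<bar> ^ 3) \<le> 2 * sqrt (t - s) ^ 3"
proof -
  note D = W_normal_increments[OF assms]
  have pos: "sqrt (t - s) > 0" using assms by simp
  show "integrable M (\<lambda>\<omega>. (W t \<omega> - W s \<omega>) ^ n)"
    using distributed_integrable[OF D, of "\<lambda>y. y ^ n"] integrable_normal_moment[OF pos, of 0 n] by simp
  show "expectation (\<lambda>\<omega>. W t \<omega> - W s \<omega>) = 0"
    using normal_distributed_expectation[OF pos D] .
  show "expectation (\<lambda>\<omega>. (W t \<omega> - W s \<omega>)\<^sup>2) = t - s"
    using normal_distributed_variance[OF pos D] normal_distributed_expectation[OF pos D] assms by simp
  show "integrable M (\<lambda>\<omega>. \<bar>W t \<omega> - W s \<omega>\<bar> ^ 3)"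
    using distributed_integrable[OF D, of "\<lambda>y. \<bar>y\<bar> ^ 3"] integrable_normal_moment_abs[OF pos, of 0 3] by simp
  have "expectation (\<lambda>\<omega>. \<bar>W t \<omega> - W s \<omega>\<bar> ^ 3) = 2 * sqrt (t - s) ^ 3 * sqrt (2 / pi)"
    using distributed_integral[OF D, of "\<lambda>y. \<bar>y\<bar> ^ 3"] integral_normal_moment_abs_odd[OF pos, of 0 1]
    by (simp add: eval_nat_numeral)
  also have "\<dots> \<le> 2 * sqrt (t - s) ^ 3 * 1"
    using pi_gt3 pos by (intro mult_left_mono) (auto simp: field_simps)
  finally show "expectation (\<lambda>\<omega>. \<bar>W t \<omega> - W s \<omega>\<bar> ^ 3) \<le> 2 * sqrt (t - s) ^ 3" by simp
qed

text \<open>Product rule for a past coefficient and a function of the next increment; it is used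
  with \<open>\<phi>\<close> the identity, the square, and the compensated square
  \<open>y\<^sup>2 - h\<close>.\<close>

lemma
  fixes Y :: "'a \<Rightarrow> real" and \<phi> :: "real \<Rightarrow> real"
  assumes "0 \<le> s" "s < t" and Y: "Y \<in> borel_measurable (F s)" and \<phi>: "\<phi> \<in> borel_measurable borel"
    and "integrable M Y" and "integrable M (\<lambda>\<omega>. \<phi> (W t \<omega> - W s \<omega>))"
  shows integrable_times_increment: "integrable M (\<lambda>\<omega>. Y \<omega> * \<phi> (W t \<omega> - W s \<omega>))"
    and expectation_times_increment: "expectation (\<lambda>\<omega>. Y \<omega> * \<phi> (W t \<omega> - W s \<omega>)) =
      expectation Y * expectation (\<lambda>\<omega>. \<phi> (W t \<omega> - W s \<omega>))"
  using indep_var_integrable[OF indep_var_increment[OF assms(1-4)]]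
    indep_var_lebesgue_integral[OF indep_var_increment[OF assms(1-4)]] assms(5,6) by auto

text \<open>The coefficients are cut off when the accumulated quadratic variation would exceed \<open>\<delta>\<close>; the
  cut-off sum has second moment at most \<open>\<delta>\<close>, and it is the original one unless the quadratic
  variation exceeds \<open>\<delta>\<close>.\<close>

lemma lenglart_discrete:
  fixes p :: "nat \<Rightarrow> real" and c :: "nat \<Rightarrow> 'a \<Rightarrow> real"
  assumes p0: "0 \<le> p 0" and p: "\<And>l. l < r \<Longrightarrow> p l < p (Suc l)"
    and c: "\<And>l. l < r \<Longrightarrow> c l \<in> borel_measurable (F (p l))"
    and \<delta>: "\<delta> > 0" and \<eta>: "\<eta> > 0"
  shows "prob {\<omega> \<in> space M. \<eta> < \<bar>\<Sum>l<r. c l \<omega> * (W (p (Suc l)) \<omega> - W (p l) \<omega>)\<bar>} \<le>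
    prob {\<omega> \<in> space M. \<delta> < (\<Sum>l<r. (c l \<omega>)\<^sup>2 * (p (Suc l) - p l))} + \<delta> / \<eta>\<^sup>2"
proof -
  have pmono: "p i \<le> p j" if "i \<le> j" "j \<le> r" for i j
    using that
  proof (induction j)
    case (Suc j) then show ?case using p[of j] by (cases "i = Suc j") auto
  qed simp
  have pnn: "0 \<le> p j" if "j \<le> r" for j using pmono[of 0 j] that p0 by simp
  \<comment> \<open>The term \<open>j = l\<close> is included: its coefficient is already known at
    time \<open>p l\<close>, so the cut-off acts before the bound is exceeded and no overshoot
    occurs.\<close>
  define q where "q l \<omega> = (\<Sum>j\<le>l. (c j \<omega>)\<^sup>2 * (p (Suc j) - p j))" for l \<omega>
  define d where "d l \<omega> = (if q l \<omega> \<le> \<delta> then c l \<omega> else 0)" for l \<omega>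
  define dW where "dW l \<omega> = W (p (Suc l)) \<omega> - W (p l) \<omega>" for l \<omega>
  define S where "S n \<omega> = (\<Sum>l<n. d l \<omega> * dW l \<omega>)" for n \<omega>
  have c_F: "c j \<in> borel_measurable (F (p l))" if "j \<le> l" "l < r" for j l
    using measurable_F_mono[OF c pmono] that by simp
  have q_F: "q l \<in> borel_measurable (F (p l))" if "l < r" for l
    unfolding q_def using c_F that by (intro borel_measurable_sum borel_measurable_times) auto
  have d_F: "d l \<in> borel_measurable (F (p l))" if "l < r" for l
    unfolding d_def using q_F[OF that] c_F[OF order_refl that] by measurable
  have dW_F: "dW j \<in> borel_measurable (F (p l))" if "j < l" "l \<le> r" for j l
    unfolding dW_def using that
    by (intro borel_measurable_diff measurable_F_mono[OF W_adapted]) (auto intro: pnn pmono)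
  have S_F: "S n \<in> borel_measurable (F (p n))" if "n \<le> r" for n
    unfolding S_def using that
    by (intro borel_measurable_sum borel_measurable_times)
      (auto intro!: dW_F measurable_F_mono[OF d_F pmono])
  \<comment> \<open>The \<open>c l\<close> carry no integrability. After the cut-off a single
    summand of \<open>q l\<close> is at most \<open>\<delta>\<close>, which bounds
    \<open>d l\<close> and makes all products below integrable.\<close>
  have d_bound: "\<bar>d l \<omega>\<bar> \<le> sqrt (\<delta> / (p (Suc l) - p l))" if "l < r" for l \<omega>
  proof (cases "q l \<omega> \<le> \<delta>")
    case True
    have "(c l \<omega>)\<^sup>2 * (p (Suc l) - p l) \<le> q l \<omega>"
      unfolding q_def using p that
      by (intro member_le_sum[of l "{..l}" "\<lambda>j. (c j \<omega>)\<^sup>2 * (p (Suc j) - p j)"])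
         (auto intro!: mult_nonneg_nonneg simp: less_imp_le)
    then have "(c l \<omega>)\<^sup>2 \<le> \<delta> / (p (Suc l) - p l)"
      using True p[OF that] by (simp add: field_simps)
    then show ?thesis using True by (simp add: d_def real_le_rsqrt)
  next
    case False then show ?thesis using \<delta> p[OF that] by (simp add: d_def)
  qed
  \<comment> \<open>Either \<open>q n\<close> is still at most \<open>\<delta>\<close> and dominates
    the whole sum, or \<open>d n\<close> vanishes and the sum does not grow.\<close>
  have dq: "(\<Sum>l<n. (d l \<omega>)\<^sup>2 * (p (Suc l) - p l)) \<le> \<delta>" if "n \<le> r" for n \<omega>
    using that
  proof (induction n)
    case (Suc n)
    show ?case
    proof (cases "q n \<omega> \<le> \<delta>")
      case True
      have "(\<Sum>l<Suc n. (d l \<omega>)\<^sup>2 * (p (Suc l) - p l)) \<le> (\<Sum>l<Suc n. (c l \<omega>)\<^sup>2 * (p (Suc l) - p l))"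
        using p Suc by (intro sum_mono mult_right_mono) (auto simp: d_def less_imp_le)
      also have "\<dots> = q n \<omega>" by (simp add: q_def lessThan_Suc_atMost)
      finally show ?thesis using True by simp
    next
      case False then show ?thesis using Suc by (simp add: d_def)
    qed
  qed (use \<delta> in auto)
  have d_int: "integrable M (\<lambda>\<omega>. (d l \<omega>)\<^sup>2)" if "l < r" for l
    using d_bound[OF that] measurable_F_M[OF d_F[OF that]]
    by (intro integrable_const_bound[where B="(sqrt (\<delta> / (p (Suc l) - p l)))\<^sup>2"])
       (auto intro!: AE_I2 order_trans[OF _ abs_ge_self] simp: abs_le_square_iff[symmetric])
  \<comment> \<open>Discrete Ito isometry: \<open>dW n\<close> is centred and independent of
    \<open>F (p n)\<close>, so the cross term \<open>2 * S n * d n * dW n\<close> has mean zero and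
    only the squares remain.\<close>
  have S2: "integrable M (\<lambda>\<omega>. (S n \<omega>)\<^sup>2) \<and>
      expectation (\<lambda>\<omega>. (S n \<omega>)\<^sup>2) = expectation (\<lambda>\<omega>. \<Sum>l<n. (d l \<omega>)\<^sup>2 * (p (Suc l) - p l))"
    if "n \<le> r" for n
    using that
  proof (induction n)
    case (Suc n)
    then have n: "n < r" and IH: "integrable M (\<lambda>\<omega>. (S n \<omega>)\<^sup>2)"
      "expectation (\<lambda>\<omega>. (S n \<omega>)\<^sup>2) = expectation (\<lambda>\<omega>. \<Sum>l<n. (d l \<omega>)\<^sup>2 * (p (Suc l) - p l))" by auto
    have pn: "0 \<le> p n" "p n < p (Suc n)" using p[OF n] pnn[of n] n by auto
    have SM: "S n \<in> borel_measurable M" using measurable_F_M[OF S_F] n by simp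
    have Sint: "integrable M (S n)"
      using square_integrable_imp_integrable[OF SM IH(1)] .
    have dM: "d n \<in> borel_measurable M" using measurable_F_M[OF d_F[OF n]] .
    have Sd: "integrable M (\<lambda>\<omega>. 2 * S n \<omega> * d n \<omega>)"
    proof (rule Bochner_Integration.integrable_bound)
      show "integrable M (\<lambda>\<omega>. 2 * sqrt (\<delta> / (p (Suc n) - p n)) * S n \<omega>)" using Sint by simp
      show "AE \<omega> in M. norm (2 * S n \<omega> * d n \<omega>) \<le> norm (2 * sqrt (\<delta> / (p (Suc n) - p n)) * S n \<omega>)"
        using mult_right_mono[OF d_bound[OF n] abs_ge_zero] \<delta> pn by (auto simp: abs_mult mult_ac)
    qed (use SM dM in measurable)
    have SdF: "(\<lambda>\<omega>. 2 * S n \<omega> * d n \<omega>) \<in> borel_measurable (F (p n))"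
      using S_F[OF less_imp_le[OF n]] d_F[OF n] by measurable
    have dF: "(\<lambda>\<omega>. (d n \<omega>)\<^sup>2) \<in> borel_measurable (F (p n))"
      using d_F[OF n] by measurable
    note mom = increment_moments[OF pn]
    have 1: "integrable M (\<lambda>\<omega>. 2 * S n \<omega> * d n \<omega> * dW n \<omega>)"
      using integrable_times_increment[OF pn SdF, of "\<lambda>y. y"] Sd mom(1)[of 1] by (simp add: dW_def)
    have 2: "expectation (\<lambda>\<omega>. 2 * S n \<omega> * d n \<omega> * dW n \<omega>) = 0"
      using expectation_times_increment[OF pn SdF, of "\<lambda>y. y"] Sd mom(1)[of 1] mom(2) by (simp add: dW_def)
    have 3: "integrable M (\<lambda>\<omega>. (d n \<omega>)\<^sup>2 * (dW n \<omega>)\<^sup>2)"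
      using integrable_times_increment[OF pn dF, of "\<lambda>y. y\<^sup>2"] d_int[OF n] mom(1)[of 2] by (simp add: dW_def)
    have 4: "expectation (\<lambda>\<omega>. (d n \<omega>)\<^sup>2 * (dW n \<omega>)\<^sup>2) = expectation (\<lambda>\<omega>. (d n \<omega>)\<^sup>2) * (p (Suc n) - p n)"
      using expectation_times_increment[OF pn dF, of "\<lambda>y. y\<^sup>2"] d_int[OF n] mom(1)[of 2] mom(3) by (simp add: dW_def)
    have eq: "(\<lambda>\<omega>. (S (Suc n) \<omega>)\<^sup>2) =
        (\<lambda>\<omega>. (S n \<omega>)\<^sup>2 + 2 * S n \<omega> * d n \<omega> * dW n \<omega> + (d n \<omega>)\<^sup>2 * (dW n \<omega>)\<^sup>2)"
      by (simp add: S_def power2_eq_square algebra_simps fun_eq_iff)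
    have dsum: "integrable M (\<lambda>\<omega>. \<Sum>l<n. (d l \<omega>)\<^sup>2 * (p (Suc l) - p l))"
      using d_int n by auto
    show ?case
      using IH 1 2 3 4 d_int[OF n] dsum by (simp add: eq)
  qed (simp add: S_def)
  have SM: "S r \<in> borel_measurable M" using measurable_F_M[OF S_F] by simp
  have cM: "c l \<in> borel_measurable M" if "l < r" for l using measurable_F_M[OF c] that .
  have WM: "W (p l) \<in> borel_measurable M" if "l \<le> r" for l using W_measurable pnn that by simp
  have "expectation (\<lambda>\<omega>. \<Sum>l<r. (d l \<omega>)\<^sup>2 * (p (Suc l) - p l)) \<le> expectation (\<lambda>_. \<delta>)"
    by (intro integral_mono Bochner_Integration.integrable_sum integrable_mult_left d_int dq) auto
  then have ES: "expectation (\<lambda>\<omega>. (S r \<omega>)\<^sup>2) \<le> \<delta>"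
    using S2[of r] by (simp add: prob_space)
  have "prob {\<omega> \<in> space M. \<eta>\<^sup>2 \<le> (S r \<omega>)\<^sup>2} \<le> expectation (\<lambda>\<omega>. (S r \<omega>)\<^sup>2) / \<eta>\<^sup>2"
    using S2[of r] \<eta> by (intro integral_Markov_inequality_measure[where A="{}"]) auto
  also have "\<dots> \<le> \<delta> / \<eta>\<^sup>2" using ES \<eta> by (simp add: divide_right_mono)
  finally have cheb: "prob {\<omega> \<in> space M. \<eta>\<^sup>2 \<le> (S r \<omega>)\<^sup>2} \<le> \<delta> / \<eta>\<^sup>2" .
  have m1: "{\<omega> \<in> space M. \<delta> < (\<Sum>l<r. (c l \<omega>)\<^sup>2 * (p (Suc l) - p l))} \<in> events"
    using cM by measurable
  have m2: "{\<omega> \<in> space M. \<eta>\<^sup>2 \<le> (S r \<omega>)\<^sup>2} \<in> events"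
    using SM by measurable
  \<comment> \<open>Outside the first event every \<open>q l\<close> stays below the full sum, hence
    below \<open>\<delta>\<close>; nothing is cut off and \<open>S r\<close> is the original
    sum.\<close>
  have "{\<omega> \<in> space M. \<eta> < \<bar>\<Sum>l<r. c l \<omega> * (W (p (Suc l)) \<omega> - W (p l) \<omega>)\<bar>} \<subseteq>
      {\<omega> \<in> space M. \<delta> < (\<Sum>l<r. (c l \<omega>)\<^sup>2 * (p (Suc l) - p l))} \<union> {\<omega> \<in> space M. \<eta>\<^sup>2 \<le> (S r \<omega>)\<^sup>2}"
  proof (intro subsetI, elim CollectE conjE, rule ccontr)
    fix \<omega> assume \<omega>: "\<omega> \<in> space M" "\<eta> < \<bar>\<Sum>l<r. c l \<omega> * (W (p (Suc l)) \<omega> - W (p l) \<omega>)\<bar>"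
      "\<omega> \<notin> {\<omega> \<in> space M. \<delta> < (\<Sum>l<r. (c l \<omega>)\<^sup>2 * (p (Suc l) - p l))} \<union> {\<omega> \<in> space M. \<eta>\<^sup>2 \<le> (S r \<omega>)\<^sup>2}"
    have "q l \<omega> \<le> \<delta>" if "l < r" for l
    proof -
      have "q l \<omega> \<le> (\<Sum>l<r. (c l \<omega>)\<^sup>2 * (p (Suc l) - p l))"
        unfolding q_def using that p by (intro sum_mono2) (auto simp: less_imp_le)
      then show ?thesis using \<omega> by simp
    qed
    then have "S r \<omega> = (\<Sum>l<r. c l \<omega> * (W (p (Suc l)) \<omega> - W (p l) \<omega>))"
      unfolding S_def d_def dW_def by (intro sum.cong) auto
    then have "\<eta> < \<bar>S r \<omega>\<bar>" using \<omega> by simp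
    then have "\<eta>\<^sup>2 \<le> (S r \<omega>)\<^sup>2" using \<eta> by (simp add: abs_le_square_iff[symmetric])
    then show False using \<omega> by simp
  qed
  then have "prob {\<omega> \<in> space M. \<eta> < \<bar>\<Sum>l<r. c l \<omega> * (W (p (Suc l)) \<omega> - W (p l) \<omega>)\<bar>} \<le>
      prob ({\<omega> \<in> space M. \<delta> < (\<Sum>l<r. (c l \<omega>)\<^sup>2 * (p (Suc l) - p l))} \<union> {\<omega> \<in> space M. \<eta>\<^sup>2 \<le> (S r \<omega>)\<^sup>2})"
    using m1 m2 by (intro finite_measure_mono) auto
  also have "\<dots> \<le> prob {\<omega> \<in> space M. \<delta> < (\<Sum>l<r. (c l \<omega>)\<^sup>2 * (p (Suc l) - p l))} +
      prob {\<omega> \<in> space M. \<eta>\<^sup>2 \<le> (S r \<omega>)\<^sup>2}"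
    using m1 m2 by (rule measure_Un_le)
  finally show ?thesis using cheb by simp
qed

end


section \<open>From simple processes to the Ito integral\<close>

text \<open>A \<open>simple_process\<close> whose coefficients may be unbounded, as the Euler
  coefficients \<open>\<sigma> * sqrt (X s)\<close> are.\<close>

definition adapted_steps ::
    "(real \<Rightarrow> 'a measure) \<Rightarrow> nat \<Rightarrow> (nat \<Rightarrow> real) \<Rightarrow> (nat \<Rightarrow> 'a \<Rightarrow> real) \<Rightarrow> bool" where
  "adapted_steps F m \<tau> \<xi> \<longleftrightarrow>
     0 \<le> \<tau> 0 \<and> (\<forall>i<m. \<tau> i < \<tau> (Suc i) \<and> \<xi> i \<in> borel_measurable (F (\<tau> i)))"

lemma adapted_steps_simple_process: "simple_process M F m \<tau> \<xi> \<Longrightarrow> adapted_steps F m \<tau> \<xi>"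
  by (simp add: simple_process_def adapted_steps_def)

text \<open>Turns the merged jump times of two step processes into the points of a
  partition.\<close>

lemma finite_set_as_increasing_sequence:
  fixes P :: "real set"
  assumes "finite P" "P \<noteq> {}"
  shows "\<exists>(p :: nat \<Rightarrow> real) r. (\<forall>i j. i < j \<longrightarrow> j \<le> r \<longrightarrow> p i < p j) \<and> p ` {..r} = P"
proof -
  let ?l = "sorted_list_of_set P"
  have len: "length ?l = Suc (card P - 1)" using assms by (simp add: card_gt_0_iff)
  have "?l ! i < ?l ! j" if "i < j" "j \<le> card P - 1" for i j
    using that len strict_sorted_list_of_set[of P] by (auto simp: sorted_wrt_iff_nth_less)
  moreover have "(!) ?l ` {..card P - 1} = P"
  proof -
    have "(!) ?l ` {..card P - 1} = set ?l"
      by (simp only: lessThan_Suc_atMost[symmetric] len[symmetric] set_conv_nth) auto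
    then show ?thesis using assms by simp
  qed
  ultimately show ?thesis by blast
qed

text \<open>A telescoping sum stopped at \<open>y\<close>: since \<open>y = p a\<close> is itself a
  partition point, the condition selects exactly the indices \<open>l < a\<close>.\<close>

lemma sum_increments_upto:
  fixes p :: "nat \<Rightarrow> real" and g :: "real \<Rightarrow> real"
  assumes p: "\<And>i j. i < j \<Longrightarrow> j \<le> r \<Longrightarrow> p i < p j" and y: "y \<in> p ` {..r}"
  shows "(\<Sum>l<r. (if p (Suc l) \<le> y then g (p (Suc l)) - g (p l) else 0)) = g y - g (p 0)"
proof -
  obtain a where a: "a \<le> r" "y = p a" using y by auto
  have "p (Suc l) \<le> p a \<longleftrightarrow> l < a" if "l < r" for l
    using p[of "Suc l" a] p[of a "Suc l"] a that
    by (cases "Suc l" a rule: linorder_cases) auto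
  then have "(\<Sum>l<r. (if p (Suc l) \<le> y then g (p (Suc l)) - g (p l) else 0)) =
      (\<Sum>l<r. (if l \<in> {..<a} then g (p (Suc l)) - g (p l) else 0))"
    using a by (intro sum.cong) auto
  also have "\<dots> = (\<Sum>l<a. g (p (Suc l)) - g (p l))"
    using a by (subst sum.inter_restrict[symmetric]) (auto intro!: sum.cong)
  also have "\<dots> = g y - g (p 0)"
    using a by (simp add: sum_lessThan_telescope[of "\<lambda>l. g (p l)"])
  finally show ?thesis .
qed

lemma sum_indicator_partition:
  fixes p :: "nat \<Rightarrow> real"
  assumes "\<And>l. l < r \<Longrightarrow> p l \<le> p (Suc l)"
  shows "(\<Sum>l<r. indicator {p l<..p (Suc l)} s) = (indicator {p 0<..p r} s :: real)"
  using assms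
proof (induction r)
  case (Suc r)
  have "p 0 \<le> p n" if "n \<le> r" for n
    using that
  proof (induction n)
    case (Suc n) then show ?case using Suc.prems \<open>\<And>l. l < Suc r \<Longrightarrow> p l \<le> p (Suc l)\<close>[of n] by simp
  qed simp
  then have "p 0 \<le> p r" "p r \<le> p (Suc r)" using Suc.prems by auto
  moreover have "(\<Sum>l<r. indicator {p l<..p (Suc l)} s) = (indicator {p 0<..p r} s :: real)"
    using Suc by simp
  ultimately show ?case by (simp add: indicator_def)
qed simp

text \<open>On a partition that contains its jump times, a step process is constant between
  consecutive points.\<close>

lemma adapted_steps_refinement:
  fixes p :: "nat \<Rightarrow> real"
  assumes st: "adapted_steps F m \<tau> \<xi>"
    and p: "\<And>i j. i < j \<Longrightarrow> j \<le> r \<Longrightarrow> p i < p j" and p0: "p 0 = 0" and pr: "p r = u"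
    and sub: "\<And>i. i \<le> m \<Longrightarrow> min (\<tau> i) u \<in> p ` {..r}"
  shows simple_value_refinement: "l < r \<Longrightarrow> s \<in> {p l<..p (Suc l)} \<Longrightarrow>
      simple_value m \<tau> \<xi> s \<omega> = simple_value m \<tau> \<xi> (p (Suc l)) \<omega>"
    and jump_time_refinement: "l < r \<Longrightarrow> i < m \<Longrightarrow> \<tau> i < p (Suc l) \<Longrightarrow> \<tau> i \<le> p l"
    and simple_integral_refinement: "simple_integral W m \<tau> \<xi> u \<omega> =
      (\<Sum>l<r. simple_value m \<tau> \<xi> (p (Suc l)) \<omega> * (W (p (Suc l)) \<omega> - W (p l) \<omega>))"
proof -
  have pu: "p l \<le> u" if "l \<le> r" for l
    using p[of l r] that pr by (cases "l = r") auto
  \<comment> \<open>A jump time strictly inside a cell would, after capping at \<open>u\<close>, be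
    a partition point strictly between two neighbours. So the comparison with
    \<open>\<tau> i\<close> has the same outcome throughout a cell.\<close>
  have key: "s \<le> \<tau> i \<longleftrightarrow> p (Suc l) \<le> \<tau> i" if h: "l < r" "s \<in> {p l<..p (Suc l)}" "i \<le> m" for l s i
  proof
    assume s: "s \<le> \<tau> i"
    obtain a where a: "a \<le> r" "min (\<tau> i) u = p a" using sub[OF h(3)] by auto
    have "p l < p a" using s h pu[of "Suc l"] a(2) by (simp add: min_def split: if_splits)
    then have "\<not> a < l" "a \<noteq> l" using p[of a l] h by auto
    then have "p (Suc l) \<le> p a" using p[of "Suc l" a] a by (cases "a = Suc l") auto
    then show "p (Suc l) \<le> \<tau> i" using a(2) by linarith
  qed (use h in auto)
  \<comment> \<open>As a difference of two threshold functions the indicator splits the sum into two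
    sums that telescope by \<open>sum_increments_upto\<close>.\<close>
  have ind: "indicator {\<tau> i<..\<tau> (Suc i)} s = (if s \<le> \<tau> (Suc i) then 1 else 0) - (if s \<le> \<tau> i then 1 else (0::real))"
    if "i < m" for i s
    using st that by (auto simp: adapted_steps_def indicator_def dest!: spec[of _ i])
  show "simple_value m \<tau> \<xi> s \<omega> = simple_value m \<tau> \<xi> (p (Suc l)) \<omega>"
    if "l < r" "s \<in> {p l<..p (Suc l)}" for l s
    unfolding simple_value_def by (intro sum.cong) (use key[OF that] in \<open>auto simp: ind\<close>)
  show "\<tau> i \<le> p l" if "l < r" "i < m" "\<tau> i < p (Suc l)" for l i
  proof (rule ccontr)
    assume "\<not> \<tau> i \<le> p l"
    then show False using key[of l "\<tau> i" i] that by auto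
  qed
  have "(\<Sum>l<r. indicator {\<tau> i<..\<tau> (Suc i)} (p (Suc l)) * (W (p (Suc l)) \<omega> - W (p l) \<omega>)) =
      W (min (\<tau> (Suc i)) u) \<omega> - W (min (\<tau> i) u) \<omega>" (is "?L = _") if i: "i < m" for i
  proof -
    have "?L = (\<Sum>l<r. (if p (Suc l) \<le> min (\<tau> (Suc i)) u then W (p (Suc l)) \<omega> - W (p l) \<omega> else 0) -
        (if p (Suc l) \<le> min (\<tau> i) u then W (p (Suc l)) \<omega> - W (p l) \<omega> else 0))"
      using pu by (intro sum.cong) (auto simp: ind[OF i])
    also have "\<dots> = (W (min (\<tau> (Suc i)) u) \<omega> - W (p 0) \<omega>) - (W (min (\<tau> i) u) \<omega> - W (p 0) \<omega>)"
      unfolding sum_subtractf using sub[of i] sub[of "Suc i"] i p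
      by (subst (1 2) sum_increments_upto[of r p _ "\<lambda>t. W t \<omega>"]) auto
    finally show ?thesis by simp
  qed
  then have "simple_integral W m \<tau> \<xi> u \<omega> = (\<Sum>i<m. \<xi> i \<omega> *
      (\<Sum>l<r. indicator {\<tau> i<..\<tau> (Suc i)} (p (Suc l)) * (W (p (Suc l)) \<omega> - W (p l) \<omega>)))"
    unfolding simple_integral_def by (intro sum.cong) auto
  also have "\<dots> = (\<Sum>l<r. simple_value m \<tau> \<xi> (p (Suc l)) \<omega> * (W (p (Suc l)) \<omega> - W (p l) \<omega>))"
    unfolding simple_value_def sum_distrib_left sum_distrib_right
    by (subst sum.swap) (simp add: mult_ac)
  finally show "simple_integral W m \<tau> \<xi> u \<omega> =
      (\<Sum>l<r. simple_value m \<tau> \<xi> (p (Suc l)) \<omega> * (W (p (Suc l)) \<omega> - W (p l) \<omega>))" .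
qed

lemma simple_value_nonpos: "adapted_steps F m \<tau> \<xi> \<Longrightarrow> s \<le> 0 \<Longrightarrow> simple_value m \<tau> \<xi> s \<omega> = 0"
proof -
  assume st: "adapted_steps F m \<tau> \<xi>" and s: "s \<le> 0"
  have "0 \<le> \<tau> i" if "i \<le> m" for i
    using that
  proof (induction i)
    case (Suc i) then show ?case using st by (auto simp: adapted_steps_def dest!: spec[of _ i])
  qed (use st in \<open>simp add: adapted_steps_def\<close>)
  then have "s \<notin> {\<tau> i<..\<tau> (Suc i)}" if "i < m" for i using s that[THEN less_imp_le] by fastforce
  then show ?thesis by (auto simp: simple_value_def intro!: sum.neutral)
qed

lemma simple_value_borel [measurable]: "(\<lambda>s. simple_value m \<tau> \<xi> s \<omega>) \<in> borel_measurable borel"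
  unfolding simple_value_def by measurable

lemma simple_value_bounded: "\<bar>simple_value m \<tau> \<xi> s \<omega>\<bar> \<le> (\<Sum>i<m. \<bar>\<xi> i \<omega>\<bar>)"
proof -
  have "\<bar>\<xi> i \<omega> * indicator {\<tau> i<..\<tau> (Suc i)} s\<bar> \<le> \<bar>\<xi> i \<omega>\<bar>" for i
    by (cases "s \<in> {\<tau> i<..\<tau> (Suc i)}") auto
  then show ?thesis
    unfolding simple_value_def by (intro order_trans[OF sum_abs] sum_mono)
qed

text \<open>Rests on (x - y)^2 <= 2 x^2 + 2 y^2. It replaces the triangle inequality for squared L2
  distances, at the price of a factor 2.\<close>

lemma set_integrable_square_diff:
  fixes f g :: "'b \<Rightarrow> real"
  assumes "set_borel_measurable N A f" "set_borel_measurable N A g"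
    and "set_integrable N A (\<lambda>s. (f s)\<^sup>2)" "set_integrable N A (\<lambda>s. (g s)\<^sup>2)"
  shows "set_integrable N A (\<lambda>s. (f s - g s)\<^sup>2)"
    and "(LINT s:A|N. (f s - g s)\<^sup>2) \<le> 2 * (LINT s:A|N. (f s)\<^sup>2) + 2 * (LINT s:A|N. (g s)\<^sup>2)"
proof -
  have le: "(x - y)\<^sup>2 \<le> 2 * x\<^sup>2 + 2 * y\<^sup>2" for x y :: real
    using zero_le_power2[of "x + y"] by (simp add: power2_eq_square algebra_simps)
  have b: "set_integrable N A (\<lambda>s. 2 * (f s)\<^sup>2 + 2 * (g s)\<^sup>2)"
    using assms by simp
  have eq: "indicator A s *\<^sub>R (f s - g s)\<^sup>2 = (indicator A s *\<^sub>R f s - indicator A s *\<^sub>R g s)\<^sup>2" for s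
    by (simp add: indicator_def)
  show 1: "set_integrable N A (\<lambda>s. (f s - g s)\<^sup>2)"
    unfolding set_integrable_def
  proof (rule Bochner_Integration.integrable_bound[OF b[unfolded set_integrable_def]])
    show "(\<lambda>s. indicator A s *\<^sub>R (f s - g s)\<^sup>2) \<in> borel_measurable N"
      unfolding eq using assms(1,2) unfolding set_borel_measurable_def by measurable
  qed (use le in \<open>auto simp: indicator_def\<close>)
  have "(LINT s:A|N. (f s - g s)\<^sup>2) \<le> (LINT s:A|N. 2 * (f s)\<^sup>2 + 2 * (g s)\<^sup>2)"
    using le by (intro set_integral_mono 1 b) auto
  then show "(LINT s:A|N. (f s - g s)\<^sup>2) \<le> 2 * (LINT s:A|N. (f s)\<^sup>2) + 2 * (LINT s:A|N. (g s)\<^sup>2)"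
    using assms by simp
qed

lemma set_integrable_simple_value_square:
  "set_integrable lborel {0..u} (\<lambda>s. (simple_value m \<tau> \<xi> s \<omega>)\<^sup>2)"
  unfolding set_integrable_def
proof (rule Bochner_Integration.integrable_bound)
  show "integrable lborel (\<lambda>s. indicator {0..u} s *\<^sub>R (\<Sum>i<m. \<bar>\<xi> i \<omega>\<bar>)\<^sup>2)"
    by (cases "0 \<le> u") (auto simp: integrable_indicator_iff)
  show "AE s in lborel. norm (indicator {0..u} s *\<^sub>R (simple_value m \<tau> \<xi> s \<omega>)\<^sup>2) \<le>
      norm (indicator {0..u} s *\<^sub>R (\<Sum>i<m. \<bar>\<xi> i \<omega>\<bar>)\<^sup>2)"
    using power_mono[OF simple_value_bounded abs_ge_zero, of m \<tau> \<xi> _ \<omega> 2]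
    by (auto simp: indicator_def)
qed measurable

context brownian_motion
begin

text \<open>On a common refinement of the jump times the difference of the integrals is one discrete
  sum, and the squared L2 distance of the integrands is exactly its quadratic variation. So
  \<open>lenglart_discrete\<close> applies.\<close>

lemma lenglart_adapted_steps:
  assumes st: "adapted_steps F m \<tau> \<xi>" and st': "adapted_steps F m' \<tau>' \<xi>'"
    and u: "0 \<le> u" and \<delta>: "\<delta> > 0" and \<eta>: "\<eta> > 0"
  shows "prob {\<omega> \<in> space M. \<eta> < \<bar>simple_integral W m \<tau> \<xi> u \<omega> - simple_integral W m' \<tau>' \<xi>' u \<omega>\<bar>} \<le>
    prob {\<omega> \<in> space M. \<delta> < (LINT s:{0..u}|lborel. (simple_value m \<tau> \<xi> s \<omega> - simple_value m' \<tau>' \<xi>' s \<omega>)\<^sup>2)}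
      + \<delta> / \<eta>\<^sup>2"
proof -
  have \<tau>pos: "0 \<le> \<tau> i" if "i \<le> m" "adapted_steps F m \<tau> \<xi>" for i m \<tau> and \<xi> :: "nat \<Rightarrow> 'a \<Rightarrow> real"
    using that
  proof (induction i)
    case (Suc i) then show ?case by (auto simp: adapted_steps_def dest!: spec[of _ i])
  qed (simp add: adapted_steps_def)
  \<comment> \<open>Jump times of both processes capped at \<open>u\<close>, with 0 and
    \<open>u\<close> added so that the partition spans the whole interval.\<close>
  define P where "P = {0, u} \<union> (\<lambda>i. min (\<tau> i) u) ` {..m} \<union> (\<lambda>i. min (\<tau>' i) u) ` {..m'}"
  have "finite P" "P \<noteq> {}" by (auto simp: P_def)
  from finite_set_as_increasing_sequence[OF this] obtain p :: "nat \<Rightarrow> real" and r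
    where p': "\<forall>i j. i < j \<longrightarrow> j \<le> r \<longrightarrow> p i < p j" and P: "p ` {..r} = P"
    by blast
  have p: "p i < p j" if "i < j" "j \<le> r" for i j using p' that by blast
  have P0u: "y \<in> {0..u}" if "y \<in> P" for y
    using that u \<tau>pos[OF _ st] \<tau>pos[OF _ st'] by (auto simp: P_def)
  have pin: "p l \<in> {0..u}" if "l \<le> r" for l using P0u[of "p l"] that P by blast
  have p0: "p 0 = 0"
  proof -
    have "0 \<in> p ` {..r}" unfolding P by (simp add: P_def)
    then obtain a where "a \<le> r" "p a = 0" by force
    then show ?thesis using p[of 0 a] pin[of 0] by (cases "a = 0") auto
  qed
  have pr: "p r = u"
  proof -
    have "u \<in> p ` {..r}" unfolding P by (simp add: P_def)
    then obtain a where "a \<le> r" "p a = u" by force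
    then show ?thesis using p[of a r] pin[of r] by (cases "a = r") auto
  qed
  have sub: "min (\<tau> i) u \<in> p ` {..r}" if "i \<le> m" for i unfolding P using that by (auto simp: P_def)
  have sub': "min (\<tau>' i) u \<in> p ` {..r}" if "i \<le> m'" for i unfolding P using that by (auto simp: P_def)
  note R = adapted_steps_refinement[OF st p p0 pr sub] and R' = adapted_steps_refinement[OF st' p p0 pr sub']
  \<comment> \<open>The value on a cell is known at its left end: a step that begins before
    \<open>p (Suc l)\<close> begins no later than \<open>p l\<close>, and the others contribute
    zero.\<close>
  have meas: "simple_value m \<tau> \<xi> (p (Suc l)) \<in> borel_measurable (F (p l))"
    if st: "adapted_steps F m \<tau> \<xi>" and sub: "\<And>i. i \<le> m \<Longrightarrow> min (\<tau> i) u \<in> p ` {..r}" and "l < r"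
    for l m \<tau> \<xi>
  proof -
    have "(\<lambda>\<omega>. \<xi> i \<omega> * indicator {\<tau> i<..\<tau> (Suc i)} (p (Suc l))) \<in> borel_measurable (F (p l))" if "i < m" for i
    proof (cases "\<tau> i < p (Suc l)")
      case True
      then have "\<tau> i \<le> p l"
        using jump_time_refinement[OF st p p0 pr sub \<open>l < r\<close> that] by simp
      then have "\<xi> i \<in> borel_measurable (F (p l))"
        using measurable_F_mono[of "\<xi> i" "\<tau> i"] st that by (auto simp: adapted_steps_def)
      then show ?thesis by measurable
    qed (simp add: indicator_def)
    then show ?thesis unfolding simple_value_def by (intro borel_measurable_sum) auto
  qed
  define c where "c l \<omega> = simple_value m \<tau> \<xi> (p (Suc l)) \<omega> - simple_value m' \<tau>' \<xi>' (p (Suc l)) \<omega>" for l \<omega>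
  have c: "c l \<in> borel_measurable (F (p l))" if "l < r" for l
    unfolding c_def using meas[OF st sub that] meas[OF st' sub' that] by measurable
  have 1: "simple_integral W m \<tau> \<xi> u \<omega> - simple_integral W m' \<tau>' \<xi>' u \<omega> =
      (\<Sum>l<r. c l \<omega> * (W (p (Suc l)) \<omega> - W (p l) \<omega>))" for \<omega>
  proof -
    have "simple_integral W m \<tau> \<xi> u \<omega> =
        (\<Sum>l<r. simple_value m \<tau> \<xi> (p (Suc l)) \<omega> * (W (p (Suc l)) \<omega> - W (p l) \<omega>))" by (rule R(3))
    moreover have "simple_integral W m' \<tau>' \<xi>' u \<omega> =
        (\<Sum>l<r. simple_value m' \<tau>' \<xi>' (p (Suc l)) \<omega> * (W (p (Suc l)) \<omega> - W (p l) \<omega>))" by (rule R'(3))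
    ultimately show ?thesis by (simp add: c_def sum_subtractf left_diff_distrib)
  qed
  have 2: "(LINT s:{0..u}|lborel. (simple_value m \<tau> \<xi> s \<omega> - simple_value m' \<tau>' \<xi>' s \<omega>)\<^sup>2) =
      (\<Sum>l<r. (c l \<omega>)\<^sup>2 * (p (Suc l) - p l))" for \<omega>
  proof -
    let ?V = "\<lambda>s. (simple_value m \<tau> \<xi> s \<omega> - simple_value m' \<tau>' \<xi>' s \<omega>)\<^sup>2"
    have "indicator {0..u} s *\<^sub>R ?V s = (\<Sum>l<r. (c l \<omega>)\<^sup>2 * indicator {p l<..p (Suc l)} s)" for s
    proof -
      \<comment> \<open>Reconciles the closed interval of integration with the left-open cells,
        which leave out the point 0.\<close>
      have "?V s = 0" if "s \<le> 0"
        using simple_value_nonpos[OF st that] simple_value_nonpos[OF st' that] by simp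
      then have "indicator {0..u} s *\<^sub>R ?V s = ?V s * indicator {p 0<..p r} s"
        using p0 pr by (cases "s \<le> 0") (auto simp: indicator_def)
      also have "\<dots> = (\<Sum>l<r. ?V s * indicator {p l<..p (Suc l)} s)"
        using p by (subst sum_indicator_partition[symmetric]) (auto simp: sum_distrib_left intro: less_imp_le)
      also have "\<dots> = (\<Sum>l<r. (c l \<omega>)\<^sup>2 * indicator {p l<..p (Suc l)} s)"
        using R(1)[of _ s \<omega>] R'(1)[of _ s \<omega>]
        by (intro sum.cong) (auto simp: c_def indicator_def)
      finally show ?thesis .
    qed
    then have "(LINT s:{0..u}|lborel. ?V s) = (LINT s|lborel. (\<Sum>l<r. (c l \<omega>)\<^sup>2 * indicator {p l<..p (Suc l)} s))"
      unfolding set_lebesgue_integral_def by simp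
    also have "\<dots> = (\<Sum>l<r. (c l \<omega>)\<^sup>2 * (p (Suc l) - p l))"
    proof -
      have "emeasure lborel {p l<..p (Suc l)} < \<infinity>" for l
        by (cases "p l \<le> p (Suc l)") auto
      moreover have "p l \<le> p (Suc l)" if "l < r" for l using p[of l "Suc l"] that by simp
      ultimately show ?thesis
        by (subst Bochner_Integration.integral_sum) (auto intro!: sum.cong simp: integrable_indicator_iff)
    qed
    finally show ?thesis .
  qed
  show ?thesis
    unfolding 1 2 using p by (intro lenglart_discrete c \<delta> \<eta>) (auto simp: p0)
qed

text \<open>The given steps are compared with the approximants from the definition of the integral;
  letting these converge removes their own errors. The squared distance enters through a measurable
  majorant \<open>Q\<close>. If \<open>Q\<close> and the error of the approximant are both at most
  \<open>\<delta>\<close>, the two step processes are within \<open>4 * \<delta>\<close>, and half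
  of \<open>\<eta>\<close> is left for their integrals, whence 16 = 4 * 2^2.\<close>

lemma prob_simple_integral_minus_ito_le:
  assumes ito: "has_ito_integral M F W H u J" and st: "adapted_steps F m \<tau> \<xi>"
    and u: "0 \<le> u" and Q: "Q \<in> borel_measurable M"
    and le: "AE \<omega> in M. (LINT s:{0..u}|lborel. (simple_value m \<tau> \<xi> s \<omega> - H s \<omega>)\<^sup>2) \<le> Q \<omega>"
    and \<delta>: "\<delta> > 0" and \<eta>: "\<eta> > 0"
  shows "prob {\<omega> \<in> space M. \<eta> < \<bar>simple_integral W m \<tau> \<xi> u \<omega> - J \<omega>\<bar>} \<le>
    prob {\<omega> \<in> space M. \<delta> < Q \<omega>} + 16 * \<delta> / \<eta>\<^sup>2"
proof -
  obtain mn \<tau>n \<xi>n where sp: "\<And>n. simple_process M F (mn n) (\<tau>n n) (\<xi>n n)"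
    and tQ: "tendsto_in_prob M
          (\<lambda>n \<omega>. LINT s:{0..u}|lborel. (simple_value (mn n) (\<tau>n n) (\<xi>n n) s \<omega> - H s \<omega>)\<^sup>2) (\<lambda>_. 0)"
    and tJ: "tendsto_in_prob M (\<lambda>n. simple_integral W (mn n) (\<tau>n n) (\<xi>n n) u) J"
    using ito unfolding has_ito_integral_def by blast
  define Qn where "Qn n \<omega> = (LINT s:{0..u}|lborel. (simple_value (mn n) (\<tau>n n) (\<xi>n n) s \<omega> - H s \<omega>)\<^sup>2)" for n \<omega>
  have Qn: "Qn n \<in> borel_measurable M" for n unfolding Qn_def using tQ by (simp add: tendsto_in_prob_def)
  have Jn: "simple_integral W (mn n) (\<tau>n n) (\<xi>n n) u \<in> borel_measurable M" for n
    using tJ by (simp add: tendsto_in_prob_def)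
  have J: "J \<in> borel_measurable M" using tJ by (simp add: tendsto_in_prob_def)
  have simple_meas: "simple_integral W m \<tau> \<xi> u \<in> borel_measurable M"
  proof -
    have \<tau>pos: "0 \<le> \<tau> i" if "i \<le> m" for i
      using that
    proof (induction i)
      case (Suc i) then show ?case using st by (auto simp: adapted_steps_def dest!: spec[of _ i])
    qed (use st in \<open>simp add: adapted_steps_def\<close>)
    show ?thesis unfolding simple_integral_def using st u \<tau>pos
      by (intro borel_measurable_sum borel_measurable_times borel_measurable_diff W_measurable)
        (auto simp: adapted_steps_def intro: measurable_F_M)
  qed
  \<comment> \<open>Sections of a jointly measurable function are measurable; this is where
    progressiveness of \<open>H\<close> is used.\<close>
  have H: "set_borel_measurable lborel {0..u} (\<lambda>s. H s \<omega>)" if \<omega>: "\<omega> \<in> space M" for \<omega>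
  proof -
    have "(\<lambda>(s, \<omega>). H s \<omega>) \<in> borel_measurable (restrict_space borel {0..u} \<Otimes>\<^sub>M F u)"
      using ito u by (simp add: has_ito_integral_def progressive_on_def)
    from measurable_compose[OF measurable_Pair2'[of \<omega> "F u"] this]
    have "(\<lambda>s. H s \<omega>) \<in> borel_measurable (restrict_space borel {0..u})"
      using \<omega> space_F by simp
    then show ?thesis
      by (subst (asm) borel_measurable_restrict_space_iff) (auto simp: set_borel_measurable_def)
  qed
  have Hint: "AE \<omega> in M. set_integrable lborel {0..u} (\<lambda>s. (H s \<omega>)\<^sup>2)"
    using ito by (simp add: has_ito_integral_def)
  have bound: "prob {\<omega> \<in> space M. \<eta> < \<bar>simple_integral W m \<tau> \<xi> u \<omega> - J \<omega>\<bar>} \<le>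
      prob {\<omega> \<in> space M. \<delta> < Q \<omega>} + 16 * \<delta> / \<eta>\<^sup>2 + prob {\<omega> \<in> space M. \<delta> < \<bar>Qn n \<omega> - 0\<bar>} +
      prob {\<omega> \<in> space M. \<eta> / 2 < \<bar>simple_integral W (mn n) (\<tau>n n) (\<xi>n n) u \<omega> - J \<omega>\<bar>}" for n
  proof -
    let ?V = "\<lambda>s \<omega>. simple_value m \<tau> \<xi> s \<omega>" and ?Vn = "\<lambda>s \<omega>. simple_value (mn n) (\<tau>n n) (\<xi>n n) s \<omega>"
    let ?I = "simple_integral W m \<tau> \<xi> u" and ?In = "simple_integral W (mn n) (\<tau>n n) (\<xi>n n) u"
    note [measurable] = simple_meas Jn[of n] J Q Qn[of n]
    have st': "adapted_steps F (mn n) (\<tau>n n) (\<xi>n n)"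
      using adapted_steps_simple_process[OF sp] .
    have sv: "set_borel_measurable lborel {0..u} (\<lambda>s. simple_value m \<tau> \<xi> s \<omega>)"
      for m \<tau> \<omega> and \<xi> :: "nat \<Rightarrow> 'a \<Rightarrow> real"
      unfolding set_borel_measurable_def by measurable
    \<comment> \<open>\<open>H\<close> is inserted between the two step processes and the squared
      triangle inequality is applied.\<close>
    have "AE \<omega> in M. (LINT s:{0..u}|lborel. (?V s \<omega> - ?Vn s \<omega>)\<^sup>2) \<le> 2 * Q \<omega> + 2 * Qn n \<omega>"
      using Hint le AE_space
    proof eventually_elim
      case (elim \<omega>)
      have vh: "set_borel_measurable lborel {0..u} (\<lambda>s. simple_value m \<tau> \<xi> s \<omega> - H s \<omega>)"
        if "\<omega> \<in> space M" for m \<tau> \<omega> and \<xi> :: "nat \<Rightarrow> 'a \<Rightarrow> real"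
        using sv[of m \<tau> \<xi> \<omega>] H[OF that] unfolding set_borel_measurable_def
        by (simp add: right_diff_distrib)
      note i1 = set_integrable_square_diff(1)[OF sv H[OF elim(3)] set_integrable_simple_value_square elim(1)]
      have "(LINT s:{0..u}|lborel. (?V s \<omega> - ?Vn s \<omega>)\<^sup>2) =
          (LINT s:{0..u}|lborel. ((?V s \<omega> - H s \<omega>) - (?Vn s \<omega> - H s \<omega>))\<^sup>2)"
        by simp
      also have "\<dots> \<le> 2 * (LINT s:{0..u}|lborel. (?V s \<omega> - H s \<omega>)\<^sup>2) + 2 * Qn n \<omega>"
        unfolding Qn_def by (intro set_integrable_square_diff(2) vh elim i1)
      finally show ?case using elim(2) by simp
    qed
    then have A: "AE \<omega> in M. \<omega> \<in> {\<omega> \<in> space M. 4 * \<delta> < (LINT s:{0..u}|lborel. (?V s \<omega> - ?Vn s \<omega>)\<^sup>2)} \<longrightarrow>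
        \<omega> \<in> {\<omega> \<in> space M. \<delta> < Q \<omega>} \<union> {\<omega> \<in> space M. \<delta> < \<bar>Qn n \<omega> - 0\<bar>}"
      by eventually_elim auto
    have split: "\<eta> / 2 < \<bar>a - b\<bar> \<or> \<eta> / 2 < \<bar>b - c\<bar>" if "\<eta> < \<bar>a - c\<bar>" for a b c :: real
      using that by linarith
    have "prob {\<omega> \<in> space M. \<eta> < \<bar>?I \<omega> - J \<omega>\<bar>} \<le>
        prob ({\<omega> \<in> space M. \<eta> / 2 < \<bar>?I \<omega> - ?In \<omega>\<bar>} \<union> {\<omega> \<in> space M. \<eta> / 2 < \<bar>?In \<omega> - J \<omega>\<bar>})"
      by (intro finite_measure_mono) (use split in blast, measurable)
    also have "\<dots> \<le> prob {\<omega> \<in> space M. \<eta> / 2 < \<bar>?I \<omega> - ?In \<omega>\<bar>} + prob {\<omega> \<in> space M. \<eta> / 2 < \<bar>?In \<omega> - J \<omega>\<bar>}"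
      by (rule measure_Un_le) auto
    also have "prob {\<omega> \<in> space M. \<eta> / 2 < \<bar>?I \<omega> - ?In \<omega>\<bar>} \<le>
        prob {\<omega> \<in> space M. 4 * \<delta> < (LINT s:{0..u}|lborel. (?V s \<omega> - ?Vn s \<omega>)\<^sup>2)} + 4 * \<delta> / (\<eta> / 2)\<^sup>2"
      using \<delta> \<eta> by (intro lenglart_adapted_steps st st' u) auto
    also have "prob {\<omega> \<in> space M. 4 * \<delta> < (LINT s:{0..u}|lborel. (?V s \<omega> - ?Vn s \<omega>)\<^sup>2)} \<le>
        prob ({\<omega> \<in> space M. \<delta> < Q \<omega>} \<union> {\<omega> \<in> space M. \<delta> < \<bar>Qn n \<omega> - 0\<bar>})"
      by (rule finite_measure_mono_AE[OF A]) measurable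
    also have "\<dots> \<le> prob {\<omega> \<in> space M. \<delta> < Q \<omega>} + prob {\<omega> \<in> space M. \<delta> < \<bar>Qn n \<omega> - 0\<bar>}"
      by (rule measure_Un_le) auto
    finally show ?thesis by (simp add: power_divide)
  qed
  \<comment> \<open>The last two terms are exactly the two convergences in probability that define
    the integral, so they vanish in the limit.\<close>
  have "(\<lambda>n. prob {\<omega> \<in> space M. \<delta> < Q \<omega>} + 16 * \<delta> / \<eta>\<^sup>2 + prob {\<omega> \<in> space M. \<delta> < \<bar>Qn n \<omega> - 0\<bar>} +
      prob {\<omega> \<in> space M. \<eta> / 2 < \<bar>simple_integral W (mn n) (\<tau>n n) (\<xi>n n) u \<omega> - J \<omega>\<bar>})
      \<longlonglongrightarrow> prob {\<omega> \<in> space M. \<delta> < Q \<omega>} + 16 * \<delta> / \<eta>\<^sup>2 + 0 + 0"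
    using tQ tJ \<delta> \<eta> unfolding tendsto_in_prob_def Qn_def
    by (intro tendsto_add tendsto_const) (auto dest!: spec[of _ "\<eta> / 2"])
  from LIMSEQ_le_const[OF this] bound show ?thesis by fastforce
qed

end


section \<open>Convergence of the Euler sums\<close>

lemma grid_cell:
  fixes h :: real
  assumes "h > 0" "0 < s" "s \<le> real i * h"
  obtains j where "j < i" "s \<in> {real j * h<..real (Suc j) * h}"
proof -
  have "\<exists>j<i. s \<in> {real j * h<..real (Suc j) * h}"
    using assms(3)
  proof (induction i)
    case (Suc i)
    then show ?case
      by (cases "s \<le> real i * h") (use less_Suc_eq in \<open>force+\<close>)
  qed (use assms in simp)
  then show ?thesis using that by blast
qed

lemma grid_cell_unique:
  fixes h :: real
  assumes "h > 0" "s \<in> {real j * h<..real (Suc j) * h}" "s \<in> {real i * h<..real (Suc i) * h}"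
  shows "i = j"
proof -
  have "real j * h < real (Suc i) * h" "real i * h < real (Suc j) * h"
    using assms(2,3) by (meson greaterThanAtMost_iff less_le_trans)+
  then have "j < Suc i" "i < Suc j" using assms(1) by (simp_all only: mult_less_cancel_right_pos of_nat_less_iff)
  then show ?thesis by simp
qed

lemma simple_value_grid:
  assumes "h > 0" "j < m" "s \<in> {real j * h<..real (Suc j) * h}"
  shows "simple_value m (\<lambda>j. real j * h) \<xi> s \<omega> = \<xi> j \<omega>"
proof -
  have "simple_value m (\<lambda>j. real j * h) \<xi> s \<omega> = (\<Sum>i<m. if i = j then \<xi> j \<omega> else 0)"
    unfolding simple_value_def
  proof (intro sum.cong refl)
    fix i
    show "\<xi> i \<omega> * indicator {real i * h<..real (Suc i) * h} s = (if i = j then \<xi> j \<omega> else 0)"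
      using grid_cell_unique[OF assms(1) assms(3), of i] assms(3)
      by (cases "i = j") (auto simp: indicator_def simp del: of_nat_Suc)
  qed
  then show ?thesis using assms(2) by simp
qed

lemma integrable_simple_value: "integrable lborel (\<lambda>s. simple_value m (\<lambda>j. real j * h) \<xi> s \<omega>)"
proof -
  have "emeasure lborel {real j * h<..real (Suc j) * h} < \<infinity>" for j
    by (cases "real j * h \<le> real (Suc j) * h") auto
  then show ?thesis
    unfolding simple_value_def
    by (intro Bochner_Integration.integrable_sum integrable_mult_right) (auto simp: integrable_indicator_iff)
qed

lemma integral_simple_value_grid:
  assumes "h > 0"
  shows "(LINT s:{0..real m * h}|lborel. simple_value m (\<lambda>j. real j * h) \<xi> s \<omega>) = (\<Sum>j<m. \<xi> j \<omega> * h)"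
proof -
  have "indicator {0..real m * h} s *\<^sub>R simple_value m (\<lambda>j. real j * h) \<xi> s \<omega> =
      (\<Sum>j<m. \<xi> j \<omega> * indicator {real j * h<..real (Suc j) * h} s)" for s
  proof (cases "s \<in> {0..real m * h}")
    case False
    have "s \<notin> {real j * h<..real (Suc j) * h}" if "j < m" for j
    proof
      assume s: "s \<in> {real j * h<..real (Suc j) * h}"
      have "0 \<le> real j * h" "real (Suc j) * h \<le> real m * h"
        using assms that by (auto simp del: of_nat_Suc intro!: mult_right_mono)
      then show False using s False by auto
    qed
    then have "(\<Sum>j<m. \<xi> j \<omega> * indicator {real j * h<..real (Suc j) * h} s) = 0"
      by (intro sum.neutral) auto
    then show ?thesis using False by simp
  qed (simp add: simple_value_def)
  then have "(LINT s:{0..real m * h}|lborel. simple_value m (\<lambda>j. real j * h) \<xi> s \<omega>) =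
      (LINT s|lborel. (\<Sum>j<m. \<xi> j \<omega> * indicator {real j * h<..real (Suc j) * h} s))"
    unfolding set_lebesgue_integral_def by (simp del: of_nat_Suc)
  also have "\<dots> = (\<Sum>j<m. \<xi> j \<omega> * h)"
  proof -
    have "emeasure lborel {real j * h<..real (Suc j) * h} < \<infinity>" for j
      by (cases "real j * h \<le> real (Suc j) * h") auto
    moreover have "real j * h \<le> real (Suc j) * h" for j using assms by simp
    ultimately show ?thesis
      by (subst Bochner_Integration.integral_sum)
        (auto intro!: sum.cong simp: integrable_indicator_iff algebra_simps simp del: of_nat_Suc, simp add: algebra_simps)
  qed
  finally show ?thesis .
qed

text \<open>Uniform continuity on the compact interval: once the mesh is small, the left-point
  interpolation is uniformly close to the path.\<close>

lemma grid_integral_tendsto_0: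
  fixes \<phi> :: "real \<Rightarrow> real"
  assumes t: "t > 0" and cont: "continuous_on {0..t} \<phi>"
  shows "(\<lambda>N. LINT s:{0..t}|lborel. \<bar>simple_value N (\<lambda>j. real j * (t / real N)) (\<lambda>j \<omega>. \<phi> (real j * (t / real N))) s \<omega> - \<phi> s\<bar>)
    \<longlonglongrightarrow> 0"
proof (rule LIMSEQ_I)
  fix r :: real assume r: "r > 0"
  \<comment> \<open>Twice \<open>t\<close> in the denominator makes \<open>e * t\<close> equal to
    \<open>r / 2\<close>, which gives the strict bound.\<close>
  define e where "e = r / (2 * t)"
  have e: "e > 0" "e * t < r" using r t by (auto simp: e_def)
  have "uniformly_continuous_on {0..t} \<phi>"
    using cont by (intro compact_uniformly_continuous) auto
  then obtain d where d: "d > 0" "\<And>u v. u \<in> {0..t} \<Longrightarrow> v \<in> {0..t} \<Longrightarrow> dist u v < d \<Longrightarrow> dist (\<phi> u) (\<phi> v) < e"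
    using e(1) unfolding uniformly_continuous_on_def by metis
  obtain N0 :: nat where N0: "t / d < real N0" using reals_Archimedean2 by blast
  show "\<exists>N0. \<forall>N\<ge>N0. norm ((LINT s:{0..t}|lborel. \<bar>simple_value N (\<lambda>j. real j * (t / real N)) (\<lambda>j \<omega>. \<phi> (real j * (t / real N))) s \<omega> - \<phi> s\<bar>) - 0) < r"
  proof (intro exI[of _ N0] allI impI)
    fix N assume "N \<ge> N0"
    then have N: "t / d < real N" using N0 by linarith
    moreover have "0 < t / d" using t d(1) by simp
    ultimately have Npos: "0 < real N" by linarith
    define h where "h = t / real N"
    have h: "h > 0" "h < d" "real N * h = t" using N Npos t d(1) by (auto simp: h_def field_simps)
    let ?V = "\<lambda>s. simple_value N (\<lambda>j. real j * h) (\<lambda>j \<omega>. \<phi> (real j * h)) s \<omega>"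
    have le: "\<bar>?V s - \<phi> s\<bar> \<le> e" if s: "s \<in> {0<..t}" for s
    proof -
      obtain j where j: "j < N" "s \<in> {real j * h<..real (Suc j) * h}"
        using grid_cell[OF h(1), of s N] s h(3) by auto
      have "real j * h \<in> {0..t}" using j h(1) s by auto
      moreover have "dist s (real j * h) < d" using j h by (auto simp: dist_real_def algebra_simps)
      ultimately show ?thesis
        using d(2)[of s "real j * h"] s simple_value_grid[OF h(1) j, of "\<lambda>j \<omega>. \<phi> (real j * h)" \<omega>]
        by (auto simp: dist_real_def)
    qed
    have "(LINT s:{0..t}|lborel. \<bar>?V s - \<phi> s\<bar>) \<le> (LINT s:{0..t}|lborel. e)"
      unfolding set_lebesgue_integral_def
    proof (rule integral_mono_AE')
      show "integrable lborel (\<lambda>s. indicator {0..t} s *\<^sub>R e)" using t by (simp add: integrable_indicator_iff)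
      \<comment> \<open>At 0 the step function is zero because the cells are left-open; a single
        point is negligible.\<close>
      have "AE s in lborel. s \<noteq> (0::real)" by (rule AE_lborel_singleton)
      then show "AE s in lborel. indicator {0..t} s *\<^sub>R \<bar>?V s - \<phi> s\<bar> \<le> indicator {0..t} s *\<^sub>R e"
        by eventually_elim (use le in \<open>auto simp: indicator_def\<close>)
    qed (use e in \<open>auto simp: indicator_def\<close>)
    also have "\<dots> = e * t" using t by (simp add: set_lebesgue_integral_def)
    finally have "(LINT s:{0..t}|lborel. \<bar>?V s - \<phi> s\<bar>) < r" using e(2) by linarith
    moreover have "0 \<le> (LINT s:{0..t}|lborel. \<bar>?V s - \<phi> s\<bar>)"
      unfolding set_lebesgue_integral_def by (intro integral_nonneg_AE) (auto simp: indicator_def)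
    ultimately show "norm ((LINT s:{0..t}|lborel. \<bar>simple_value N (\<lambda>j. real j * (t / real N)) (\<lambda>j \<omega>. \<phi> (real j * (t / real N))) s \<omega> - \<phi> s\<bar>) - 0) < r"
      by (simp add: h_def)
  qed
qed

text \<open>A left Riemann sum is the integral of the step interpolation, so its error is bounded by
  the L1 distance of the preceding lemma. The unit value \<open>()\<close> fills the outcome
  argument of \<open>simple_value\<close> for a deterministic path.\<close>

lemma riemann_sum_tendsto:
  fixes \<phi> :: "real \<Rightarrow> real"
  assumes t: "t > 0" and cont: "continuous_on {0..t} \<phi>"
  shows "(\<lambda>N. \<Sum>j<N. \<phi> (real j * (t / real N)) * (t / real N)) \<longlonglongrightarrow> (LINT s:{0..t}|lborel. \<phi> s)"
proof (rule LIM_zero_cancel, rule tendsto_rabs_zero_cancel, rule tendsto_sandwich[OF _ _ tendsto_const grid_integral_tendsto_0[OF t cont, of "()"]])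
  show "\<forall>\<^sub>F N in sequentially. \<bar>(\<Sum>j<N. \<phi> (real j * (t / real N)) * (t / real N)) - (LINT s:{0..t}|lborel. \<phi> s)\<bar>
     \<le> (LINT s:{0..t}|lborel. \<bar>simple_value N (\<lambda>j. real j * (t / real N)) (\<lambda>j \<omega>. \<phi> (real j * (t / real N))) s () - \<phi> s\<bar>)"
    using eventually_gt_at_top[of 0]
  proof eventually_elim
    case (elim N)
    define h where "h = t / real N"
    have h: "h > 0" "real N * h = t" using elim t by (auto simp: h_def)
    let ?V = "\<lambda>s. simple_value N (\<lambda>j. real j * h) (\<lambda>j \<omega>. \<phi> (real j * h)) s ()"
    have i1: "set_integrable lborel {0..t} ?V"
      unfolding set_integrable_def using integrable_real_mult_indicator[OF _ integrable_simple_value, of "{0..t}"]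
      by (simp add: mult.commute)
    have i2: "set_integrable lborel {0..t} \<phi>" using borel_integrable_atLeastAtMost'[OF cont] .
    have "(\<Sum>j<N. \<phi> (real j * h) * h) - (LINT s:{0..t}|lborel. \<phi> s) = (LINT s:{0..t}|lborel. ?V s - \<phi> s)"
      using integral_simple_value_grid[OF h(1), of N "\<lambda>j \<omega>. \<phi> (real j * h)" "()"] i1 i2 h(2)
      by simp
    also have "\<bar>\<dots>\<bar> \<le> (LINT s:{0..t}|lborel. \<bar>?V s - \<phi> s\<bar>)"
      using set_integral_norm_bound[OF set_integral_diff(1)[OF i1 i2]] by simp
    finally show ?case by (simp add: h_def)
  qed
qed auto

text \<open>Bounded convergence for the indicators of the events, which vanish eventually along
  almost every path.\<close>

lemma (in prob_space) prob_gt_tendsto_0: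
  fixes Y :: "nat \<Rightarrow> 'a \<Rightarrow> real"
  assumes Y: "\<And>n. Y n \<in> borel_measurable M" and lim: "AE \<omega> in M. (\<lambda>n. Y n \<omega>) \<longlonglongrightarrow> 0" and c: "c > 0"
  shows "(\<lambda>n. prob {\<omega> \<in> space M. c < Y n \<omega>}) \<longlonglongrightarrow> 0"
proof -
  have "(\<lambda>n. expectation (indicator {\<omega> \<in> space M. c < Y n \<omega>} :: _ \<Rightarrow> real)) \<longlonglongrightarrow> expectation (\<lambda>_. 0)"
  proof (rule integral_dominated_convergence[where w="\<lambda>_. 1"])
    show "indicator {\<omega> \<in> space M. c < Y n \<omega>} \<in> borel_measurable M" for n
      using Y[of n] by measurable
    show "AE \<omega> in M. (\<lambda>n. indicator {\<omega> \<in> space M. c < Y n \<omega>} \<omega> :: real) \<longlonglongrightarrow> 0"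
      using lim
    proof eventually_elim
      case (elim \<omega>)
      then have "\<forall>\<^sub>F n in sequentially. Y n \<omega> < c" using c by (rule order_tendstoD)
      then show ?case
        by (rule tendsto_eventually[OF eventually_mono]) (auto simp: indicator_def)
    qed
  qed (auto simp: indicator_def)
  moreover have "{\<omega> \<in> space M. c < Y n \<omega>} \<inter> space M = {\<omega> \<in> space M. c < Y n \<omega>}" for n by auto
  ultimately show ?thesis by simp
qed

section \<open>Euler sums with exact coefficients, and their distance to the solution\<close>

locale cir_process_pos = cir_process +
  assumes sigma_pos: "\<sigma> > 0"
begin

text \<open>Not the recursive Euler scheme: the coefficients are read off the exact solution at the
  grid points. Hence the sum is an Ito sum of a known integrand and its error needs no discrete
  Gronwall argument.\<close>

definition euler :: "real \<Rightarrow> nat \<Rightarrow> 'a \<Rightarrow> real" where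
  "euler h i \<omega> = x + (\<Sum>j<i. (a - k * X (real j * h) \<omega>) * h +
     \<sigma> * sqrt (X (real j * h) \<omega>) * (W (real (Suc j) * h) \<omega> - W (real j * h) \<omega>))"

text \<open>A pathwise L1 interpolation error; it controls both the drift error and the quadratic
  variation error of \<open>euler\<close>.\<close>

definition grid_error :: "real \<Rightarrow> nat \<Rightarrow> 'a \<Rightarrow> real" where
  "grid_error h N \<omega> = (LINT s:{0..real N * h}|lborel.
     \<bar>simple_value N (\<lambda>j. real j * h) (\<lambda>j. X (real j * h)) s \<omega> - X s \<omega>\<bar>)"

lemma X_measurable: "0 \<le> t \<Longrightarrow> X t \<in> borel_measurable M"
  using X_adapted measurable_F_M by blast

lemma euler_measurable: "0 \<le> h \<Longrightarrow> euler h i \<in> borel_measurable M"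
  unfolding euler_def
  by (intro borel_measurable_add borel_measurable_sum borel_measurable_times borel_measurable_diff
      borel_measurable_const measurable_compose[OF X_measurable borel_measurable_sqrt] X_measurable W_measurable) auto

text \<open>The locale only makes \<open>X\<close> adapted; joint measurability is read off the progressive
  integrand \<open>\<sigma> * sqrt (X s)\<close>, which is where \<open>\<sigma> \<noteq> 0\<close> is needed.\<close>

lemma X_jointly_measurable:
  assumes t: "0 \<le> t"
  shows "(\<lambda>(\<omega>, s). X (max 0 (min t s)) \<omega>) \<in> borel_measurable (M \<Otimes>\<^sub>M lborel)"
proof -
  obtain J where "has_ito_integral M F W (\<lambda>s \<omega>. \<sigma> * sqrt (X s \<omega>)) t (J t)"
    using X_sde t by blast
  then have *: "(\<lambda>(s, \<omega>). \<sigma> * sqrt (X s \<omega>)) \<in> borel_measurable (restrict_space borel {0..t} \<Otimes>\<^sub>M F t)"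
    using t by (simp add: has_ito_integral_def progressive_on_def)
  \<comment> \<open>Clamping time to \<open>[0, t]\<close> lands in the restricted space of which
    progressiveness speaks; outcomes may pass from \<open>M\<close> to \<open>F t\<close> because
    \<open>F t\<close> is a subalgebra.\<close>
  have "(\<lambda>p. (max 0 (min t (snd p)), fst p)) \<in> measurable (M \<Otimes>\<^sub>M lborel) (restrict_space borel {0..t} \<Otimes>\<^sub>M F t)"
  proof (rule measurable_Pair)
    show "(\<lambda>p. max 0 (min t (snd p))) \<in> measurable (M \<Otimes>\<^sub>M lborel) (restrict_space borel {0..t})"
      using t by (intro measurable_restrict_space2) auto
    have "(\<lambda>\<omega>. \<omega>) \<in> measurable M (F t)"
      using measurable_from_subalg[OF subalg[of t] measurable_ident_sets] by auto
    then show "fst \<in> measurable (M \<Otimes>\<^sub>M lborel) (F t)"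
      using measurable_compose[OF measurable_fst] by auto
  qed
  from measurable_compose[OF this *]
  have H: "(\<lambda>p. \<sigma> * sqrt (X (max 0 (min t (snd p))) (fst p))) \<in> borel_measurable (M \<Otimes>\<^sub>M lborel)"
    by simp
  \<comment> \<open>With the odd \<open>sqrt\<close>, a real \<open>y\<close> of either sign equals
    \<open>r * \<bar>r\<bar>\<close> for \<open>r = sqrt y\<close>, so \<open>X\<close> is a
    measurable function of the integrand.\<close>
  have "y = (\<sigma> * sqrt y / \<sigma>) * \<bar>\<sigma> * sqrt y / \<sigma>\<bar>" for y
  proof (cases "0 \<le> y")
    case False
    then have "sqrt y = - sqrt (- y)" "sqrt (- y) * sqrt (- y) = - y" by (auto simp: real_sqrt_minus)
    then show ?thesis using sigma_pos False by simp
  qed (use sigma_pos in simp)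
  then have eq: "(\<lambda>(\<omega>, s). X (max 0 (min t s)) \<omega>) = (\<lambda>p. (\<sigma> * sqrt (X (max 0 (min t (snd p))) (fst p)) / \<sigma>) *
      \<bar>\<sigma> * sqrt (X (max 0 (min t (snd p))) (fst p)) / \<sigma>\<bar>)"
    by (auto simp: fun_eq_iff)
  show ?thesis unfolding eq using H by measurable
qed

lemma grid_error_measurable:
  assumes h: "0 < h"
  shows "grid_error h N \<in> borel_measurable M"
proof -
  let ?t = "real N * h"
  have t: "0 \<le> ?t" using h by simp
  note [measurable] = X_jointly_measurable[OF t]
  have [measurable]: "X (real j * h) \<in> borel_measurable M" for j using X_measurable h by simp
  have "grid_error h N \<omega> = (LINT s|lborel. indicator {0..?t} s *
     \<bar>(\<Sum>i<N. X (real i * h) \<omega> * indicator {real i * h<..real (Suc i) * h} s) - (\<lambda>(\<omega>, s). X (max 0 (min ?t s)) \<omega>) (\<omega>, s)\<bar>)" for \<omega>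
    unfolding grid_error_def set_lebesgue_integral_def simple_value_def
    by (intro Bochner_Integration.integral_cong) (auto simp: indicator_def)
  then have eq: "grid_error h N = (\<lambda>\<omega>. LINT s|lborel. indicator {0..?t} s *
     \<bar>(\<Sum>i<N. X (real i * h) \<omega> * indicator {real i * h<..real (Suc i) * h} s) - (\<lambda>(\<omega>, s). X (max 0 (min ?t s)) \<omega>) (\<omega>, s)\<bar>)"
    by auto
  show ?thesis unfolding eq
    by (intro lborel.borel_measurable_lebesgue_integral) measurable
qed

lemma AE_good_path:
  "\<exists>J. (\<forall>t\<ge>0. has_ito_integral M F W (\<lambda>s \<omega>. \<sigma> * sqrt (X s \<omega>)) t (J t)) \<and>
   (AE \<omega> in M. \<omega> \<in> space M \<and> continuous_on {0..} (\<lambda>t. X t \<omega>) \<and> (\<forall>t\<ge>0. 0 \<le> X t \<omega>) \<and>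
      (\<forall>t\<ge>0. X t \<omega> = x + (LINT s:{0..t}|lborel. a - k * X s \<omega>) + J t \<omega>))"
proof -
  obtain J where J: "\<forall>t\<ge>0. has_ito_integral M F W (\<lambda>s \<omega>. \<sigma> * sqrt (X s \<omega>)) t (J t)"
    "AE \<omega> in M. \<forall>t\<ge>0. X t \<omega> = X 0 \<omega> + (LINT s:{0..t}|lborel. a - k * X s \<omega>) + J t \<omega>"
    using X_sde by blast
  have "AE \<omega> in M. \<omega> \<in> space M \<and> continuous_on {0..} (\<lambda>t. X t \<omega>) \<and> (\<forall>t\<ge>0. 0 \<le> X t \<omega>) \<and>
      (\<forall>t\<ge>0. X t \<omega> = x + (LINT s:{0..t}|lborel. a - k * X s \<omega>) + J t \<omega>)"
    using J(2) X_continuous X_nonneg X_start AE_space by eventually_elim metis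
  then show ?thesis using J(1) by blast
qed

text \<open>Subtracting the equation for \<open>X\<close> leaves the error of the drift sum, at most
  \<open>\<bar>k\<bar> * grid_error h N\<close>, and the difference between a step integral and the
  Ito integral. Each gets half of \<open>\<eta>\<close>, so the factor 16 becomes 64. The error over
  the whole grid is used, which makes the bound uniform in \<open>i\<close>.\<close>

lemma euler_error_le:
  assumes h: "h > 0" and i: "i \<le> N" and \<delta>: "\<delta> > 0" and \<eta>: "\<eta> > 0"
  shows "prob {\<omega> \<in> space M. \<eta> < \<bar>euler h i \<omega> - X (real i * h) \<omega>\<bar>} \<le>
    prob {\<omega> \<in> space M. \<eta> / 2 < \<bar>k\<bar> * grid_error h N \<omega>} +
    (prob {\<omega> \<in> space M. \<delta> < \<sigma>\<^sup>2 * grid_error h N \<omega>} + 64 * \<delta> / \<eta>\<^sup>2)"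
proof -
  obtain J where ito: "\<And>t. t \<ge> 0 \<Longrightarrow> has_ito_integral M F W (\<lambda>s \<omega>. \<sigma> * sqrt (X s \<omega>)) t (J t)"
    and good: "AE \<omega> in M. \<omega> \<in> space M \<and> continuous_on {0..} (\<lambda>t. X t \<omega>) \<and> (\<forall>t\<ge>0. 0 \<le> X t \<omega>) \<and>
      (\<forall>t\<ge>0. X t \<omega> = x + (LINT s:{0..t}|lborel. a - k * X s \<omega>) + J t \<omega>)"
    using AE_good_path by blast
  let ?u = "real i * h" and ?t = "real N * h" and ?\<tau> = "\<lambda>j. real j * h"
  have u: "0 \<le> ?u" "?u \<le> ?t" using h i by (auto intro: mult_right_mono)
  let ?\<xi> = "\<lambda>j \<omega>. \<sigma> * sqrt (X (real j * h) \<omega>)"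
  let ?Y = "\<lambda>j. X (real j * h)"
  have X_F: "X (real j * h) \<in> borel_measurable (F (real j * h))" for j using X_adapted h by simp
  have st: "adapted_steps F i ?\<tau> ?\<xi>"
    using h X_F by (auto simp: adapted_steps_def)
  have J: "J ?u \<in> borel_measurable M"
    using ito[OF u(1)] by (auto simp: has_ito_integral_def tendsto_in_prob_def)
  have SI: "simple_integral W i ?\<tau> ?\<xi> ?u \<omega> =
      (\<Sum>j<i. ?\<xi> j \<omega> * (W (real (Suc j) * h) \<omega> - W (real j * h) \<omega>))" for \<omega>
    unfolding simple_integral_def
  proof (intro sum.cong refl)
    fix j assume "j \<in> {..<i}"
    then have "real (Suc j) * h \<le> ?u" "real j * h \<le> ?u" using h by (auto intro!: mult_right_mono simp del: of_nat_Suc)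
    then show "?\<xi> j \<omega> * (W (min (real (Suc j) * h) ?u) \<omega> - W (min (real j * h) ?u) \<omega>) =
        ?\<xi> j \<omega> * (W (real (Suc j) * h) \<omega> - W (real j * h) \<omega>)" by (simp del: of_nat_Suc)
  qed
  have SIM: "simple_integral W i ?\<tau> ?\<xi> ?u \<in> borel_measurable M"
    unfolding SI[abs_def] using h
    by (intro borel_measurable_sum borel_measurable_times borel_measurable_diff borel_measurable_const
        measurable_compose[OF X_measurable borel_measurable_sqrt] W_measurable) auto
  note QM = grid_error_measurable[OF h, of N]
  \<comment> \<open>Used twice: with \<open>c = \<sigma>\<^sup>2\<close> for the squared integrands
    and with \<open>c = 1\<close> for the drift.\<close>
  have mono: "(LINT s:{0..?u}|lborel. f s) \<le> c * grid_error h N \<omega>"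
    if \<omega>: "continuous_on {0..} (\<lambda>t. X t \<omega>)" and c: "0 \<le> c"
      and f: "\<And>j s. j < i \<Longrightarrow> s \<in> {real j * h<..real (Suc j) * h} \<Longrightarrow> f s \<le> c * \<bar>X (real j * h) \<omega> - X s \<omega>\<bar>"
    for f c \<omega>
  proof -
    let ?g = "\<lambda>s. c * \<bar>simple_value N ?\<tau> ?Y s \<omega> - X s \<omega>\<bar>"
    have i1: "set_integrable lborel {0..?t} (\<lambda>s. simple_value N ?\<tau> ?Y s \<omega>)"
      unfolding set_integrable_def using integrable_real_mult_indicator[OF _ integrable_simple_value, of "{0..?t}"]
      by (simp add: mult.commute)
    have i2: "set_integrable lborel {0..?t} (\<lambda>s. X s \<omega>)"
      using continuous_on_subset[OF \<omega>] by (intro borel_integrable_atLeastAtMost') auto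
    have i3: "set_integrable lborel {0..?t} ?g"
      using set_integrable_abs[OF set_integral_diff(1)[OF i1 i2]] by simp
    have "(LINT s:{0..?u}|lborel. f s) \<le> (LINT s:{0..?t}|lborel. ?g s)"
      unfolding set_lebesgue_integral_def
    proof (rule integral_mono_AE'[OF i3[unfolded set_integrable_def]])
      have "AE s in lborel. s \<noteq> (0::real)" by (rule AE_lborel_singleton)
      then show "AE s in lborel. indicator {0..?u} s *\<^sub>R f s \<le> indicator {0..?t} s *\<^sub>R ?g s"
      proof eventually_elim
        case (elim s)
        show ?case
        proof (cases "s \<in> {0..?u}")
          case True
          then obtain j where j: "j < i" "s \<in> {real j * h<..real (Suc j) * h}"
            using grid_cell[OF h, of s i] elim by auto
          have "j < N" using j i by simp
          have "f s \<le> ?g s" using f[OF j] simple_value_grid[OF h \<open>j < N\<close> j(2), of ?Y \<omega>] by simp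
          then show ?thesis using True u by (simp add: indicator_def)
        qed (use c in simp)
      qed
    qed (use c in \<open>auto simp: indicator_def\<close>)
    then show ?thesis by (simp add: grid_error_def)
  qed
  have le: "AE \<omega> in M. (LINT s:{0..?u}|lborel. (simple_value i ?\<tau> ?\<xi> s \<omega> - \<sigma> * sqrt (X s \<omega>))\<^sup>2) \<le>
      \<sigma>\<^sup>2 * grid_error h N \<omega>"
    using good
  proof eventually_elim
    case (elim \<omega>)
    \<comment> \<open>Holder continuity of order 1/2, from \<bar>sqrt y - sqrt z\<bar> <= sqrt y +
      sqrt z. It turns an L2 error of the diffusion coefficient into an L1 error of the
      path.\<close>
    have sq: "(sqrt y - sqrt z)\<^sup>2 \<le> \<bar>y - z\<bar>" if "0 \<le> y" "0 \<le> z" for y z :: real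
    proof -
      have "\<bar>sqrt y - sqrt z\<bar> * \<bar>sqrt y - sqrt z\<bar> \<le> \<bar>sqrt y - sqrt z\<bar> * (sqrt y + sqrt z)"
        using that by (intro mult_left_mono) (auto simp: abs_le_iff)
      also have "\<dots> = \<bar>(sqrt y - sqrt z) * (sqrt y + sqrt z)\<bar>" using that by (simp add: abs_mult)
      also have "(sqrt y - sqrt z) * (sqrt y + sqrt z) = y - z" using that by (simp add: algebra_simps)
      finally show ?thesis by (simp add: power2_eq_square)
    qed
    show ?case
    proof (rule mono)
      fix j s assume j: "j < i" "s \<in> {real j * h<..real (Suc j) * h}"
      have "0 \<le> real j * h" using h by simp
      then have "0 \<le> X (real j * h) \<omega>" "0 \<le> X s \<omega>" using elim j by auto
      then have "\<sigma>\<^sup>2 * (sqrt (X (real j * h) \<omega>) - sqrt (X s \<omega>))\<^sup>2 \<le> \<sigma>\<^sup>2 * \<bar>X (real j * h) \<omega> - X s \<omega>\<bar>"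
        by (intro mult_left_mono sq) auto
      then show "(simple_value i ?\<tau> ?\<xi> s \<omega> - \<sigma> * sqrt (X s \<omega>))\<^sup>2 \<le> \<sigma>\<^sup>2 * \<bar>X (real j * h) \<omega> - X s \<omega>\<bar>"
        unfolding simple_value_grid[OF h j, of ?\<xi> \<omega>] right_diff_distrib[symmetric] power_mult_distrib .
    qed (use elim in auto)
  qed
  have ineq: "AE \<omega> in M. \<bar>euler h i \<omega> - X ?u \<omega>\<bar> \<le> \<bar>k\<bar> * grid_error h N \<omega> + \<bar>simple_integral W i ?\<tau> ?\<xi> ?u \<omega> - J ?u \<omega>\<bar>"
    using good
  proof eventually_elim
    case (elim \<omega>)
    let ?V = "\<lambda>s. simple_value i ?\<tau> ?Y s \<omega>"
    have i1: "set_integrable lborel {0..?u} ?V"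
      unfolding set_integrable_def using integrable_real_mult_indicator[OF _ integrable_simple_value, of "{0..?u}"]
      by (simp add: mult.commute)
    have i2: "set_integrable lborel {0..?u} (\<lambda>s. X s \<omega>)"
      using continuous_on_subset[of "{0..}" "\<lambda>t. X t \<omega>" "{0..?u}"] elim by (intro borel_integrable_atLeastAtMost') auto
    have i3: "set_integrable lborel {0..?u} (\<lambda>s. a)" using u by (simp add: set_integrable_def integrable_indicator_iff)
    have "\<bar>LINT s:{0..?u}|lborel. ?V s - X s \<omega>\<bar> \<le> (LINT s:{0..?u}|lborel. \<bar>?V s - X s \<omega>\<bar>)"
      using set_integral_norm_bound[OF set_integral_diff(1)[OF i1 i2]] by simp
    also have "\<dots> \<le> 1 * grid_error h N \<omega>"
      by (rule mono) (use elim simple_value_grid[OF h, of _ i _ ?Y \<omega>] in auto)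
    finally have V: "\<bar>k * (LINT s:{0..?u}|lborel. ?V s - X s \<omega>)\<bar> \<le> \<bar>k\<bar> * grid_error h N \<omega>"
      by (simp add: abs_mult mult_left_mono)
    have X: "X ?u \<omega> = x + (a * ?u - k * (LINT s:{0..?u}|lborel. X s \<omega>)) + J ?u \<omega>"
    proof -
      have "X ?u \<omega> = x + (LINT s:{0..?u}|lborel. a - k * X s \<omega>) + J ?u \<omega>" using elim u by blast
      also have "(LINT s:{0..?u}|lborel. a - k * X s \<omega>) = a * ?u - k * (LINT s:{0..?u}|lborel. X s \<omega>)"
        using i2 i3 u by (simp add: set_lebesgue_integral_def[of _ _ "\<lambda>_. a"])
      finally show ?thesis .
    qed
    have "(LINT s:{0..?u}|lborel. ?V s - X s \<omega>) = (\<Sum>j<i. X (real j * h) \<omega> * h) - (LINT s:{0..?u}|lborel. X s \<omega>)"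
      using i1 i2 integral_simple_value_grid[OF h, of i ?Y \<omega>] by simp
    moreover have "euler h i \<omega> = x + (a * ?u - k * (\<Sum>j<i. X (real j * h) \<omega> * h)) + simple_integral W i ?\<tau> ?\<xi> ?u \<omega>"
      unfolding euler_def SI by (simp add: sum.distrib left_diff_distrib sum_subtractf sum_distrib_left mult.assoc del: of_nat_Suc)
    ultimately have "euler h i \<omega> - X ?u \<omega> = (simple_integral W i ?\<tau> ?\<xi> ?u \<omega> - J ?u \<omega>) -
        k * (LINT s:{0..?u}|lborel. ?V s - X s \<omega>)"
      using X by (simp add: right_diff_distrib)
    then show ?case using V by linarith
  qed
  let ?D = "\<lambda>\<omega>. \<bar>simple_integral W i ?\<tau> ?\<xi> ?u \<omega> - J ?u \<omega>\<bar>"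
  note [measurable] = J SIM QM
  have "prob {\<omega> \<in> space M. \<eta> < \<bar>euler h i \<omega> - X ?u \<omega>\<bar>} \<le>
      prob ({\<omega> \<in> space M. \<eta> / 2 < \<bar>k\<bar> * grid_error h N \<omega>} \<union> {\<omega> \<in> space M. \<eta> / 2 < ?D \<omega>})"
  proof (rule finite_measure_mono_AE)
    show "AE \<omega> in M. \<omega> \<in> {\<omega> \<in> space M. \<eta> < \<bar>euler h i \<omega> - X ?u \<omega>\<bar>} \<longrightarrow>
        \<omega> \<in> {\<omega> \<in> space M. \<eta> / 2 < \<bar>k\<bar> * grid_error h N \<omega>} \<union> {\<omega> \<in> space M. \<eta> / 2 < ?D \<omega>}"
      using ineq
    proof eventually_elim
      case (elim \<omega>)
      then have "\<eta> < \<bar>euler h i \<omega> - X ?u \<omega>\<bar> \<Longrightarrow> \<eta> / 2 < \<bar>k\<bar> * grid_error h N \<omega> \<or> \<eta> / 2 < ?D \<omega>"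
        by linarith
      then show ?case by blast
    qed
  qed measurable
  also have "\<dots> \<le> prob {\<omega> \<in> space M. \<eta> / 2 < \<bar>k\<bar> * grid_error h N \<omega>} + prob {\<omega> \<in> space M. \<eta> / 2 < ?D \<omega>}"
    by (rule measure_Un_le) measurable
  also have "prob {\<omega> \<in> space M. \<eta> / 2 < ?D \<omega>} \<le>
      prob {\<omega> \<in> space M. \<delta> < \<sigma>\<^sup>2 * grid_error h N \<omega>} + 16 * \<delta> / (\<eta> / 2)\<^sup>2"
    using \<delta> \<eta> QM by (intro prob_simple_integral_minus_ito_le[OF ito[OF u(1)] st u(1) _ le]) auto
  finally show ?thesis by (simp add: power_divide)
qed

lemma euler_converges_in_prob:
  assumes t: "t > 0" and \<eta>: "\<eta> > 0" and \<epsilon>: "\<epsilon> > 0"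
  shows "\<forall>\<^sub>F N in sequentially. \<forall>i\<le>N.
    prob {\<omega> \<in> space M. \<eta> < \<bar>euler (t / real N) i \<omega> - X (real i * (t / real N)) \<omega>\<bar>} < \<epsilon>"
proof -
  \<comment> \<open>This makes the deterministic term of \<open>euler_error_le\<close> equal to
    \<epsilon>/4; the two probabilities are eventually below \<epsilon>/4 each.\<close>
  define \<delta> where "\<delta> = \<epsilon> * \<eta>\<^sup>2 / 256"
  have \<delta>: "\<delta> > 0" "64 * \<delta> / \<eta>\<^sup>2 = \<epsilon> / 4" using \<eta> \<epsilon> by (auto simp: \<delta>_def)
  \<comment> \<open>The shift to \<open>Suc N\<close> keeps the mesh positive and is undone at the
    end.\<close>
  let ?Q = "\<lambda>N. grid_error (t / real (Suc N)) (Suc N)"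
  have Q: "?Q N \<in> borel_measurable M" for N using t by (intro grid_error_measurable) auto
  have lim: "AE \<omega> in M. (\<lambda>N. ?Q N \<omega>) \<longlonglongrightarrow> 0"
    using X_continuous
  proof eventually_elim
    case (elim \<omega>)
    have "continuous_on {0..t} (\<lambda>s. X s \<omega>)" using continuous_on_subset[OF elim] by auto
    from LIMSEQ_Suc[OF grid_integral_tendsto_0[OF t this, of \<omega>]]
    show ?case unfolding grid_error_def by (simp add: simple_value_def del: of_nat_Suc)
  qed
  have lim': "AE \<omega> in M. (\<lambda>N. c * ?Q N \<omega>) \<longlonglongrightarrow> 0" for c
    using lim by eventually_elim (rule tendsto_mult_right_zero)
  have "\<forall>\<^sub>F N in sequentially. prob {\<omega> \<in> space M. \<eta> / 2 < \<bar>k\<bar> * ?Q N \<omega>} < \<epsilon> / 4"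
    by (rule order_tendstoD[OF prob_gt_tendsto_0[OF _ lim']]) (use \<eta> \<epsilon> Q in auto)
  moreover have "\<forall>\<^sub>F N in sequentially. prob {\<omega> \<in> space M. \<delta> < \<sigma>\<^sup>2 * ?Q N \<omega>} < \<epsilon> / 4"
    by (rule order_tendstoD[OF prob_gt_tendsto_0[OF _ lim']]) (use \<delta> \<epsilon> Q in auto)
  ultimately have "\<forall>\<^sub>F N in sequentially. \<forall>i\<le>Suc N.
    prob {\<omega> \<in> space M. \<eta> < \<bar>euler (t / real (Suc N)) i \<omega> - X (real i * (t / real (Suc N))) \<omega>\<bar>} < \<epsilon>"
  proof eventually_elim
    case (elim N)
    show ?case
    proof (intro allI impI)
      fix i assume "i \<le> Suc N"
      from euler_error_le[OF _ this \<delta>(1) \<eta>, of "t / real (Suc N)"] elim t \<delta>(2) \<epsilon>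
      show "prob {\<omega> \<in> space M. \<eta> < \<bar>euler (t / real (Suc N)) i \<omega> - X (real i * (t / real (Suc N))) \<omega>\<bar>} < \<epsilon>"
        by (simp del: of_nat_Suc)
    qed
  qed
  then show ?thesis by (subst (asm) eventually_sequentially_Suc)
qed

end


section \<open>The generator identity\<close>

text \<open>The Lipschitz condition on \<open>f''\<close> does the work of a bounded third
  derivative in the Taylor remainder; a single constant serves all bounds.\<close>

definition test_function :: "(real \<Rightarrow> real) \<Rightarrow> (real \<Rightarrow> real) \<Rightarrow> (real \<Rightarrow> real) \<Rightarrow> real \<Rightarrow> bool" where
  "test_function f f' f'' K \<longleftrightarrow>
     (\<forall>y. (f has_real_derivative f' y) (at y) \<and> (f' has_real_derivative f'' y) (at y)) \<and>
     (\<forall>y. \<bar>f y\<bar> \<le> K \<and> \<bar>f' y\<bar> \<le> K \<and> \<bar>f'' y\<bar> \<le> K) \<and>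
     (\<forall>y z. \<bar>f'' y - f'' z\<bar> \<le> K * \<bar>y - z\<bar>)"

lemma lipschitz_of_deriv_bounded:
  fixes f :: "real \<Rightarrow> real"
  assumes "\<And>y. (f has_real_derivative f' y) (at y)" "\<And>y. \<bar>f' y\<bar> \<le> K"
  shows "\<bar>f y - f z\<bar> \<le> K * \<bar>y - z\<bar>"
  using field_differentiable_bound[of UNIV f f' K y z] assms by auto

lemma test_functionD:
  assumes "test_function f f' f'' K"
  shows "(f has_real_derivative f' y) (at y)" "(f' has_real_derivative f'' y) (at y)"
    "\<bar>f y\<bar> \<le> K" "\<bar>f' y\<bar> \<le> K" "\<bar>f'' y\<bar> \<le> K" "0 \<le> K"
    "\<bar>f y - f z\<bar> \<le> K * \<bar>y - z\<bar>" "\<bar>f' y - f' z\<bar> \<le> K * \<bar>y - z\<bar>" "\<bar>f'' y - f'' z\<bar> \<le> K * \<bar>y - z\<bar>"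
    "continuous_on UNIV f" "continuous_on UNIV f'" "continuous_on UNIV f''"
    "f \<in> borel_measurable borel" "f' \<in> borel_measurable borel" "f'' \<in> borel_measurable borel"
proof -
  show d: "(f has_real_derivative f' y) (at y)" "(f' has_real_derivative f'' y) (at y)"
    and b: "\<bar>f y\<bar> \<le> K" "\<bar>f' y\<bar> \<le> K" "\<bar>f'' y\<bar> \<le> K"
    and l: "\<bar>f'' y - f'' z\<bar> \<le> K * \<bar>y - z\<bar>" for y z
    using assms unfolding test_function_def by blast+
  show "0 \<le> K" using b(1) abs_ge_zero order_trans by blast
  show "\<bar>f y - f z\<bar> \<le> K * \<bar>y - z\<bar>" "\<bar>f' y - f' z\<bar> \<le> K * \<bar>y - z\<bar>"
    using lipschitz_of_deriv_bounded[OF d(1) b(2)] lipschitz_of_deriv_bounded[OF d(2) b(3)] by auto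
  show c: "continuous_on UNIV f" "continuous_on UNIV f'"
    using d by (auto simp: continuous_on_eq_continuous_at intro: DERIV_isCont)
  have "K-lipschitz_on UNIV f''"
    using l \<open>0 \<le> K\<close> by (auto simp: lipschitz_on_def dist_real_def)
  then show c': "continuous_on UNIV f''" by (rule lipschitz_on_continuous_on)
  show "f \<in> borel_measurable borel" "f' \<in> borel_measurable borel" "f'' \<in> borel_measurable borel"
    using c c' by (auto intro: borel_measurable_continuous_onI)
qed

text \<open>Lagrange remainder of order two, with \<open>f''\<close> moved from the intermediate
  point to \<open>z\<close>; the two points differ by at most \<open>\<bar>d\<bar>\<close>, which
  supplies the third power.\<close>

lemma test_function_taylor:
  assumes tf: "test_function f f' f'' K"
  shows "\<bar>f (z + d) - f z - f' z * d - f'' z * d\<^sup>2 / 2\<bar> \<le> K * \<bar>d\<bar> ^ 3"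
proof (cases "d = 0")
  case False
  define D where "D m = (if m = 0 then f else if m = 1 then f' else f'')" for m :: nat
  have "\<exists>t. (if z + d < z then z + d < t \<and> t < z else z < t \<and> t < z + d) \<and>
      f (z + d) = (\<Sum>m<2. D m z / fact m * (z + d - z) ^ m) + D 2 t / fact 2 * (z + d - z) ^ 2"
    using False test_functionD(1,2)[OF tf]
    by (intro Taylor[where a="min z (z + d)" and b="max z (z + d)"]) (auto simp: D_def less_2_cases_iff)
  then obtain t where t': "if z + d < z then z + d < t \<and> t < z else z < t \<and> t < z + d"
      "f (z + d) = (\<Sum>m<2. D m z / fact m * (z + d - z) ^ m) + D 2 t / fact 2 * (z + d - z) ^ 2"
    by blast
  have t: "\<bar>t - z\<bar> \<le> \<bar>d\<bar>" "f (z + d) = f z + f' z * d + f'' t / 2 * d\<^sup>2"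
    using t' by (auto simp: D_def lessThan_nat_numeral power2_eq_square split: if_splits)
  have "f (z + d) - f z - f' z * d - f'' z * d\<^sup>2 / 2 = (f'' t - f'' z) * d\<^sup>2 / 2"
    unfolding t(2) by (simp add: algebra_simps)
  also have "\<bar>\<dots>\<bar> = \<bar>f'' t - f'' z\<bar> * d\<^sup>2 / 2" by (simp add: abs_mult)
  also have "\<dots> \<le> K * \<bar>d\<bar> * d\<^sup>2 / 2"
    using test_functionD(9)[OF tf, of t z] t(1) test_functionD(6)[OF tf]
    by (intro divide_right_mono mult_right_mono) (auto intro: order_trans mult_left_mono)
  also have "\<dots> \<le> K * \<bar>d\<bar> * d\<^sup>2" using test_functionD(6)[OF tf] by simp
  also have "\<dots> = K * \<bar>d\<bar> ^ 3"
  proof -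
    have "d\<^sup>2 = \<bar>d\<bar> * \<bar>d\<bar>" by (simp add: power2_eq_square)
    then show ?thesis by (simp only: power3_eq_cube mult.assoc)
  qed
  finally show ?thesis .
qed simp

lemma abs_integral_le_integral:
  fixes f g :: "'b \<Rightarrow> real"
  assumes f: "integrable N f" and g: "integrable N g" and le: "\<And>y. y \<in> space N \<Longrightarrow> \<bar>f y\<bar> \<le> g y"
  shows "\<bar>integral\<^sup>L N f\<bar> \<le> integral\<^sup>L N g"
proof -
  have "\<bar>integral\<^sup>L N f\<bar> \<le> (\<integral>y. \<bar>f y\<bar> \<partial>N)" by (rule integral_abs_bound)
  also have "\<dots> \<le> integral\<^sup>L N g" using f g le by (intro integral_mono) auto
  finally show ?thesis .
qed

section \<open>One Taylor step along a Gaussian increment\<close>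

context brownian_motion
begin

text \<open>A discrete Ito formula: terms linear in the increment \<open>D\<close> have mean zero,
  \<open>D\<^sup>2\<close> may be replaced by \<open>h\<close> in expectation, and the rest is of
  order h^(3/2). The 12 is 4 from the cube of a sum times 1 + 2 from \<open>h ^ 3\<close> and the
  third absolute moment.\<close>

lemma discrete_ito_step:
  assumes tf: "test_function f f' f'' K" and s: "0 \<le> s" and h: "0 < h" "h \<le> 1"
    and Z: "Z \<in> borel_measurable (F s)" and b: "b \<in> borel_measurable (F s)" and g: "g \<in> borel_measurable (F s)"
    and bB: "\<And>\<omega>. \<bar>b \<omega>\<bar> \<le> B" and gB: "\<And>\<omega>. \<bar>g \<omega>\<bar> \<le> B"
  shows "\<bar>expectation (\<lambda>\<omega>. f (Z \<omega> + b \<omega> * h + g \<omega> * (W (s + h) \<omega> - W s \<omega>))) - expectation (\<lambda>\<omega>. f (Z \<omega>))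
      - h * expectation (\<lambda>\<omega>. f' (Z \<omega>) * b \<omega> + f'' (Z \<omega>) * (g \<omega>)\<^sup>2 / 2)\<bar> \<le> (K * B\<^sup>2 + 12 * K * B ^ 3) * sqrt h ^ 3"
proof -
  note T = test_functionD[OF tf]
  have B: "0 \<le> B" using bB abs_ge_zero order_trans by blast
  have sh: "s < s + h" using h by simp
  define D where "D \<omega> = W (s + h) \<omega> - W s \<omega>" for \<omega>
  define e where "e \<omega> = b \<omega> * h + g \<omega> * D \<omega>" for \<omega>
  note mom = increment_moments[OF s sh]
  have DM [measurable]: "D \<in> borel_measurable M"
    unfolding D_def using W_measurable[OF s] W_measurable[of "s + h"] s h by simp
  note [measurable] = T(13-15)
  have [measurable]: "Z \<in> borel_measurable M" "b \<in> borel_measurable M" "g \<in> borel_measurable M"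
    using Z b g measurable_F_M by blast+
  \<comment> \<open>\<open>Y1\<close> collects all coefficients of \<open>D\<close>, including the
    cross term of the squared displacement; \<open>Y2\<close> is the coefficient of
    \<open>D\<^sup>2\<close>.\<close>
  define Y1 where "Y1 \<omega> = f' (Z \<omega>) * g \<omega> + f'' (Z \<omega>) * b \<omega> * g \<omega> * h" for \<omega>
  define Y2 where "Y2 \<omega> = f'' (Z \<omega>) * (g \<omega>)\<^sup>2 / 2" for \<omega>
  have Y1F: "Y1 \<in> borel_measurable (F s)" and Y2F: "Y2 \<in> borel_measurable (F s)"
    unfolding Y1_def Y2_def using Z b g by measurable
  have g2: "\<bar>(g \<omega>)\<^sup>2\<bar> \<le> B\<^sup>2" and b2: "\<bar>(b \<omega>)\<^sup>2\<bar> \<le> B\<^sup>2" for \<omega>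
    using power_mono[OF bB abs_ge_zero, of \<omega> 2] power_mono[OF gB abs_ge_zero, of \<omega> 2] by auto
  have bnd: "\<bar>f'' (Z \<omega>) * b \<omega>\<bar> \<le> K * B" "\<bar>f'' (Z \<omega>) * b \<omega> * g \<omega>\<bar> \<le> K * B * B"
    "\<bar>f' (Z \<omega>) * b \<omega>\<bar> \<le> K * B" "\<bar>f' (Z \<omega>) * g \<omega>\<bar> \<le> K * B" "\<bar>f'' (Z \<omega>) * (g \<omega>)\<^sup>2\<bar> \<le> K * B\<^sup>2"
    "\<bar>f'' (Z \<omega>) * (b \<omega>)\<^sup>2\<bar> \<le> K * B\<^sup>2" for \<omega>
    using T(3-6) bB gB B g2 b2 unfolding abs_mult by (auto intro!: mult_mono mult_nonneg_nonneg)
  have Y1: "integrable M Y1"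
  proof (rule integrable_const_bound)
    show "AE \<omega> in M. norm (Y1 \<omega>) \<le> K * B + K * B * B * h"
      unfolding Y1_def real_norm_def using h bnd(2,4)
      by (intro AE_I2 order_trans[OF abs_triangle_ineq] add_mono) (auto simp: abs_mult mult.assoc intro!: mult_right_mono)
  qed (use measurable_F_M[OF Y1F] in auto)
  have Y2: "integrable M Y2"
  proof (rule integrable_const_bound)
    show "AE \<omega> in M. norm (Y2 \<omega>) \<le> K * B\<^sup>2 / 2"
      unfolding Y2_def real_norm_def using bnd(5) by (intro AE_I2) auto
  qed (use measurable_F_M[OF Y2F] in auto)
  have D1: "integrable M (\<lambda>\<omega>. Y1 \<omega> * D \<omega>)" "expectation (\<lambda>\<omega>. Y1 \<omega> * D \<omega>) = 0"
    using integrable_times_increment[OF s sh Y1F, of "\<lambda>y. y"] expectation_times_increment[OF s sh Y1F, of "\<lambda>y. y"]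
      Y1 mom(1)[of 1] mom(2) by (simp_all add: D_def)
  have i2: "integrable M (\<lambda>\<omega>. (W (s + h) \<omega> - W s \<omega>)\<^sup>2 - h)" using mom(1)[of 2] by simp
  have D2: "integrable M (\<lambda>\<omega>. Y2 \<omega> * ((D \<omega>)\<^sup>2 - h))" "expectation (\<lambda>\<omega>. Y2 \<omega> * ((D \<omega>)\<^sup>2 - h)) = 0"
    using integrable_times_increment[OF s sh Y2F, of "\<lambda>y. y\<^sup>2 - h"] expectation_times_increment[OF s sh Y2F, of "\<lambda>y. y\<^sup>2 - h"]
      Y2 i2 mom(1)[of 2] mom(3) by (simp_all add: D_def prob_space)
  define V where "V \<omega> = f (Z \<omega> + e \<omega>) - f (Z \<omega>) - h * (f' (Z \<omega>) * b \<omega> + Y2 \<omega>)" for \<omega>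
  have f1: "integrable M (\<lambda>\<omega>. f (Z \<omega> + e \<omega>))"
    by (rule integrable_const_bound[of _ K]) (use T(3) in \<open>auto simp: e_def\<close>)
  have f2: "integrable M (\<lambda>\<omega>. f (Z \<omega>))"
    by (rule integrable_const_bound[of _ K]) (use T(3) in auto)
  have f3: "integrable M (\<lambda>\<omega>. f' (Z \<omega>) * b \<omega>)"
    by (rule integrable_const_bound[of _ "K * B"]) (use bnd(3) in auto)
  have V: "integrable M V" unfolding V_def using f1 f2 f3 Y2 by auto
  have EV: "expectation V = expectation (\<lambda>\<omega>. f (Z \<omega> + e \<omega>)) - expectation (\<lambda>\<omega>. f (Z \<omega>))
      - h * expectation (\<lambda>\<omega>. f' (Z \<omega>) * b \<omega> + Y2 \<omega>)"
    unfolding V_def using f1 f2 f3 Y2 by simp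
  \<comment> \<open>Removing the two mean-zero terms does not change the expectation, but leaves a
    variable that is small in absolute value: the Taylor remainder plus the \<open>h\<^sup>2\<close>
    part of the squared displacement.\<close>
  define R where "R \<omega> = V \<omega> - Y1 \<omega> * D \<omega> - Y2 \<omega> * ((D \<omega>)\<^sup>2 - h)" for \<omega>
  have ER: "expectation R = expectation V" "integrable M R"
    unfolding R_def using V D1 D2 by simp_all
  have Rle: "\<bar>R \<omega>\<bar> \<le> 4 * K * B ^ 3 * (h ^ 3 + \<bar>D \<omega>\<bar> ^ 3) + K * B\<^sup>2 * h\<^sup>2" for \<omega>
  proof -
    have "R \<omega> = (f (Z \<omega> + e \<omega>) - f (Z \<omega>) - f' (Z \<omega>) * e \<omega> - f'' (Z \<omega>) * (e \<omega>)\<^sup>2 / 2) + f'' (Z \<omega>) * (b \<omega>)\<^sup>2 * h\<^sup>2 / 2"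
      unfolding R_def V_def Y1_def Y2_def e_def by (simp add: power2_eq_square field_simps)
    moreover have "\<bar>e \<omega>\<bar> ^ 3 \<le> 4 * B ^ 3 * (h ^ 3 + \<bar>D \<omega>\<bar> ^ 3)"
    proof -
      have cube: "(u + v) ^ 3 \<le> 4 * (u ^ 3 + v ^ 3)" if "0 \<le> u" "0 \<le> v" for u v :: real
      proof -
        have "4 * (u ^ 3 + v ^ 3) - (u + v) ^ 3 = 3 * ((u + v) * (u - v)\<^sup>2)"
          by (simp add: power3_eq_cube power2_eq_square algebra_simps)
        moreover have "0 \<le> 3 * ((u + v) * (u - v)\<^sup>2)" using that by simp
        ultimately show ?thesis by linarith
      qed
      have "\<bar>e \<omega>\<bar> \<le> B * h + B * \<bar>D \<omega>\<bar>"
        unfolding e_def using bB[of \<omega>] gB[of \<omega>] h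
        by (intro order_trans[OF abs_triangle_ineq] add_mono) (auto simp: abs_mult intro!: mult_right_mono)
      then have "\<bar>e \<omega>\<bar> ^ 3 \<le> (B * (h + \<bar>D \<omega>\<bar>)) ^ 3" by (intro power_mono) (auto simp: algebra_simps)
      also have "\<dots> = B ^ 3 * (h + \<bar>D \<omega>\<bar>) ^ 3" by (simp add: power_mult_distrib)
      also have "\<dots> \<le> B ^ 3 * (4 * (h ^ 3 + \<bar>D \<omega>\<bar> ^ 3))"
        using B h by (intro mult_left_mono cube) auto
      finally show ?thesis by (simp only: mult_ac)
    qed
    then have "K * \<bar>e \<omega>\<bar> ^ 3 \<le> 4 * K * B ^ 3 * (h ^ 3 + \<bar>D \<omega>\<bar> ^ 3)"
      using mult_left_mono[OF _ T(6)] by (fastforce simp: mult_ac)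
    moreover have "\<bar>f'' (Z \<omega>) * (b \<omega>)\<^sup>2 * h\<^sup>2 / 2\<bar> \<le> K * B\<^sup>2 * h\<^sup>2"
    proof -
      have "\<bar>f'' (Z \<omega>) * (b \<omega>)\<^sup>2\<bar> * h\<^sup>2 \<le> K * B\<^sup>2 * h\<^sup>2" using bnd(6) by (intro mult_right_mono) auto
      moreover have "0 \<le> K * B\<^sup>2 * h\<^sup>2" using T(6) by simp
      moreover have "\<bar>f'' (Z \<omega>) * (b \<omega>)\<^sup>2 * h\<^sup>2 / 2\<bar> = \<bar>f'' (Z \<omega>) * (b \<omega>)\<^sup>2\<bar> * h\<^sup>2 / 2"
        by (simp add: abs_mult)
      ultimately show ?thesis by linarith
    qed
    ultimately show ?thesis
      using test_function_taylor[OF tf, of "Z \<omega>" "e \<omega>"] by linarith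
  qed
  have iD: "integrable M (\<lambda>\<omega>. \<bar>D \<omega>\<bar> ^ 3)" using mom(4) by (simp add: D_def)
  have ED: "expectation (\<lambda>\<omega>. \<bar>D \<omega>\<bar> ^ 3) \<le> 2 * sqrt h ^ 3" using mom(5) by (simp add: D_def)
  have "\<bar>expectation R\<bar> \<le> expectation (\<lambda>\<omega>. 4 * K * B ^ 3 * (h ^ 3 + \<bar>D \<omega>\<bar> ^ 3) + K * B\<^sup>2 * h\<^sup>2)"
    using abs_integral_le_integral[OF ER(2), of "\<lambda>\<omega>. 4 * K * B ^ 3 * (h ^ 3 + \<bar>D \<omega>\<bar> ^ 3) + K * B\<^sup>2 * h\<^sup>2"] Rle iD
    by simp
  also have "\<dots> = 4 * K * B ^ 3 * (h ^ 3 + expectation (\<lambda>\<omega>. \<bar>D \<omega>\<bar> ^ 3)) + K * B\<^sup>2 * h\<^sup>2"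
    using iD by (simp add: prob_space)
  also have "\<dots> \<le> 4 * K * B ^ 3 * (sqrt h ^ 3 + 2 * sqrt h ^ 3) + K * B\<^sup>2 * sqrt h ^ 3"
  proof -
    \<comment> \<open>All powers are expressed in \<open>sqrt h <= 1\<close>, so that higher ones
      are absorbed by the third.\<close>
    have sq: "h ^ 3 = sqrt h ^ 6" "h\<^sup>2 = sqrt h ^ 4"
      using h power_mult[of "sqrt h" 2 3] power_mult[of "sqrt h" 2 2] by auto
    have "h ^ 3 \<le> sqrt h ^ 3" "h\<^sup>2 \<le> sqrt h ^ 3"
      unfolding sq using h by (auto intro!: power_decreasing)
    then show ?thesis using ED T(6) B by (intro add_mono mult_left_mono) auto
  qed
  also have "\<dots> = (K * B\<^sup>2 + 12 * K * B ^ 3) * sqrt h ^ 3" by (simp add: algebra_simps)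
  finally have "\<bar>expectation V\<bar> \<le> (K * B\<^sup>2 + 12 * K * B ^ 3) * sqrt h ^ 3" unfolding ER .
  then show ?thesis unfolding EV by (simp add: e_def D_def Y2_def add.assoc)
qed

end

section \<open>Tightness, stopping on the grid, and passage to the limit\<close>

context cir_process_pos
begin

text \<open>The absolute value makes \<open>\<sigma>\<^sup>2 / 2 * \<bar>y\<bar>\<close> equal to \<open>(\<sigma> * sqrt y)\<^sup>2 / 2\<close> for negative \<open>y\<close>
  as well, because \<^const>\<open>sqrt\<close> is odd.\<close>

definition generator :: "(real \<Rightarrow> real) \<Rightarrow> (real \<Rightarrow> real) \<Rightarrow> real \<Rightarrow> real" where
  "generator f' f'' y = (a - k * y) * f' y + \<sigma>\<^sup>2 / 2 * \<bar>y\<bar> * f'' y"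

text \<open>The supremum of a path is taken over rational times, one unit beyond \<open>t\<close>, so that it is
  measurable and every point of \<open>[0, t]\<close> is a limit of rationals from the right.\<close>

lemma X_tight:
  assumes \<epsilon>: "\<epsilon> > 0"
  shows "\<exists>R>0. \<forall>S. finite S \<longrightarrow> S \<subseteq> {0..t} \<longrightarrow> prob {\<omega> \<in> space M. \<exists>s\<in>S. R < \<bar>X s \<omega>\<bar>} < \<epsilon>"
proof -
  let ?Q = "\<rat> \<inter> {0..t + 1}"
  define E where "E n = {\<omega> \<in> space M. \<exists>q\<in>?Q. real n < \<bar>X q \<omega>\<bar>}" for n
  have E [measurable]: "E n \<in> events" for n
  proof -
    have "E n = (\<Union>q\<in>?Q. {\<omega> \<in> space M. real n < \<bar>X q \<omega>\<bar>})" unfolding E_def by auto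
    moreover have "{\<omega> \<in> space M. real n < \<bar>X q \<omega>\<bar>} \<in> events" if "q \<in> ?Q" for q
    proof -
      have [measurable]: "X q \<in> borel_measurable M" using X_measurable that by simp
      show ?thesis by measurable
    qed
    ultimately show ?thesis using countable_rat by (auto intro!: sets.countable_UN')
  qed
  \<comment> \<open>Paths are bounded on the compact interval, so the indicators of
    \<open>E n\<close> vanish eventually; the level 1/2 only brings the events into the form of
    \<open>prob_gt_tendsto_0\<close>.\<close>
  have "(\<lambda>n. prob {\<omega> \<in> space M. 1 / 2 < (indicator (E n) \<omega> :: real)}) \<longlonglongrightarrow> 0"
  proof (rule prob_gt_tendsto_0)
    show "AE \<omega> in M. (\<lambda>n. indicator (E n) \<omega> :: real) \<longlonglongrightarrow> 0"
      using X_continuous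
    proof eventually_elim
      case (elim \<omega>)
      have "compact ((\<lambda>s. X s \<omega>) ` {0..t + 1})"
        using continuous_on_subset[OF elim, of "{0..t + 1}"] by (intro compact_continuous_image) auto
      then obtain C where C: "\<And>s. s \<in> {0..t + 1} \<Longrightarrow> \<bar>X s \<omega>\<bar> \<le> C"
        using compact_imp_bounded[THEN bounded_iff[THEN iffD1]] by fastforce
      have "\<forall>\<^sub>F n in sequentially. C < real n"
        by real_asymp
      then have "\<forall>\<^sub>F n in sequentially. (indicator (E n) \<omega> :: real) = 0"
      proof eventually_elim
        case (elim n) then show ?case using C by (force simp: E_def indicator_def)
      qed
      then show ?case by (rule tendsto_eventually)
    qed
  qed auto
  then have "(\<lambda>n. prob (E n)) \<longlonglongrightarrow> 0"
  proof (rule Lim_transform_eventually, intro always_eventually allI)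
    fix n
    have "{\<omega> \<in> space M. 1 / 2 < (indicator (E n) \<omega> :: real)} = E n" by (auto simp: E_def indicator_def)
    then show "prob {\<omega> \<in> space M. 1 / 2 < (indicator (E n) \<omega> :: real)} = prob (E n)" by simp
  qed
  then have "\<forall>\<^sub>F n in sequentially. prob (E n) < \<epsilon> \<and> 0 < n"
    using \<epsilon> by (intro eventually_conj order_tendstoD eventually_gt_at_top)
  then obtain n where n: "prob (E n) < \<epsilon>" "0 < n" by (rule eventually_happens'[OF sequentially_bot, THEN exE]) auto
  have "prob {\<omega> \<in> space M. \<exists>s\<in>S. real n < \<bar>X s \<omega>\<bar>} < \<epsilon>" if S: "finite S" "S \<subseteq> {0..t}" for S
  proof -
    have "prob {\<omega> \<in> space M. \<exists>s\<in>S. real n < \<bar>X s \<omega>\<bar>} \<le> prob (E n)"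
    proof (rule finite_measure_mono_AE)
      show "AE \<omega> in M. \<omega> \<in> {\<omega> \<in> space M. \<exists>s\<in>S. real n < \<bar>X s \<omega>\<bar>} \<longrightarrow> \<omega> \<in> E n"
        using X_continuous
      proof eventually_elim
        case (elim \<omega>)
        show ?case
        proof
          assume "\<omega> \<in> {\<omega> \<in> space M. \<exists>s\<in>S. real n < \<bar>X s \<omega>\<bar>}"
          then obtain s where s: "s \<in> S" "real n < \<bar>X s \<omega>\<bar>" "\<omega> \<in> space M" by auto
          have s0: "0 \<le> s" "s \<le> t" using s(1) S by auto
          have "((\<lambda>u. \<bar>X u \<omega>\<bar>) \<longlongrightarrow> \<bar>X s \<omega>\<bar>) (at s within {0..})"
            using elim s0 by (intro tendsto_rabs) (simp add: continuous_on_def)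
          then have "\<forall>\<^sub>F u in at s within {0..}. real n < \<bar>X u \<omega>\<bar>"
            using s(2) by (rule order_tendstoD)
          then obtain d where d: "d > 0" "\<And>u. u \<in> {0..} \<Longrightarrow> u \<noteq> s \<Longrightarrow> dist u s < d \<Longrightarrow> real n < \<bar>X u \<omega>\<bar>"
            unfolding eventually_at by auto
          obtain q where q: "q \<in> \<rat>" "s < q" "q < min (s + d) (t + 1)"
            using Rats_dense_in_real[of s "min (s + d) (t + 1)"] d(1) s0 by auto
          then show "\<omega> \<in> E n"
            using d(2)[of q] s0 s(3) by (auto simp: E_def dist_real_def intro!: bexI[of _ q])
        qed
      qed
    qed simp
    then show ?thesis using n by simp
  qed
  then show ?thesis using n(2) by (intro exI[of _ "real n"]) auto
qed

lemma generator_continuous: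
  assumes "test_function f f' f'' K"
  shows "continuous_on UNIV (generator f' f'')"
  unfolding generator_def using test_functionD(11,12)[OF assms] by (intro continuous_intros)

text \<open>Bounded convergence along continuous paths. It supplies the continuity needed for
  Riemann sums and for differentiating in time.\<close>

lemma continuous_expectation:
  fixes \<phi> :: "real \<Rightarrow> real"
  assumes c: "continuous_on UNIV \<phi>" and b: "\<And>y. \<bar>\<phi> y\<bar> \<le> G"
  shows "continuous_on {0..} (\<lambda>t. expectation (\<lambda>\<omega>. \<phi> (X t \<omega>)))"
  unfolding continuous_on_sequentially
proof (intro allI ballI impI)
  fix u :: "nat \<Rightarrow> real" and t assume t: "t \<in> {0..}" and u: "(\<forall>n. u n \<in> {0..}) \<and> u \<longlonglongrightarrow> t"
  have \<phi>: "\<phi> \<in> borel_measurable borel" using c by (rule borel_measurable_continuous_onI)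
  have "(\<lambda>n. expectation (\<lambda>\<omega>. \<phi> (X (u n) \<omega>))) \<longlonglongrightarrow> expectation (\<lambda>\<omega>. \<phi> (X t \<omega>))"
  proof (rule integral_dominated_convergence[where w="\<lambda>_. G"])
    show "AE \<omega> in M. (\<lambda>n. \<phi> (X (u n) \<omega>)) \<longlonglongrightarrow> \<phi> (X t \<omega>)"
      using X_continuous
    proof eventually_elim
      case (elim \<omega>)
      then have "(\<lambda>n. X (u n) \<omega>) \<longlonglongrightarrow> X t \<omega>"
        using u t unfolding continuous_on_sequentially by (auto simp: comp_def)
      moreover have "isCont \<phi> (X t \<omega>)" using c by (simp add: continuous_on_eq_continuous_at)
      ultimately show ?case using isCont_tendsto_compose by blast
    qed
    show "(\<lambda>\<omega>. \<phi> (X t \<omega>)) \<in> borel_measurable M" "(\<lambda>\<omega>. \<phi> (X (u n) \<omega>)) \<in> borel_measurable M" for n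
      using t u X_measurable by (auto intro!: measurable_compose[OF _ \<phi>])
  qed (use b in auto)
  then show "((\<lambda>t. expectation (\<lambda>\<omega>. \<phi> (X t \<omega>))) \<circ> u) \<longlonglongrightarrow> expectation (\<lambda>\<omega>. \<phi> (X t \<omega>))"
    by (simp add: comp_def)
qed

text \<open>Killing the increments once \<open>X\<close> has left \<open>[-R, R]\<close> on the grid bounds the coefficients, while
  up to that moment the scheme coincides with \<^const>\<open>euler\<close> and hence stays close to \<open>X\<close>.\<close>

definition inside :: "real \<Rightarrow> real \<Rightarrow> nat \<Rightarrow> 'a \<Rightarrow> real" where
  "inside R h i \<omega> = (if \<forall>j\<le>i. \<bar>X (real j * h) \<omega>\<bar> \<le> R then 1 else 0)"

definition stopped_euler :: "real \<Rightarrow> real \<Rightarrow> nat \<Rightarrow> 'a \<Rightarrow> real" where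
  "stopped_euler R h i \<omega> = x + (\<Sum>j<i. inside R h j \<omega> * ((a - k * X (real j * h) \<omega>) * h +
     \<sigma> * sqrt (X (real j * h) \<omega>) * (W (real (Suc j) * h) \<omega> - W (real j * h) \<omega>)))"

lemma inside_adapted: "h > 0 \<Longrightarrow> j \<le> i \<Longrightarrow> inside R h j \<in> borel_measurable (F (real i * h))"
proof -
  assume h: "h > 0" and j: "j \<le> i"
  have [measurable]: "X (real l * h) \<in> borel_measurable (F (real i * h))" if "l \<in> {..j}" for l
    using h j that by (intro measurable_F_mono[OF X_adapted]) (auto intro!: mult_right_mono)
  have "Measurable.pred (F (real i * h)) (\<lambda>\<omega>. \<forall>l\<in>{..j}. \<bar>X (real l * h) \<omega>\<bar> \<le> R)"
    by measurable
  then show ?thesis unfolding inside_def[abs_def] by (simp add: Ball_def)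
qed

lemma stopped_euler_adapted: "h > 0 \<Longrightarrow> stopped_euler R h i \<in> borel_measurable (F (real i * h))"
proof -
  assume h: "h > 0"
  have "X (real l * h) \<in> borel_measurable (F (real i * h))" "W (real l * h) \<in> borel_measurable (F (real i * h))"
    if "l \<le> i" for l
    using h that by (auto intro!: mult_right_mono measurable_F_mono[OF X_adapted] measurable_F_mono[OF W_adapted])
  note m = this
  show ?thesis
    unfolding stopped_euler_def[abs_def]
    by (intro borel_measurable_add borel_measurable_sum borel_measurable_times borel_measurable_diff
      borel_measurable_const measurable_compose[OF _ borel_measurable_sqrt] m inside_adapted h) auto
qed

lemma stopped_euler_eq: "inside R h i \<omega> \<noteq> 0 \<Longrightarrow> stopped_euler R h i \<omega> = euler h i \<omega>"
  unfolding stopped_euler_def euler_def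
  by (auto simp: inside_def split: if_splits intro!: sum.cong)

text \<open>Adds up \<open>N\<close> one-step estimates. \<open>B\<close> bounds drift and diffusion
  coefficient simultaneously while the path is within \<open>[-R, R]\<close>; after stopping both
  are zero.\<close>

lemma stopped_euler_ito:
  assumes tf: "test_function f f' f'' K" and h: "0 < h" "h \<le> 1" and R: "0 \<le> R"
  defines "B \<equiv> \<bar>a\<bar> + \<bar>k\<bar> * R + \<sigma> * sqrt R"
  shows "\<bar>expectation (\<lambda>\<omega>. f (stopped_euler R h N \<omega>)) - f x - (\<Sum>i<N. h * expectation (\<lambda>\<omega>. inside R h i \<omega> *
      ((a - k * X (real i * h) \<omega>) * f' (stopped_euler R h i \<omega>) +
       \<sigma>\<^sup>2 / 2 * \<bar>X (real i * h) \<omega>\<bar> * f'' (stopped_euler R h i \<omega>))))\<bar>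
    \<le> real N * ((K * B\<^sup>2 + 12 * K * B ^ 3) * sqrt h ^ 3)"
proof (induction N)
  case 0 then show ?case by (simp add: stopped_euler_def prob_space)
next
  case (Suc N)
  let ?s = "real N * h" and ?Z = "stopped_euler R h N"
  define b where "b \<omega> = inside R h N \<omega> * (a - k * X ?s \<omega>)" for \<omega>
  define g where "g \<omega> = inside R h N \<omega> * (\<sigma> * sqrt (X ?s \<omega>))" for \<omega>
  have s: "0 \<le> ?s" using h by simp
  have [measurable]: "X ?s \<in> borel_measurable (F ?s)" "inside R h N \<in> borel_measurable (F ?s)"
    using X_adapted[OF s] inside_adapted[OF h(1), of N N] by auto
  have b: "b \<in> borel_measurable (F ?s)" and g: "g \<in> borel_measurable (F ?s)"
    unfolding b_def g_def by measurable
  have "\<bar>b \<omega>\<bar> \<le> \<bar>a\<bar> + \<bar>k\<bar> * R" for \<omega>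
  proof (cases "inside R h N \<omega> = 0")
    case False
    then have "\<bar>X ?s \<omega>\<bar> \<le> R" by (auto simp: inside_def split: if_splits)
    then have "\<bar>k * X ?s \<omega>\<bar> \<le> \<bar>k\<bar> * R" by (simp add: abs_mult mult_left_mono)
    then have "\<bar>a - k * X ?s \<omega>\<bar> \<le> \<bar>a\<bar> + \<bar>k\<bar> * R" by linarith
    then show ?thesis using False by (auto simp: b_def inside_def split: if_splits)
  qed (use R in \<open>simp add: b_def\<close>)
  then have bB: "\<bar>b \<omega>\<bar> \<le> B" for \<omega>
    using R sigma_pos unfolding B_def by (intro order_trans[OF \<open>\<bar>b \<omega>\<bar> \<le> \<bar>a\<bar> + \<bar>k\<bar> * R\<close>]) simp
  have "\<bar>g \<omega>\<bar> \<le> \<sigma> * sqrt R" for \<omega>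
  proof (cases "inside R h N \<omega> = 0")
    case False
    then have "\<bar>X ?s \<omega>\<bar> \<le> R" by (auto simp: inside_def split: if_splits)
    then have "\<bar>\<sigma> * sqrt (X ?s \<omega>)\<bar> \<le> \<sigma> * sqrt R"
    proof -
      have "\<bar>sqrt y\<bar> = sqrt \<bar>y\<bar>" for y
        by (cases "0 \<le> y") (simp_all add: abs_of_neg abs_of_nonneg real_sqrt_minus)
      then show ?thesis using sigma_pos \<open>\<bar>X ?s \<omega>\<bar> \<le> R\<close> by (simp add: abs_mult)
    qed
    then show ?thesis using False by (auto simp: g_def inside_def split: if_splits)
  qed (use R sigma_pos in \<open>simp add: g_def\<close>)
  then have gB: "\<bar>g \<omega>\<bar> \<le> B" for \<omega>
    using R unfolding B_def by (intro order_trans[OF \<open>\<bar>g \<omega>\<bar> \<le> \<sigma> * sqrt R\<close>]) simp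
  have "stopped_euler R h (Suc N) = (\<lambda>\<omega>. ?Z \<omega> + b \<omega> * h + g \<omega> * (W (?s + h) \<omega> - W ?s \<omega>))"
    by (auto simp: fun_eq_iff stopped_euler_def b_def g_def algebra_simps)
  note eq1 = this
  \<comment> \<open>The weight is idempotent and, \<open>sqrt\<close> being odd, the square of
    \<open>sqrt y\<close> is \<open>\<bar>y\<bar>\<close>; hence the absolute value in
    \<open>generator\<close>.\<close>
  have eq2: "f' (?Z \<omega>) * b \<omega> + f'' (?Z \<omega>) * (g \<omega>)\<^sup>2 / 2 = inside R h N \<omega> *
      ((a - k * X ?s \<omega>) * f' (?Z \<omega>) + \<sigma>\<^sup>2 / 2 * \<bar>X ?s \<omega>\<bar> * f'' (?Z \<omega>))" for \<omega>
  proof -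
    have "inside R h N \<omega> * inside R h N \<omega> = inside R h N \<omega>" by (simp add: inside_def)
    moreover have "sqrt (X ?s \<omega>) * sqrt (X ?s \<omega>) = \<bar>X ?s \<omega>\<bar>" by simp
    ultimately have "(g \<omega>)\<^sup>2 = inside R h N \<omega> * (\<sigma>\<^sup>2 * \<bar>X ?s \<omega>\<bar>)"
      unfolding g_def power2_eq_square by (metis (no_types, opaque_lifting) mult.assoc mult.left_commute)
    then show ?thesis by (simp add: b_def algebra_simps)
  qed
  have "\<bar>expectation (\<lambda>\<omega>. f (stopped_euler R h (Suc N) \<omega>)) - expectation (\<lambda>\<omega>. f (?Z \<omega>))
      - h * expectation (\<lambda>\<omega>. inside R h N \<omega> *
      ((a - k * X ?s \<omega>) * f' (?Z \<omega>) + \<sigma>\<^sup>2 / 2 * \<bar>X ?s \<omega>\<bar> * f'' (?Z \<omega>)))\<bar> \<le> (K * B\<^sup>2 + 12 * K * B ^ 3) * sqrt h ^ 3"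
    using discrete_ito_step[OF tf s h stopped_euler_adapted[OF h(1), of R N] b g bB gB] unfolding eq1 eq2 .
  then show ?case using Suc by (simp only: sum.lessThan_Suc of_nat_Suc distrib_right mult_1)
qed

text \<open>Three cases: on stopped paths (probability at most \<open>q\<close>) sup bounds are
  used; on the others the scheme equals \<open>euler\<close>, and either it is within
  \<open>\<eta>\<close> of \<open>X\<close> and Lipschitz bounds apply, or an event of probability
  at most \<open>p\<close> occurs and twice the sup bound is paid.\<close>

lemma stopped_euler_generator_error:
  assumes tf: "test_function f f' f'' K" and h: "0 < h" and R: "0 \<le> R" and \<eta>: "\<eta> > 0"
    and G: "\<And>y. \<bar>generator f' f'' y\<bar> \<le> G"
    and p: "prob {\<omega> \<in> space M. \<eta> < \<bar>euler h i \<omega> - X (real i * h) \<omega>\<bar>} \<le> p"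
    and q: "prob {\<omega> \<in> space M. inside R h i \<omega> = 0} \<le> q"
  shows "\<bar>expectation (\<lambda>\<omega>. inside R h i \<omega> *
      ((a - k * X (real i * h) \<omega>) * f' (stopped_euler R h i \<omega>) +
       \<sigma>\<^sup>2 / 2 * \<bar>X (real i * h) \<omega>\<bar> * f'' (stopped_euler R h i \<omega>))) -
      expectation (\<lambda>\<omega>. generator f' f'' (X (real i * h) \<omega>))\<bar> \<le>
      G * q + (\<bar>a\<bar> + \<bar>k\<bar> * R + \<sigma>\<^sup>2 / 2 * R) * K * (\<eta> + 2 * p)"
    and "\<bar>expectation (\<lambda>\<omega>. f (stopped_euler R h i \<omega>)) - expectation (\<lambda>\<omega>. f (X (real i * h) \<omega>))\<bar> \<le>
      2 * K * q + K * (\<eta> + 2 * p)"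
proof -
  note T = test_functionD[OF tf]
  let ?X = "X (real i * h)" and ?Z = "stopped_euler R h i" and ?w = "inside R h i"
  let ?P = "{\<omega> \<in> space M. \<eta> < \<bar>euler h i \<omega> - ?X \<omega>\<bar>}" and ?Q = "{\<omega> \<in> space M. ?w \<omega> = 0}"
  let ?C = "\<bar>a\<bar> + \<bar>k\<bar> * R + \<sigma>\<^sup>2 / 2 * R"
  have ih: "0 \<le> real i * h" using h by simp
  have C: "0 \<le> ?C" using R by simp
  have G0: "0 \<le> G" using G abs_ge_zero order_trans by blast
  note [measurable] = T(13-15)
  have gm: "generator f' f'' \<in> borel_measurable borel"
    using generator_continuous[OF tf] by (rule borel_measurable_continuous_onI)
  have XM [measurable]: "?X \<in> borel_measurable M" using X_measurable[OF ih] .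
  have [measurable]: "euler h i \<in> borel_measurable M" using euler_measurable[of h i] h by simp
  have wM [measurable]: "?w \<in> borel_measurable M" using measurable_F_M[OF inside_adapted[OF h, of i i]] by simp
  have ZM [measurable]: "?Z \<in> borel_measurable M" using measurable_F_M[OF stopped_euler_adapted[OF h]] .
  have wX: "\<bar>?X \<omega>\<bar> \<le> R" "?w \<omega> = 1" "?Z \<omega> = euler h i \<omega>" if "?w \<omega> \<noteq> 0" for \<omega>
    using that stopped_euler_eq[OF that] by (auto simp: inside_def split: if_splits)
  \<comment> \<open>One pointwise bound covering both unstopped cases, stated for arbitrary
    \<open>\<phi>\<close> because it is applied to \<open>f\<close>, \<open>f'\<close> and
    \<open>f''\<close>.\<close>
  have near: "\<bar>\<phi> (?Z \<omega>) - \<phi> (?X \<omega>)\<bar> \<le> K * (\<eta> + 2 * indicator ?P \<omega>)"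
    if "?w \<omega> \<noteq> 0" "\<omega> \<in> space M" "\<And>y. \<bar>\<phi> y\<bar> \<le> K" "\<And>y z. \<bar>\<phi> y - \<phi> z\<bar> \<le> K * \<bar>y - z\<bar>" for \<phi> \<omega>
  proof (cases "\<omega> \<in> ?P")
    case True
    have "\<bar>\<phi> (?Z \<omega>) - \<phi> (?X \<omega>)\<bar> \<le> 2 * K" using that(3)[of "?Z \<omega>"] that(3)[of "?X \<omega>"] by linarith
    also have "\<dots> \<le> K * (\<eta> + 2)" using \<eta> T(6) by (simp add: algebra_simps)
    finally show ?thesis using True by simp
  next
    case False
    then have "\<bar>?Z \<omega> - ?X \<omega>\<bar> \<le> \<eta>" using wX(3)[OF that(1)] that(2) by auto
    then have "K * \<bar>?Z \<omega> - ?X \<omega>\<bar> \<le> K * \<eta>" using T(6) by (intro mult_left_mono)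
    then show ?thesis using that(4)[of "?Z \<omega>" "?X \<omega>"] False by simp
  qed
  define Y where "Y \<omega> = ?w \<omega> * ((a - k * ?X \<omega>) * f' (?Z \<omega>) + \<sigma>\<^sup>2 / 2 * \<bar>?X \<omega>\<bar> * f'' (?Z \<omega>))" for \<omega>
  have coef: "\<bar>(a - k * ?X \<omega>) * u + \<sigma>\<^sup>2 / 2 * \<bar>?X \<omega>\<bar> * v\<bar> \<le> ?C * c"
    if "?w \<omega> \<noteq> 0" "\<bar>u\<bar> \<le> c" "\<bar>v\<bar> \<le> c" for \<omega> u v c
  proof -
    have X: "\<bar>?X \<omega>\<bar> \<le> R" using wX(1)[OF that(1)] .
    have "\<bar>k * ?X \<omega>\<bar> \<le> \<bar>k\<bar> * R" using X by (simp add: abs_mult mult_left_mono)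
    then have "\<bar>a - k * ?X \<omega>\<bar> \<le> \<bar>a\<bar> + \<bar>k\<bar> * R" by linarith
    then have "\<bar>(a - k * ?X \<omega>) * u\<bar> \<le> (\<bar>a\<bar> + \<bar>k\<bar> * R) * c"
      using that(2) unfolding abs_mult by (intro mult_mono) auto
    moreover have "\<bar>\<sigma>\<^sup>2 / 2 * \<bar>?X \<omega>\<bar> * v\<bar> \<le> \<sigma>\<^sup>2 / 2 * R * c"
      using that(3) X R by (simp add: abs_mult) (intro mult_mono, auto)
    ultimately show ?thesis by (simp add: distrib_right)
  qed
  have Yint: "integrable M Y"
  proof (rule integrable_const_bound)
    show "AE \<omega> in M. norm (Y \<omega>) \<le> ?C * K"
    proof (intro AE_I2)
      fix \<omega>
      show "norm (Y \<omega>) \<le> ?C * K"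
      proof (cases "?w \<omega> = 0")
        case False
        then show ?thesis using coef[OF False T(4) T(5), of "?Z \<omega>" "?Z \<omega>"] wX(2)[OF False] by (simp add: Y_def)
      qed (use C T(6) in \<open>simp add: Y_def\<close>)
    qed
    show "Y \<in> borel_measurable M" unfolding Y_def by measurable
  qed
  have gint: "integrable M (\<lambda>\<omega>. generator f' f'' (?X \<omega>))"
    using G by (intro integrable_const_bound[of _ G]) (auto intro: measurable_compose[OF XM gm])
  have fX: "integrable M (\<lambda>\<omega>. f (?X \<omega>))"
    by (rule integrable_const_bound[of _ K]) (use T(3) in auto)
  have fZ: "integrable M (\<lambda>\<omega>. f (?Z \<omega>))"
    by (rule integrable_const_bound[of _ K]) (use T(3) in auto)
  have bint: "integrable M (\<lambda>\<omega>. c * indicator ?Q \<omega> + d * (\<eta> + 2 * indicator ?P \<omega>))" for c d :: real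
    by (intro Bochner_Integration.integrable_add integrable_mult_right integrable_const integrable_real_indicator)
      (auto simp: less_top[symmetric])
  have bexp: "expectation (\<lambda>\<omega>. c * indicator ?Q \<omega> + d * (\<eta> + 2 * indicator ?P \<omega>)) = c * prob ?Q + d * (\<eta> + 2 * prob ?P)"
    for c d :: real
    proof -
    have sub: "?Q \<inter> space M = ?Q" "?P \<inter> space M = ?P" by auto
    have i: "integrable M (indicator ?Q :: _ \<Rightarrow> real)" "integrable M (indicator ?P :: _ \<Rightarrow> real)"
      by (intro integrable_real_indicator; simp add: less_top[symmetric])+
    then show ?thesis using sub by (simp add: prob_space)
  qed
  have le: "\<bar>expectation U - expectation V\<bar> \<le> c * q + d * (\<eta> + 2 * p)"
    if "integrable M U" "integrable M V" "0 \<le> c" "0 \<le> d"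
      "\<And>\<omega>. \<omega> \<in> space M \<Longrightarrow> \<bar>U \<omega> - V \<omega>\<bar> \<le> c * indicator ?Q \<omega> + d * (\<eta> + 2 * indicator ?P \<omega>)" for U V c d
  proof -
    have "\<bar>expectation U - expectation V\<bar> = \<bar>expectation (\<lambda>\<omega>. U \<omega> - V \<omega>)\<bar>" using that by simp
    also have "\<dots> \<le> expectation (\<lambda>\<omega>. c * indicator ?Q \<omega> + d * (\<eta> + 2 * indicator ?P \<omega>))"
      using abs_integral_le_integral[of M "\<lambda>\<omega>. U \<omega> - V \<omega>", OF _ bint[of c d]] that by simp
    also have "\<dots> \<le> c * q + d * (\<eta> + 2 * p)"
      unfolding bexp using p q that(3,4) by (intro add_mono mult_left_mono) auto
    finally show ?thesis .
  qed
  have "\<bar>expectation Y - expectation (\<lambda>\<omega>. generator f' f'' (?X \<omega>))\<bar> \<le> G * q + (?C * K) * (\<eta> + 2 * p)"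
  proof (rule le[OF Yint gint G0])
    fix \<omega> assume \<omega>: "\<omega> \<in> space M"
    show "\<bar>Y \<omega> - generator f' f'' (?X \<omega>)\<bar> \<le> G * indicator ?Q \<omega> + (?C * K) * (\<eta> + 2 * indicator ?P \<omega>)"
    proof (cases "?w \<omega> = 0")
      case True
      have "0 \<le> (?C * K) * (\<eta> + 2 * indicator ?P \<omega>)" using C T(6) \<eta> by (intro mult_nonneg_nonneg) auto
      then show ?thesis using True G[of "?X \<omega>"] \<omega> by (simp add: Y_def)
    next
      case False
      have "Y \<omega> - generator f' f'' (?X \<omega>) = (a - k * ?X \<omega>) * (f' (?Z \<omega>) - f' (?X \<omega>)) +
          \<sigma>\<^sup>2 / 2 * \<bar>?X \<omega>\<bar> * (f'' (?Z \<omega>) - f'' (?X \<omega>))"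
        using wX(2)[OF False] by (simp add: Y_def generator_def algebra_simps)
      then have "\<bar>Y \<omega> - generator f' f'' (?X \<omega>)\<bar> \<le> ?C * (K * (\<eta> + 2 * indicator ?P \<omega>))"
        using coef[OF False near[OF False \<omega> T(4) T(8)] near[OF False \<omega> T(5) T(9)]] by (simp only:)
      then show ?thesis using False by (simp add: mult.assoc)
    qed
  qed (use C T(6) in simp)
  then show "\<bar>expectation (\<lambda>\<omega>. ?w \<omega> * ((a - k * ?X \<omega>) * f' (?Z \<omega>) + \<sigma>\<^sup>2 / 2 * \<bar>?X \<omega>\<bar> * f'' (?Z \<omega>))) -
      expectation (\<lambda>\<omega>. generator f' f'' (?X \<omega>))\<bar> \<le> G * q + ?C * K * (\<eta> + 2 * p)"
    unfolding Y_def .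
  show "\<bar>expectation (\<lambda>\<omega>. f (?Z \<omega>)) - expectation (\<lambda>\<omega>. f (?X \<omega>))\<bar> \<le> 2 * K * q + K * (\<eta> + 2 * p)"
  proof (rule le[OF fZ fX])
    fix \<omega> assume \<omega>: "\<omega> \<in> space M"
    show "\<bar>f (?Z \<omega>) - f (?X \<omega>)\<bar> \<le> 2 * K * indicator ?Q \<omega> + K * (\<eta> + 2 * indicator ?P \<omega>)"
    proof (cases "?w \<omega> = 0")
      case True
      have "0 \<le> K * (\<eta> + 2 * indicator ?P \<omega>)" using T(6) \<eta> by (intro mult_nonneg_nonneg) auto
      moreover have "2 * K * indicator ?Q \<omega> = 2 * K" using True \<omega> by simp
      ultimately show ?thesis using T(3)[of "?Z \<omega>"] T(3)[of "?X \<omega>"] by linarith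
    qed (use near[OF _ \<omega> T(3) T(7)] in simp)
  qed (use T(6) in auto)
qed

text \<open>Four errors separate the two sides: the accumulated Taylor error, the scheme replacing
  \<open>X\<close> inside the generator, the Riemann sum, and the scheme replacing \<open>X\<close>
  at the final time. Each is at most a constant times an arbitrary \<epsilon>. The radius
  \<open>R\<close> is chosen first, then \<open>\<eta>\<close> depending on it, then the
  mesh.\<close>

lemma expectation_generator:
  assumes tf: "test_function f f' f'' K" and G: "\<And>y. \<bar>generator f' f'' y\<bar> \<le> G" and t: "t > 0"
  shows "expectation (\<lambda>\<omega>. f (X t \<omega>)) =
    f x + (LINT s:{0..t}|lborel. expectation (\<lambda>\<omega>. generator f' f'' (X s \<omega>)))"
proof -
  note T = test_functionD[OF tf]
  define g where "g s = expectation (\<lambda>\<omega>. generator f' f'' (X s \<omega>))" for s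
  define L where "L = \<bar>expectation (\<lambda>\<omega>. f (X t \<omega>)) - f x - (LINT s:{0..t}|lborel. g s)\<bar>"
  have G0: "0 \<le> G" using G abs_ge_zero order_trans by blast
  have "continuous_on {0..} g"
    unfolding g_def using continuous_expectation[OF generator_continuous[OF tf] G] .
  then have gc: "continuous_on {0..t} g" by (rule continuous_on_subset) auto
  \<comment> \<open>Collects \<open>t * (G + 3)\<close> from the generator, \<open>5 * K\<close>
    from the final time, and 1 each from the Taylor error and the Riemann sum.\<close>
  define C where "C = t * G + 5 * K + 3 * t + 2"
  have "L \<le> \<epsilon> * C" if \<epsilon>: "\<epsilon> > 0" for \<epsilon>
  proof -
    obtain R where R: "R > 0" and tight: "\<And>S. finite S \<Longrightarrow> S \<subseteq> {0..t} \<Longrightarrow> prob {\<omega> \<in> space M. \<exists>s\<in>S. R < \<bar>X s \<omega>\<bar>} < \<epsilon>"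
      using X_tight[OF \<epsilon>, of t] by blast
    define CR where "CR = (\<bar>a\<bar> + \<bar>k\<bar> * R + \<sigma>\<^sup>2 / 2 * R) * K"
    define B where "B = \<bar>a\<bar> + \<bar>k\<bar> * R + \<sigma> * sqrt R"
    define D where "D = (K * B\<^sup>2 + 12 * K * B ^ 3)"
    have CR: "0 \<le> CR" using R T(6) by (simp add: CR_def)
    \<comment> \<open>Small enough to compensate the constant \<open>CR\<close>, which grows with
      the radius.\<close>
    define \<eta> where "\<eta> = \<epsilon> / (1 + CR)"
    have \<eta>: "\<eta> > 0" "\<eta> \<le> \<epsilon>" "CR * \<eta> \<le> \<epsilon>"
      using \<epsilon> CR by (auto simp: \<eta>_def field_simps)
    have "(\<lambda>N. D * t * sqrt (t / real N)) \<longlonglongrightarrow> D * t * sqrt 0"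
      by (intro tendsto_intros lim_const_over_n)
    then have e1: "\<forall>\<^sub>F N in sequentially. D * t * sqrt (t / real N) < \<epsilon>"
      using \<epsilon> by (intro order_tendstoD(2)) auto
    have "(\<lambda>N. t / real N) \<longlonglongrightarrow> 0" by (rule lim_const_over_n)
    then have e2: "\<forall>\<^sub>F N in sequentially. t / real N < 1" by (rule order_tendstoD(2)) simp
    have "(\<lambda>N. \<bar>(\<Sum>j<N. g (real j * (t / real N)) * (t / real N)) - (LINT s:{0..t}|lborel. g s)\<bar>) \<longlonglongrightarrow> 0"
      using riemann_sum_tendsto[OF t gc] by (intro tendsto_rabs_zero LIM_zero)
    then have e3: "\<forall>\<^sub>F N in sequentially. \<bar>(\<Sum>j<N. g (real j * (t / real N)) * (t / real N)) - (LINT s:{0..t}|lborel. g s)\<bar> < \<epsilon>"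
      using \<epsilon> by (rule order_tendstoD(2))
    have "\<forall>\<^sub>F N in sequentially. L \<le> \<epsilon> * C"
      \<comment> \<open>\<open>\<eta>\<close> serves both as distance and as probability, so that
        \<eta> + 2p becomes 3\<eta>.\<close>
      using e1 e2 e3 euler_converges_in_prob[OF t \<eta>(1) \<eta>(1)] eventually_gt_at_top[of 0]
    proof eventually_elim
      case (elim N)
      define h where "h = t / real N"
      have h: "0 < h" "h \<le> 1" "real N * h = t" using elim t by (auto simp: h_def)
      have q: "prob {\<omega> \<in> space M. inside R h i \<omega> = 0} \<le> \<epsilon>" if "i \<le> N" for i
      proof -
        have "{\<omega> \<in> space M. inside R h i \<omega> = 0} = {\<omega> \<in> space M. \<exists>s\<in>(\<lambda>j. real j * h) ` {..i}. R < \<bar>X s \<omega>\<bar>}"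
          by (auto simp: inside_def not_le)
        moreover have "real j * h \<le> t" if "j \<le> i" for j
          using h that \<open>i \<le> N\<close> unfolding h(3)[symmetric] by (intro mult_right_mono) auto
        ultimately show ?thesis using tight[of "(\<lambda>j. real j * h) ` {..i}"] h(1) by (simp add: image_subset_iff less_imp_le)
      qed
      have p: "prob {\<omega> \<in> space M. \<eta> < \<bar>euler h i \<omega> - X (real i * h) \<omega>\<bar>} \<le> \<eta>" if "i \<le> N" for i
        using elim(4) that by (simp add: h_def less_imp_le)
      note er = stopped_euler_generator_error[OF tf h(1) less_imp_le[OF R] \<eta>(1) G p q, folded CR_def]
      let ?E = "\<lambda>i. expectation (\<lambda>\<omega>. inside R h i \<omega> *
          ((a - k * X (real i * h) \<omega>) * f' (stopped_euler R h i \<omega>) +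
           \<sigma>\<^sup>2 / 2 * \<bar>X (real i * h) \<omega>\<bar> * f'' (stopped_euler R h i \<omega>)))"
      have "\<bar>?E i - g (real i * h)\<bar> \<le> G * \<epsilon> + 3 * \<epsilon>" if "i < N" for i
        using er(1)[of i] that \<eta>(3) by (simp add: g_def algebra_simps)
      then have "\<bar>\<Sum>i<N. h * (?E i - g (real i * h))\<bar> \<le> (\<Sum>i<N. h * (G * \<epsilon> + 3 * \<epsilon>))"
        using h(1) by (intro order_trans[OF sum_abs] sum_mono) (simp add: abs_mult)
      also have "\<dots> = t * (G * \<epsilon> + 3 * \<epsilon>)" using h(3) by (simp add: mult.assoc[symmetric])
      finally have A: "\<bar>(\<Sum>i<N. h * ?E i) - (\<Sum>i<N. g (real i * h) * h)\<bar> \<le> t * (G * \<epsilon> + 3 * \<epsilon>)"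
        by (simp add: right_diff_distrib sum_subtractf mult.commute)
      have Bd: "\<bar>expectation (\<lambda>\<omega>. f (stopped_euler R h N \<omega>)) - expectation (\<lambda>\<omega>. f (X t \<omega>))\<bar> \<le> 5 * K * \<epsilon>"
      proof -
        have "K * \<eta> \<le> K * \<epsilon>" using \<eta>(2) T(6) by (rule mult_left_mono)
        then show ?thesis using er(2)[of N] h(3) by (simp add: algebra_simps)
      qed
      have "\<bar>expectation (\<lambda>\<omega>. f (stopped_euler R h N \<omega>)) - f x - (\<Sum>i<N. h * ?E i)\<bar> \<le> real N * (D * sqrt h ^ 3)"
        using stopped_euler_ito[OF tf h(1,2) less_imp_le[OF R], of N] unfolding D_def B_def .
      also have "\<dots> = D * t * sqrt h"
        using h(1) unfolding h(3)[symmetric] by (simp add: power3_eq_cube)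
      also have "\<dots> \<le> \<epsilon>" using elim(1) by (simp add: h_def)
      finally have I: "\<bar>expectation (\<lambda>\<omega>. f (stopped_euler R h N \<omega>)) - f x - (\<Sum>i<N. h * ?E i)\<bar> \<le> \<epsilon>" .
      have "\<bar>(\<Sum>j<N. g (real j * h) * h) - (LINT s:{0..t}|lborel. g s)\<bar> \<le> \<epsilon>"
        using elim(3) by (simp add: h_def)
      then have "L \<le> t * (G * \<epsilon> + 3 * \<epsilon>) + 5 * K * \<epsilon> + 2 * \<epsilon>"
        using A Bd I unfolding L_def by linarith
      then show ?case by (simp add: C_def algebra_simps)
    qed
    then show ?thesis by simp
  qed
  note le = this
  have "L \<le> 0"
  proof (rule field_le_epsilon)
    fix e :: real assume e: "e > 0"
    have C: "C > 0" using t G0 T(6) by (simp add: C_def add_nonneg_pos)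
    show "L \<le> 0 + e" using le[of "e / C"] e C by simp
  qed
  then show ?thesis unfolding L_def g_def by linarith
qed

end


section \<open>Truncated powers\<close>

text \<open>This truncation of the identity is chosen because \<open>y * cutoff' \<epsilon> y\<close> and \<open>y * cutoff'' \<epsilon> y\<close> are
  dominated by \<open>cutoff \<epsilon> y\<close> itself, uniformly in \<open>\<epsilon>\<close>: the generator applied to its powers then
  satisfies a growth bound that survives \<open>\<epsilon> \<rightarrow> 0\<close>.\<close>

definition cutoff :: "real \<Rightarrow> real \<Rightarrow> real" where
  "cutoff \<epsilon> y = y / (1 + \<epsilon> * y\<^sup>2)"

definition cutoff' :: "real \<Rightarrow> real \<Rightarrow> real" where
  "cutoff' \<epsilon> y = (1 - \<epsilon> * y\<^sup>2) / (1 + \<epsilon> * y\<^sup>2)\<^sup>2"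

definition cutoff'' :: "real \<Rightarrow> real \<Rightarrow> real" where
  "cutoff'' \<epsilon> y = 2 * \<epsilon> * y * (\<epsilon> * y\<^sup>2 - 3) / (1 + \<epsilon> * y\<^sup>2) ^ 3"

definition cutoff''' :: "real \<Rightarrow> real \<Rightarrow> real" where
  "cutoff''' \<epsilon> y = (36 * \<epsilon>\<^sup>2 * y\<^sup>2 - 6 * \<epsilon> ^ 3 * y ^ 4 - 6 * \<epsilon>) / (1 + \<epsilon> * y\<^sup>2) ^ 4"

text \<open>The second bound lets the denominator absorb the factor \<open>\<epsilon> * y\<close> in
  the numerator of \<open>cutoff''\<close>.\<close>

lemma cutoff_denominator:
  assumes "0 < \<epsilon>" "\<epsilon> \<le> 1"
  shows "1 \<le> 1 + \<epsilon> * (y::real)\<^sup>2" "\<epsilon> * \<bar>y\<bar> \<le> 1 + \<epsilon> * y\<^sup>2"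
proof -
  show "1 \<le> 1 + \<epsilon> * y\<^sup>2" using assms by simp
  have "\<epsilon> * \<bar>y\<bar> \<le> \<epsilon> * (1 + y\<^sup>2)"
  proof (rule mult_left_mono)
    have "0 \<le> (\<bar>y\<bar> - 1)\<^sup>2" by simp
    then have "2 * \<bar>y\<bar> \<le> 1 + y\<^sup>2" by (simp add: power2_eq_square algebra_simps)
    then show "\<bar>y\<bar> \<le> 1 + y\<^sup>2" using abs_ge_zero[of y] by linarith
  qed (use assms in simp)
  also have "\<dots> \<le> 1 + \<epsilon> * y\<^sup>2" using assms by (simp add: distrib_left)
  finally show "\<epsilon> * \<bar>y\<bar> \<le> 1 + \<epsilon> * y\<^sup>2" .
qed

lemma cutoff_deriv:
  assumes "0 < \<epsilon>" "\<epsilon> \<le> 1"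
  shows "(cutoff \<epsilon> has_real_derivative cutoff' \<epsilon> y) (at y)"
    and "(cutoff' \<epsilon> has_real_derivative cutoff'' \<epsilon> y) (at y)"
    and "(cutoff'' \<epsilon> has_real_derivative cutoff''' \<epsilon> y) (at y)"
proof -
  define q where "q = 1 + \<epsilon> * y\<^sup>2"
  have q: "q \<noteq> 0" "q = 1 + \<epsilon> * y\<^sup>2" using cutoff_denominator(1)[OF assms, of y] by (auto simp: q_def)
  have dq: "((\<lambda>y. 1 + \<epsilon> * y\<^sup>2) has_real_derivative 2 * \<epsilon> * y) (at y)"
    by (auto intro!: derivative_eq_intros)
  have dq2: "((\<lambda>y. (1 + \<epsilon> * y\<^sup>2) ^ n) has_real_derivative real n * q ^ (n - 1) * (2 * \<epsilon> * y)) (at y)" for n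
    using DERIV_power[OF dq, of n] by (simp add: q_def mult_ac)
  show "(cutoff \<epsilon> has_real_derivative cutoff' \<epsilon> y) (at y)"
  proof -
    have "((\<lambda>y. y / (1 + \<epsilon> * y\<^sup>2)) has_real_derivative (1 * q - y * (2 * \<epsilon> * y)) / (q * q)) (at y)"
      unfolding q_def using q by (intro DERIV_divide dq DERIV_ident) (auto simp: q_def)
    also have "(1 * q - y * (2 * \<epsilon> * y)) / (q * q) = cutoff' \<epsilon> y"
      unfolding cutoff'_def q(2)[symmetric] using q by (simp add: power2_eq_square algebra_simps)
    finally show ?thesis unfolding cutoff_def[abs_def] .
  qed
  show "(cutoff' \<epsilon> has_real_derivative cutoff'' \<epsilon> y) (at y)"
  proof -
    have d: "((\<lambda>y. 1 - \<epsilon> * y\<^sup>2) has_real_derivative - (2 * \<epsilon> * y)) (at y)"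
      by (auto intro!: derivative_eq_intros)
    have "((\<lambda>y. (1 - \<epsilon> * y\<^sup>2) / (1 + \<epsilon> * y\<^sup>2)\<^sup>2) has_real_derivative
        (- (2 * \<epsilon> * y) * q\<^sup>2 - (1 - \<epsilon> * y\<^sup>2) * (2 * q * (2 * \<epsilon> * y))) / (q\<^sup>2 * q\<^sup>2)) (at y)"
      using q DERIV_divide[OF d dq2[of 2]] by (simp add: q_def)
    \<comment> \<open>The quotient rule leaves a common factor \<open>q\<close>, cancelled here to
      reach the stated denominator; the third derivative is treated in the same way.\<close>
    also have "(- (2 * \<epsilon> * y) * q\<^sup>2 - (1 - \<epsilon> * y\<^sup>2) * (2 * q * (2 * \<epsilon> * y))) / (q\<^sup>2 * q\<^sup>2) =
        (q * (2 * \<epsilon> * y * (\<epsilon> * y\<^sup>2 - 3))) / (q * q ^ 3)"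
    proof -
      have "- (2 * \<epsilon> * y) * q\<^sup>2 - (1 - \<epsilon> * y\<^sup>2) * (2 * q * (2 * \<epsilon> * y)) = q * (2 * \<epsilon> * y * (\<epsilon> * y\<^sup>2 - 3))"
        unfolding q(2) by (simp add: power2_eq_square algebra_simps)
      moreover have "q\<^sup>2 * q\<^sup>2 = q * q ^ 3" by (simp add: eval_nat_numeral)
      ultimately show ?thesis by simp
    qed
    also have "\<dots> = cutoff'' \<epsilon> y"
      unfolding cutoff''_def q(2)[symmetric] using q(1) by simp
    finally show ?thesis unfolding cutoff'_def[abs_def] .
  qed
  show "(cutoff'' \<epsilon> has_real_derivative cutoff''' \<epsilon> y) (at y)"
  proof -
    have d: "((\<lambda>y. 2 * \<epsilon> * y * (\<epsilon> * y\<^sup>2 - 3)) has_real_derivative 6 * \<epsilon>\<^sup>2 * y\<^sup>2 - 6 * \<epsilon>) (at y)"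
      by (auto intro!: derivative_eq_intros simp: power2_eq_square algebra_simps)
    have "((\<lambda>y. 2 * \<epsilon> * y * (\<epsilon> * y\<^sup>2 - 3) / (1 + \<epsilon> * y\<^sup>2) ^ 3) has_real_derivative
        ((6 * \<epsilon>\<^sup>2 * y\<^sup>2 - 6 * \<epsilon>) * q ^ 3 - 2 * \<epsilon> * y * (\<epsilon> * y\<^sup>2 - 3) * (3 * q\<^sup>2 * (2 * \<epsilon> * y))) / (q ^ 3 * q ^ 3)) (at y)"
      using q DERIV_divide[OF d dq2[of 3]] by (simp add: q_def)
    also have "((6 * \<epsilon>\<^sup>2 * y\<^sup>2 - 6 * \<epsilon>) * q ^ 3 - 2 * \<epsilon> * y * (\<epsilon> * y\<^sup>2 - 3) * (3 * q\<^sup>2 * (2 * \<epsilon> * y))) / (q ^ 3 * q ^ 3) =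
        (q\<^sup>2 * (36 * \<epsilon>\<^sup>2 * y\<^sup>2 - 6 * \<epsilon> ^ 3 * y ^ 4 - 6 * \<epsilon>)) / (q\<^sup>2 * q ^ 4)"
    proof -
      have "(6 * \<epsilon>\<^sup>2 * y\<^sup>2 - 6 * \<epsilon>) * q ^ 3 - 2 * \<epsilon> * y * (\<epsilon> * y\<^sup>2 - 3) * (3 * q\<^sup>2 * (2 * \<epsilon> * y)) =
          q\<^sup>2 * ((6 * \<epsilon>\<^sup>2 * y\<^sup>2 - 6 * \<epsilon>) * q - 2 * \<epsilon> * y * (\<epsilon> * y\<^sup>2 - 3) * (3 * (2 * \<epsilon> * y)))"
        by (simp add: eval_nat_numeral algebra_simps)
      also have "(6 * \<epsilon>\<^sup>2 * y\<^sup>2 - 6 * \<epsilon>) * q - 2 * \<epsilon> * y * (\<epsilon> * y\<^sup>2 - 3) * (3 * (2 * \<epsilon> * y)) =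
          36 * \<epsilon>\<^sup>2 * y\<^sup>2 - 6 * \<epsilon> ^ 3 * y ^ 4 - 6 * \<epsilon>"
        unfolding q(2) by (simp add: eval_nat_numeral algebra_simps)
      finally show ?thesis by (simp add: eval_nat_numeral)
    qed
    also have "\<dots> = cutoff''' \<epsilon> y"
      unfolding cutoff'''_def q(2)[symmetric] by (rule mult_divide_mult_cancel_left) (use q(1) in simp)
    finally show ?thesis unfolding cutoff''_def[abs_def] .
  qed
qed

text \<open>With q = 1 + \<epsilon> y^2, the function equals y / q and its first two derivatives are
  at most 1 / q and 6 / q; multiplication by \<open>\<bar>y\<bar>\<close> gives back the function.
  For the third derivative, w = \<epsilon> y^2 turns the numerator into 6 \<epsilon> (6 w - w^2 -
  1), and the bracket is at most 3 (1 + w)^2.\<close>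

lemma cutoff_bounds:
  assumes "0 < \<epsilon>" "\<epsilon> \<le> 1"
  shows "\<bar>cutoff \<epsilon> y\<bar> \<le> \<bar>y\<bar>" "\<bar>cutoff \<epsilon> y\<bar> \<le> 1 / \<epsilon>" "\<bar>cutoff' \<epsilon> y\<bar> \<le> 1"
    "\<bar>y * cutoff' \<epsilon> y\<bar> \<le> \<bar>cutoff \<epsilon> y\<bar>" "\<bar>cutoff'' \<epsilon> y\<bar> \<le> 6" "\<bar>y * cutoff'' \<epsilon> y\<bar> \<le> 6 * \<bar>cutoff \<epsilon> y\<bar>"
    "\<bar>cutoff''' \<epsilon> y\<bar> \<le> 18"
proof -
  define q where "q = 1 + \<epsilon> * y\<^sup>2"
  have q: "1 \<le> q" "\<epsilon> * \<bar>y\<bar> \<le> q" using cutoff_denominator[OF assms, of y] by (auto simp: q_def)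
  have u: "0 \<le> \<epsilon> * y\<^sup>2" using assms by simp
  have abs_q: "\<bar>q\<bar> = q" using q by simp
  have n1: "\<bar>1 - \<epsilon> * y\<^sup>2\<bar> \<le> q" using u unfolding q_def by linarith
  have n2: "\<bar>\<epsilon> * y\<^sup>2 - 3\<bar> \<le> 3 * q" 
  proof -
    have "\<bar>v - 3\<bar> \<le> 3 * (1 + v)" if "0 \<le> v" for v :: real using that by (simp add: abs_le_iff)
    then show ?thesis using u unfolding q_def by blast
  qed
  have c: "\<bar>cutoff \<epsilon> y\<bar> = \<bar>y\<bar> / q" unfolding cutoff_def q_def[symmetric] using q by (simp add: abs_divide)
  have c': "\<bar>cutoff' \<epsilon> y\<bar> \<le> 1 / q"
  proof -
    have "\<bar>cutoff' \<epsilon> y\<bar> = \<bar>1 - \<epsilon> * y\<^sup>2\<bar> / q\<^sup>2" unfolding cutoff'_def q_def[symmetric] by (simp add: abs_divide)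
    also have "\<dots> \<le> q / q\<^sup>2" using n1 by (intro divide_right_mono) auto
    finally show ?thesis using q by (simp add: power2_eq_square)
  qed
  have c'': "\<bar>cutoff'' \<epsilon> y\<bar> \<le> 6 / q"
  proof -
    have "\<bar>cutoff'' \<epsilon> y\<bar> = 2 * (\<epsilon> * \<bar>y\<bar>) * \<bar>\<epsilon> * y\<^sup>2 - 3\<bar> / q ^ 3"
      unfolding cutoff''_def q_def[symmetric] using q assms by (simp add: abs_divide abs_mult)
    also have "\<dots> \<le> 2 * q * (3 * q) / q ^ 3"
      using q n2 assms by (intro divide_right_mono mult_mono) auto
    also have "\<dots> = 6 / q" using q by (simp add: power3_eq_cube)
    finally show ?thesis .
  qed
  have iq: "1 / q \<le> 1" "0 < q" using q by auto
  show "\<bar>cutoff \<epsilon> y\<bar> \<le> \<bar>y\<bar>" unfolding c using q iq by (simp add: divide_le_eq mult_le_cancel_left1)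
  show "\<bar>cutoff \<epsilon> y\<bar> \<le> 1 / \<epsilon>" unfolding c using q iq assms by (simp add: field_simps)
  show "\<bar>cutoff' \<epsilon> y\<bar> \<le> 1" using c' iq by linarith
  show "\<bar>y * cutoff' \<epsilon> y\<bar> \<le> \<bar>cutoff \<epsilon> y\<bar>"
    unfolding c abs_mult using mult_left_mono[OF c' abs_ge_zero, of y] by simp
  show "\<bar>cutoff'' \<epsilon> y\<bar> \<le> 6" 
  proof -
    have "6 / q \<le> 6" using q by (simp add: divide_le_eq)
    then show ?thesis using c'' by linarith
  qed
  show "\<bar>y * cutoff'' \<epsilon> y\<bar> \<le> 6 * \<bar>cutoff \<epsilon> y\<bar>"
    unfolding c abs_mult using mult_left_mono[OF c'' abs_ge_zero, of y] by (simp add: mult.commute)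
  have "\<bar>cutoff''' \<epsilon> y\<bar> = \<bar>36 * \<epsilon>\<^sup>2 * y\<^sup>2 - 6 * \<epsilon> ^ 3 * y ^ 4 - 6 * \<epsilon>\<bar> / q ^ 4"
    unfolding cutoff'''_def q_def[symmetric] using q by (simp add: abs_divide)
  also have "\<dots> \<le> 18 * q\<^sup>2 / q ^ 4"
  proof (rule divide_right_mono)
    have e: "36 * \<epsilon>\<^sup>2 * y\<^sup>2 - 6 * \<epsilon> ^ 3 * y ^ 4 - 6 * \<epsilon> = 6 * \<epsilon> * (6 * (\<epsilon> * y\<^sup>2) - (\<epsilon> * y\<^sup>2)\<^sup>2 - 1)"
      by (simp add: eval_nat_numeral algebra_simps)
    have "\<bar>6 * (\<epsilon> * y\<^sup>2) - (\<epsilon> * y\<^sup>2)\<^sup>2 - 1\<bar> \<le> 3 * q\<^sup>2"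
    proof -
      have "3 * q\<^sup>2 = 3 + 6 * (\<epsilon> * y\<^sup>2) + 3 * (\<epsilon> * y\<^sup>2)\<^sup>2"
        unfolding q_def by (simp add: power2_eq_square algebra_simps)
      then show ?thesis using u zero_le_power2[of "\<epsilon> * y\<^sup>2"] by linarith
    qed
    then have "6 * \<epsilon> * \<bar>6 * (\<epsilon> * y\<^sup>2) - (\<epsilon> * y\<^sup>2)\<^sup>2 - 1\<bar> \<le> 6 * 1 * (3 * q\<^sup>2)"
      using assms by (intro mult_mono) auto
    then show "\<bar>36 * \<epsilon>\<^sup>2 * y\<^sup>2 - 6 * \<epsilon> ^ 3 * y ^ 4 - 6 * \<epsilon>\<bar> \<le> 18 * q\<^sup>2"
      unfolding e using assms by (simp add: abs_mult)
  qed (use q in simp)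
  also have "\<dots> = 18 / q\<^sup>2" using q by (simp add: eval_nat_numeral)
  also have "\<dots> \<le> 18" using q one_le_power[OF q(1), of 2] by (simp add: divide_le_eq)
  finally show "\<bar>cutoff''' \<epsilon> y\<bar> \<le> 18" .
qed

definition cutoff_power' :: "nat \<Rightarrow> real \<Rightarrow> real \<Rightarrow> real" where
  "cutoff_power' n \<epsilon> y = real n * cutoff \<epsilon> y ^ (n - 1) * cutoff' \<epsilon> y"

definition cutoff_power'' :: "nat \<Rightarrow> real \<Rightarrow> real \<Rightarrow> real" where
  "cutoff_power'' n \<epsilon> y = real n * (real (n - 1) * cutoff \<epsilon> y ^ (n - 2) * (cutoff' \<epsilon> y)\<^sup>2 + cutoff \<epsilon> y ^ (n - 1) * cutoff'' \<epsilon> y)"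

text \<open>The constant grows with a power of 1 / \<epsilon>. That is harmless, as it only licenses
  \<open>expectation_generator\<close> at fixed \<epsilon>; the uniform bounds come from
  \<open>growth\<close>.\<close>

lemma test_function_cutoff_power:
  assumes \<epsilon>: "0 < \<epsilon>" "\<epsilon> \<le> 1"
  shows "\<exists>K. test_function (\<lambda>y. cutoff \<epsilon> y ^ n) (cutoff_power' n \<epsilon>) (cutoff_power'' n \<epsilon>) K"
proof -
  define E where "E = 1 / \<epsilon>"
  have E: "1 \<le> E" using \<epsilon> by (simp add: E_def)
  let ?c = "cutoff \<epsilon>" and ?c' = "cutoff' \<epsilon>" and ?c'' = "cutoff'' \<epsilon>" and ?c''' = "cutoff''' \<epsilon>"
  note cb = cutoff_bounds[OF \<epsilon>, folded E_def] and d = cutoff_deriv[OF \<epsilon>]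
  have cp: "\<bar>?c y ^ j\<bar> \<le> E ^ n" if "j \<le> n" for y j
  proof -
    have "\<bar>?c y ^ j\<bar> \<le> E ^ j" unfolding power_abs by (intro power_mono cb) auto
    also have "\<dots> \<le> E ^ n" using E that by (rule power_increasing[rotated])
    finally show ?thesis .
  qed
  \<comment> \<open>The third derivative, needed for the Lipschitz bound. Truncated exponents such
    as \<open>n - 3\<close> do no harm: the factors \<open>real n\<close>,
    \<open>real (n - 1)\<close>, \<open>real (n - 2)\<close> vanish in those cases.\<close>
  define t where "t y = real n * (real (n - 1) * (real (n - 2) * ?c y ^ (n - 3) * ?c' y ^ 3 + ?c y ^ (n - 2) * (3 * ?c' y * ?c'' y))
     + ?c y ^ (n - 1) * ?c''' y)" for y
  have d1: "((\<lambda>y. ?c y ^ n) has_real_derivative cutoff_power' n \<epsilon> y) (at y)" for y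
    unfolding cutoff_power'_def by (rule derivative_eq_intros d refl)+ simp
  have d2: "(cutoff_power' n \<epsilon> has_real_derivative cutoff_power'' n \<epsilon> y) (at y)" for y
    unfolding cutoff_power'_def[abs_def] cutoff_power''_def
    by (rule derivative_eq_intros d refl)+ (simp add: power2_eq_square algebra_simps numeral_2_eq_2)
  have d3: "(cutoff_power'' n \<epsilon> has_real_derivative t y) (at y)" for y
    unfolding cutoff_power''_def[abs_def] t_def
    by (rule derivative_eq_intros d refl)+
      (simp add: power2_eq_square power3_eq_cube algebra_simps numeral_2_eq_2 numeral_3_eq_3)
  have c'p: "\<bar>?c' y ^ j\<bar> \<le> 1" for y j unfolding power_abs using cb(3) by (intro power_le_one) auto
  have b1: "\<bar>cutoff_power' n \<epsilon> y\<bar> \<le> real n * E ^ n" for y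
  proof -
    have "\<bar>?c y ^ (n - 1)\<bar> * \<bar>?c' y\<bar> \<le> E ^ n * 1" using E by (intro mult_mono cp cb) auto
    then show ?thesis unfolding cutoff_power'_def abs_mult mult.assoc by (intro mult_mono) auto
  qed
  have b2: "\<bar>cutoff_power'' n \<epsilon> y\<bar> \<le> real n * (real (n - 1) * E ^ n + 6 * E ^ n)" for y
  proof -
    have "\<bar>?c y ^ (n - 2)\<bar> * \<bar>(?c' y)\<^sup>2\<bar> \<le> E ^ n * 1" using E by (intro mult_mono cp c'p) auto
    then have "\<bar>real (n - 1) * ?c y ^ (n - 2) * (?c' y)\<^sup>2\<bar> \<le> real (n - 1) * E ^ n"
      unfolding abs_mult mult.assoc by (intro mult_mono) auto
    moreover have "\<bar>?c y ^ (n - 1) * ?c'' y\<bar> \<le> E ^ n * 6" unfolding abs_mult using E by (intro mult_mono cp cb) auto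
    ultimately have "\<bar>real (n - 1) * ?c y ^ (n - 2) * (?c' y)\<^sup>2 + ?c y ^ (n - 1) * ?c'' y\<bar> \<le> real (n - 1) * E ^ n + 6 * E ^ n"
      by linarith
    then show ?thesis unfolding cutoff_power''_def abs_mult[of "real n"] by (intro mult_mono) auto
  qed
  define K3 where "K3 = real n * (real (n - 1) * (real (n - 2) * E ^ n + 18 * E ^ n) + 18 * E ^ n)"
  have b3: "\<bar>t y\<bar> \<le> K3" for y
  proof -
    have "\<bar>?c y ^ (n - 3)\<bar> * \<bar>?c' y ^ 3\<bar> \<le> E ^ n * 1" using E by (intro mult_mono cp c'p) auto
    then have "\<bar>real (n - 2) * ?c y ^ (n - 3) * ?c' y ^ 3\<bar> \<le> real (n - 2) * E ^ n"
      unfolding abs_mult mult.assoc by (intro mult_mono) auto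
    moreover have "\<bar>?c' y\<bar> * \<bar>?c'' y\<bar> \<le> 1 * 6" by (intro mult_mono cb) auto
    then have "\<bar>?c y ^ (n - 2)\<bar> * \<bar>3 * ?c' y * ?c'' y\<bar> \<le> E ^ n * 18"
      using E by (intro mult_mono cp) (auto simp: abs_mult)
    then have "\<bar>?c y ^ (n - 2) * (3 * ?c' y * ?c'' y)\<bar> \<le> E ^ n * 18" unfolding abs_mult[of "_ ^ _"] .
    ultimately have "\<bar>real (n - 2) * ?c y ^ (n - 3) * ?c' y ^ 3 + ?c y ^ (n - 2) * (3 * ?c' y * ?c'' y)\<bar> \<le> real (n - 2) * E ^ n + 18 * E ^ n"
      by linarith
    then have "\<bar>real (n - 1) * (real (n - 2) * ?c y ^ (n - 3) * ?c' y ^ 3 + ?c y ^ (n - 2) * (3 * ?c' y * ?c'' y))\<bar> \<le>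
        real (n - 1) * (real (n - 2) * E ^ n + 18 * E ^ n)"
      unfolding abs_mult[of "real (n - 1)"] by (intro mult_mono) auto
    moreover have "\<bar>?c y ^ (n - 1) * ?c''' y\<bar> \<le> E ^ n * 18" unfolding abs_mult using E by (intro mult_mono cp cb) auto
    ultimately have "\<bar>real (n - 1) * (real (n - 2) * ?c y ^ (n - 3) * ?c' y ^ 3 + ?c y ^ (n - 2) * (3 * ?c' y * ?c'' y)) + ?c y ^ (n - 1) * ?c''' y\<bar>
        \<le> real (n - 1) * (real (n - 2) * E ^ n + 18 * E ^ n) + 18 * E ^ n"
      by linarith
    then show ?thesis unfolding t_def abs_mult[of "real n"] K3_def by (intro mult_mono) auto
  qed
  define K where "K = Max {E ^ n, real n * E ^ n, real n * (real (n - 1) * E ^ n + 6 * E ^ n), K3}"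
  have K: "E ^ n \<le> K" "real n * E ^ n \<le> K" "real n * (real (n - 1) * E ^ n + 6 * E ^ n) \<le> K" "K3 \<le> K"
    unfolding K_def by (auto intro!: Max_ge)
  have "\<bar>cutoff_power'' n \<epsilon> y - cutoff_power'' n \<epsilon> z\<bar> \<le> K * \<bar>y - z\<bar>" for y z
    using lipschitz_of_deriv_bounded[OF d3, of K] b3 K(4) order_trans by blast
  then have "test_function (\<lambda>y. ?c y ^ n) (cutoff_power' n \<epsilon>) (cutoff_power'' n \<epsilon>) K"
    unfolding test_function_def using d1 d2 cp[OF order_refl] b1 b2 K by (meson order_trans)
  then show ?thesis by blast
qed

lemma cutoff_tendsto:
  shows "(\<lambda>m. cutoff (1 / real (Suc m)) y) \<longlonglongrightarrow> y"
    and "(\<lambda>m. cutoff' (1 / real (Suc m)) y) \<longlonglongrightarrow> 1"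
    and "(\<lambda>m. cutoff'' (1 / real (Suc m)) y) \<longlonglongrightarrow> 0"
proof -
  have e: "(\<lambda>m. 1 / real (Suc m)) \<longlonglongrightarrow> 0" using LIMSEQ_Suc[OF lim_const_over_n[of 1]] by simp
  have "(\<lambda>m. y / (1 + 1 / real (Suc m) * y\<^sup>2)) \<longlonglongrightarrow> y / (1 + 0 * y\<^sup>2)"
    by (intro tendsto_intros e) simp
  then show "(\<lambda>m. cutoff (1 / real (Suc m)) y) \<longlonglongrightarrow> y" unfolding cutoff_def by simp
  have "(\<lambda>m. (1 - 1 / real (Suc m) * y\<^sup>2) / (1 + 1 / real (Suc m) * y\<^sup>2)\<^sup>2) \<longlonglongrightarrow> (1 - 0 * y\<^sup>2) / (1 + 0 * y\<^sup>2)\<^sup>2"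
    by (intro tendsto_intros e) simp
  then show "(\<lambda>m. cutoff' (1 / real (Suc m)) y) \<longlonglongrightarrow> 1" unfolding cutoff'_def by simp
  have "(\<lambda>m. 2 * (1 / real (Suc m)) * y * (1 / real (Suc m) * y\<^sup>2 - 3) / (1 + 1 / real (Suc m) * y\<^sup>2) ^ 3) \<longlonglongrightarrow>
      2 * 0 * y * (0 * y\<^sup>2 - 3) / (1 + 0 * y\<^sup>2) ^ 3"
    by (intro tendsto_intros e) simp
  then show "(\<lambda>m. cutoff'' (1 / real (Suc m)) y) \<longlonglongrightarrow> 0" unfolding cutoff''_def by simp
qed

lemma power_le_one_plus: "j \<le> n \<Longrightarrow> 0 \<le> z \<Longrightarrow> z ^ j \<le> 1 + z ^ n" for z :: real
proof (cases "z \<le> 1")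
  case True
  assume "0 \<le> z"
  then show ?thesis using True power_le_one[of z j] zero_le_power[of z n] by linarith
next
  case False
  assume "j \<le> n"
  then show ?thesis using False power_increasing[of j n z] by linarith
qed

section \<open>Generator bounds for truncated powers, uniform in the truncation\<close>

context cir_process_pos
begin

text \<open>The sum of the bounds for drift and diffusion part; the 6 stems from the bound on
  \<open>y * cutoff'' \<epsilon> y\<close>, and \<epsilon> does not occur.\<close>

definition growth :: "nat \<Rightarrow> real" where
  "growth n = real n * \<bar>a\<bar> + real n * \<bar>k\<bar> + \<sigma>\<^sup>2 / 2 * (real n * real (n - 1) + 6 * real n)"

lemma growth_nonneg: "0 \<le> growth n"
  by (simp add: growth_def)

text \<open>Every factor \<open>y\<close> in the generator is paired with a derivative of
  \<open>cutoff\<close>, and the product is again at most a multiple of \<open>cutoff\<close>. So no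
  degree beyond \<open>n\<close> arises.\<close>

lemma generator_cutoff_power_le:
  assumes \<epsilon>: "0 < \<epsilon>" "\<epsilon> \<le> 1" and n: "0 < n"
  shows "\<bar>generator (cutoff_power' n \<epsilon>) (cutoff_power'' n \<epsilon>) y\<bar> \<le> growth n * (1 + \<bar>cutoff \<epsilon> y\<bar> ^ n)"
proof -
  let ?c = "cutoff \<epsilon> y" and ?c' = "cutoff' \<epsilon> y" and ?c'' = "cutoff'' \<epsilon> y"
  define P where "P = 1 + \<bar>?c\<bar> ^ n"
  note cb = cutoff_bounds[OF \<epsilon>, of y]
  have p: "\<bar>?c ^ j\<bar> \<le> P" if "j \<le> n" for j
    unfolding P_def power_abs using that by (intro power_le_one_plus) auto
  have p1: "\<bar>?c ^ (n - 1)\<bar> * \<bar>?c\<bar> \<le> P"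
    using p[of n] n by (cases n) (auto simp: abs_mult mult.commute power_abs)
  have 1: "\<bar>?c ^ (n - 1)\<bar> * \<bar>?c'\<bar> \<le> P" using mult_mono[OF p[of "n - 1"] cb(3)] by (auto simp: P_def)
  have 2: "\<bar>?c ^ (n - 1)\<bar> * \<bar>y * ?c'\<bar> \<le> P" using mult_left_mono[OF cb(4), of "\<bar>?c ^ (n - 1)\<bar>"] p1 by linarith
  \<comment> \<open>For \<open>n = 1\<close> the exponent \<open>n - 2\<close> is truncated, but the
    coefficient is zero; otherwise one power of \<open>cutoff\<close> is regained from
    \<open>y * cutoff'\<close>.\<close>
  have 3: "real (n - 1) * (\<bar>?c ^ (n - 2)\<bar> * (\<bar>?c'\<bar> * \<bar>y * ?c'\<bar>)) \<le> real (n - 1) * P"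
  proof (cases "n - 1 = 0")
    case False
    then obtain l where l: "n = Suc (Suc l)" by (metis Suc_pred diff_Suc_1 n not_gr_zero)
    have "\<bar>?c'\<bar> * \<bar>y * ?c'\<bar> \<le> 1 * \<bar>?c\<bar>" using cb(3,4) by (intro mult_mono) auto
    then have "\<bar>?c ^ (n - 2)\<bar> * (\<bar>?c'\<bar> * \<bar>y * ?c'\<bar>) \<le> \<bar>?c ^ (n - 2)\<bar> * \<bar>?c\<bar>" by (intro mult_left_mono) auto
    also have "\<dots> = \<bar>?c ^ (n - 1)\<bar>" by (simp add: l abs_mult)
    also have "\<dots> \<le> P" by (rule p) simp
    finally show ?thesis by (intro mult_left_mono) auto
  qed simp
  have 4: "\<bar>?c ^ (n - 1)\<bar> * \<bar>y * ?c''\<bar> \<le> 6 * P"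
    using mult_left_mono[OF cb(6), of "\<bar>?c ^ (n - 1)\<bar>"] p1 by linarith
  have g0: "generator (cutoff_power' n \<epsilon>) (cutoff_power'' n \<epsilon>) y = a * (real n * (?c ^ (n - 1) * ?c')) - k * (real n * (?c ^ (n - 1) * (y * ?c'))) +
      \<sigma>\<^sup>2 / 2 * (real n * (\<bar>y\<bar> * (real (n - 1) * (?c ^ (n - 2) * (?c' * ?c')) + ?c ^ (n - 1) * ?c'')))"
    unfolding generator_def cutoff_power'_def cutoff_power''_def by (simp add: power2_eq_square algebra_simps)
  have g1: "\<bar>a * (real n * (?c ^ (n - 1) * ?c'))\<bar> \<le> \<bar>a\<bar> * (real n * P)"
    using 1 by (simp add: abs_mult mult_left_mono)
  have g2: "\<bar>k * (real n * (?c ^ (n - 1) * (y * ?c')))\<bar> \<le> \<bar>k\<bar> * (real n * P)"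
    using 2 by (simp add: abs_mult mult_left_mono)
  have g3: "\<bar>\<sigma>\<^sup>2 / 2 * (real n * (\<bar>y\<bar> * (real (n - 1) * (?c ^ (n - 2) * (?c' * ?c')) + ?c ^ (n - 1) * ?c'')))\<bar> \<le>
      \<sigma>\<^sup>2 / 2 * (real n * (real (n - 1) * P + 6 * P))"
  proof -
    have "\<bar>\<bar>y\<bar> * (real (n - 1) * (?c ^ (n - 2) * (?c' * ?c')) + ?c ^ (n - 1) * ?c'')\<bar> \<le>
        real (n - 1) * (\<bar>?c ^ (n - 2)\<bar> * (\<bar>?c'\<bar> * \<bar>y * ?c'\<bar>)) + \<bar>?c ^ (n - 1)\<bar> * \<bar>y * ?c''\<bar>"
      unfolding distrib_left by (rule order_trans[OF abs_triangle_ineq]) (simp add: abs_mult mult_ac del: abs_mult_self_eq)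
    also have "\<dots> \<le> real (n - 1) * P + 6 * P" using 3 4 by (rule add_mono)
    finally show ?thesis
      unfolding abs_mult[of "\<sigma>\<^sup>2 / 2"] abs_mult[of "real n"] by (intro mult_mono) auto
  qed
  have tri: "\<bar>A - B + C\<bar> \<le> A' + B' + C'" if "\<bar>A\<bar> \<le> A'" "\<bar>B\<bar> \<le> B'" "\<bar>C\<bar> \<le> C'" for A B C A' B' C' :: real
    using that by linarith
  have "\<bar>generator (cutoff_power' n \<epsilon>) (cutoff_power'' n \<epsilon>) y\<bar> \<le>
      \<bar>a\<bar> * (real n * P) + \<bar>k\<bar> * (real n * P) + \<sigma>\<^sup>2 / 2 * (real n * (real (n - 1) * P + 6 * P))"
    unfolding g0 by (rule tri[OF g1 g2 g3])
  also have "\<dots> = growth n * P" by (simp add: growth_def algebra_simps)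
  finally show ?thesis unfolding P_def .
qed

text \<open>The first bound makes the generator identity applicable at fixed \<epsilon>, the second
  is the dominating function when \<epsilon> tends to 0.\<close>

lemma generator_cutoff_power_bounded:
  assumes \<epsilon>: "0 < \<epsilon>" "\<epsilon> \<le> 1" and n: "0 < n"
  shows "\<bar>generator (cutoff_power' n \<epsilon>) (cutoff_power'' n \<epsilon>) y\<bar> \<le> growth n * (1 + (1 / \<epsilon>) ^ n)"
    and "\<bar>generator (cutoff_power' n \<epsilon>) (cutoff_power'' n \<epsilon>) y\<bar> \<le> growth n * (1 + \<bar>y\<bar> ^ n)"
proof -
  have "growth n * (1 + \<bar>cutoff \<epsilon> y\<bar> ^ n) \<le> growth n * (1 + (1 / \<epsilon>) ^ n)"
    "growth n * (1 + \<bar>cutoff \<epsilon> y\<bar> ^ n) \<le> growth n * (1 + \<bar>y\<bar> ^ n)"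
    using cutoff_bounds(1,2)[OF \<epsilon>, of y] growth_nonneg by (auto intro!: mult_left_mono power_mono)
  then show "\<bar>generator (cutoff_power' n \<epsilon>) (cutoff_power'' n \<epsilon>) y\<bar> \<le> growth n * (1 + (1 / \<epsilon>) ^ n)"
    "\<bar>generator (cutoff_power' n \<epsilon>) (cutoff_power'' n \<epsilon>) y\<bar> \<le> growth n * (1 + \<bar>y\<bar> ^ n)"
    using generator_cutoff_power_le[OF assms, of y] by linarith+
qed

end


section \<open>Moments\<close>

lemma set_integral_point: "(LINT s:{c}|lborel. g s) = 0" for g :: "real \<Rightarrow> real"
proof -
  have "(\<lambda>s. indicator {c} s *\<^sub>R g s) = (\<lambda>s. indicator {c} s * g c)"
    by (auto simp: indicator_def fun_eq_iff)
  then show ?thesis unfolding set_lebesgue_integral_def by simp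
qed

text \<open>The fundamental theorem of calculus, after identifying the set integral with the gauge
  integral.\<close>

lemma primitive_has_real_derivative:
  fixes u g :: "real \<Rightarrow> real"
  assumes u: "\<And>t. t \<in> {0..T} \<Longrightarrow> u t = c + (LINT s:{0..t}|lborel. g s)"
    and g: "continuous_on {0..T} g" and t: "t \<in> {0..T}"
  shows "(u has_real_derivative g t) (at t within {0..T})"
proof -
  have eq: "u s = c + integral {0..s} g" if "s \<in> {0..T}" for s
  proof -
    have "set_integrable lborel {0..s} g"
      using continuous_on_subset[OF g] that by (intro borel_integrable_atLeastAtMost') auto
    then show ?thesis using u[OF that] set_borel_integral_eq_integral(2) by simp
  qed
  have "((\<lambda>s. c + integral {0..s} g) has_real_derivative g t) (at t within {0..T})"
    using integral_has_real_derivative[OF g t] by (auto intro!: derivative_eq_intros)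
  then show ?thesis
    by (rule has_field_derivative_transform_within[OF _ zero_less_one t]) (use eq in auto)
qed

context cir_process_pos
begin

lemma expectation_X0:
  assumes "\<phi> \<in> borel_measurable borel"
  shows "expectation (\<lambda>\<omega>. \<phi> (X 0 \<omega>)) = (\<phi> x :: real)"
proof -
  have "expectation (\<lambda>\<omega>. \<phi> (X 0 \<omega>)) = expectation (\<lambda>\<omega>. \<phi> x)"
    using X_start assms X_measurable[of 0] by (intro integral_cong_AE) auto
  then show ?thesis by (simp add: prob_space)
qed

text \<open>Gronwall's inequality for \<open>1 + E (cutoff \<epsilon> (X t) ^ n)\<close>, with a constant that does not
  depend on \<open>\<epsilon>\<close>.\<close>

lemma expectation_cutoff_power_le:
  assumes \<epsilon>: "0 < \<epsilon>" "\<epsilon> \<le> 1" and n: "0 < n" "even n" and t: "t \<in> {0..T}"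
  shows "expectation (\<lambda>\<omega>. cutoff \<epsilon> (X t \<omega>) ^ n) \<le> (1 + \<bar>x\<bar> ^ n) * exp (growth n * T)"
proof -
  let ?f = "\<lambda>y. cutoff \<epsilon> y ^ n"
  obtain K where tf: "test_function ?f (cutoff_power' n \<epsilon>) (cutoff_power'' n \<epsilon>) K"
    using test_function_cutoff_power[OF \<epsilon>] by blast
  note TF = test_functionD[OF tf]
  note G = generator_cutoff_power_bounded(1)[OF \<epsilon> n(1)]
  define u where "u s = expectation (\<lambda>\<omega>. ?f (X s \<omega>))" for s
  define g where "g s = expectation (\<lambda>\<omega>. generator (cutoff_power' n \<epsilon>) (cutoff_power'' n \<epsilon>) (X s \<omega>))" for s
  define C where "C = growth n"
  have C: "0 \<le> C" by (simp add: C_def growth_nonneg)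
  have gc: "continuous_on {0..T} g"
    unfolding g_def by (rule continuous_on_subset[OF continuous_expectation[OF generator_continuous[OF tf] G]]) auto
  have u: "u s = ?f x + (LINT r:{0..s}|lborel. g r)" if "s \<in> {0..T}" for s
  proof (cases "s = 0")
    case True
    then show ?thesis using expectation_X0[OF TF(13)] by (simp add: u_def set_integral_point)
  next
    case False
    then show ?thesis
      using expectation_generator[OF tf G, of s] that unfolding u_def g_def by auto
  qed
  have du: "(u has_real_derivative g s) (at s within {0..T})" if "s \<in> {0..T}" for s
    using primitive_has_real_derivative[OF u gc that] .
  have gm: "generator (cutoff_power' n \<epsilon>) (cutoff_power'' n \<epsilon>) \<in> borel_measurable borel"
    using generator_continuous[OF tf] by (rule borel_measurable_continuous_onI)
  have gu: "g s \<le> C * (1 + u s)" if "s \<in> {0..T}" for s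
  proof -
    have XM [measurable]: "X s \<in> borel_measurable M" using X_measurable that by simp
    have i1: "integrable M (\<lambda>\<omega>. generator (cutoff_power' n \<epsilon>) (cutoff_power'' n \<epsilon>) (X s \<omega>))"
      using G by (intro integrable_const_bound[where B="growth n * (1 + (1 / \<epsilon>) ^ n)"]) (auto intro: measurable_compose[OF XM gm])
    have i2: "integrable M (\<lambda>\<omega>. ?f (X s \<omega>))"
      using TF(3) by (intro integrable_const_bound[where B=K]) (auto intro: measurable_compose[OF XM TF(13)])
    have "g s \<le> expectation (\<lambda>\<omega>. C * (1 + ?f (X s \<omega>)))"
      unfolding g_def
    proof (rule integral_mono[OF i1])
      show "integrable M (\<lambda>\<omega>. C * (1 + ?f (X s \<omega>)))" using i2 by simp
      show "generator (cutoff_power' n \<epsilon>) (cutoff_power'' n \<epsilon>) (X s \<omega>) \<le> C * (1 + ?f (X s \<omega>))" for \<omega>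
        using generator_cutoff_power_le[OF \<epsilon> n(1), of "X s \<omega>"] n(2) by (simp add: C_def power_even_abs)
    qed
    also have "\<dots> = C * (1 + u s)" using i2 by (simp add: u_def prob_space)
    finally show ?thesis .
  qed
  \<comment> \<open>Integrating factor: the growth bound \<open>gu\<close> makes the derivative of
    \<open>v\<close> nonpositive.\<close>
  define v where "v s = exp (- C * s) * (1 + u s)" for s
  have dv: "(v has_real_derivative exp (- C * s) * (g s - C * (1 + u s))) (at s within {0..T})" if "s \<in> {0..T}" for s
    unfolding v_def by (rule derivative_eq_intros du[OF that] refl)+ (simp add: algebra_simps)
  have "v t \<le> v 0"
  proof (rule DERIV_nonpos_imp_decreasing_open[where f=v and a=0 and b=t])
    show "0 \<le> t" using t by simp
    show "continuous_on {0..t} v"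
      using DERIV_continuous_on[OF dv] by (rule continuous_on_subset) (use t in auto)
    fix s assume s: "0 < s" "s < t"
    then have sT: "s \<in> interior {0..T}" "s \<in> {0..T}" using t by auto
    then have "(v has_real_derivative exp (- C * s) * (g s - C * (1 + u s))) (at s)"
      using dv[OF sT(2)] at_within_interior[OF sT(1)] by (simp only:)
    moreover have "exp (- C * s) * (g s - C * (1 + u s)) \<le> 0"
      using gu[OF sT(2)] by (intro mult_nonneg_nonpos) auto
    ultimately show "\<exists>y. (v has_real_derivative y) (at s) \<and> y \<le> 0" by blast
  qed
  moreover have "u 0 = ?f x" using expectation_X0[OF TF(13)] by (simp add: u_def)
  ultimately have "exp (- C * t) * (1 + u t) \<le> 1 + ?f x" by (simp add: v_def)
  then have "exp (C * t) * (exp (- C * t) * (1 + u t)) \<le> exp (C * t) * (1 + ?f x)" by (intro mult_left_mono) auto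
  then have "1 + u t \<le> exp (C * t) * (1 + ?f x)" by (simp add: mult.assoc[symmetric] exp_minus)
  also have "\<dots> \<le> exp (C * T) * (1 + \<bar>x\<bar> ^ n)"
  proof (rule mult_mono)
    show "exp (C * t) \<le> exp (C * T)" using C t by (auto intro: mult_left_mono)
    have "?f x = \<bar>cutoff \<epsilon> x\<bar> ^ n" using n(2) by (simp add: power_even_abs)
    also have "\<dots> \<le> \<bar>x\<bar> ^ n" using cutoff_bounds(1)[OF \<epsilon>] by (intro power_mono) auto
    finally show "1 + ?f x \<le> 1 + \<bar>x\<bar> ^ n" by simp
  qed (use n(2) in \<open>auto simp: zero_le_even_power\<close>)
  finally show ?thesis by (simp add: u_def C_def mult.commute)
qed

text \<open>Fatou's lemma along \<epsilon> = 1/(m+1), with the bound that is uniform in \<epsilon>.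
  Evenness makes the integrands nonnegative whatever the sign of \<open>X\<close>.\<close>

lemma even_moment_finite:
  assumes n: "0 < n" "even n" and t: "t \<in> {0..T}"
  shows "integrable M (\<lambda>\<omega>. X t \<omega> ^ n)"
    and "expectation (\<lambda>\<omega>. X t \<omega> ^ n) \<le> (1 + \<bar>x\<bar> ^ n) * exp (growth n * T)"
proof -
  let ?B = "(1 + \<bar>x\<bar> ^ n) * exp (growth n * T)"
  let ?e = "\<lambda>m. 1 / real (Suc m)"
  have e: "0 < ?e m" "?e m \<le> 1" for m by auto
  have [measurable]: "X t \<in> borel_measurable M" using X_measurable t by simp
  have [measurable]: "cutoff c \<in> borel_measurable borel" for c
    unfolding cutoff_def[abs_def] by measurable
  have B: "0 \<le> ?B" by simp
  have "(\<integral>\<^sup>+\<omega>. ennreal (X t \<omega> ^ n) \<partial>M) = (\<integral>\<^sup>+\<omega>. liminf (\<lambda>m. ennreal (cutoff (?e m) (X t \<omega>) ^ n)) \<partial>M)"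
  proof (rule nn_integral_cong)
    fix \<omega>
    have "(\<lambda>m. ennreal (cutoff (?e m) (X t \<omega>) ^ n)) \<longlonglongrightarrow> ennreal (X t \<omega> ^ n)"
      by (intro tendsto_ennrealI tendsto_power cutoff_tendsto)
    then show "ennreal (X t \<omega> ^ n) = liminf (\<lambda>m. ennreal (cutoff (?e m) (X t \<omega>) ^ n))"
      by (simp add: lim_imp_Liminf)
  qed
  also have "\<dots> \<le> liminf (\<lambda>m. \<integral>\<^sup>+\<omega>. ennreal (cutoff (?e m) (X t \<omega>) ^ n) \<partial>M)"
    by (rule nn_integral_liminf) measurable
  also have "\<dots> \<le> ennreal ?B"
  proof (rule order_trans[OF Liminf_le_Limsup Limsup_bounded])
    show "\<forall>\<^sub>F m in sequentially. (\<integral>\<^sup>+\<omega>. ennreal (cutoff (?e m) (X t \<omega>) ^ n) \<partial>M) \<le> ennreal ?B"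
    proof (intro always_eventually allI)
      fix m
      obtain K where "test_function (\<lambda>y. cutoff (?e m) y ^ n) (cutoff_power' n (?e m)) (cutoff_power'' n (?e m)) K"
        using test_function_cutoff_power[OF e] by blast
      from test_functionD(3)[OF this]
      have "integrable M (\<lambda>\<omega>. cutoff (?e m) (X t \<omega>) ^ n)"
        by (intro integrable_const_bound[where B=K]) auto
      then have "(\<integral>\<^sup>+\<omega>. ennreal (cutoff (?e m) (X t \<omega>) ^ n) \<partial>M) = ennreal (expectation (\<lambda>\<omega>. cutoff (?e m) (X t \<omega>) ^ n))"
        using n(2) by (intro nn_integral_eq_integral) (auto simp: zero_le_even_power)
      also have "\<dots> \<le> ennreal ?B" using expectation_cutoff_power_le[OF e n t] by (rule ennreal_leI)
      finally show "(\<integral>\<^sup>+\<omega>. ennreal (cutoff (?e m) (X t \<omega>) ^ n) \<partial>M) \<le> ennreal ?B" .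
    qed
  qed simp
  finally have le: "(\<integral>\<^sup>+\<omega>. ennreal (X t \<omega> ^ n) \<partial>M) \<le> ennreal ?B" .
  have nn: "0 \<le> X t \<omega> ^ n" for \<omega> using n(2) by (simp add: zero_le_even_power)
  show i: "integrable M (\<lambda>\<omega>. X t \<omega> ^ n)"
  proof (rule integrableI_bounded)
    have "norm (X t \<omega> ^ n) = X t \<omega> ^ n" for \<omega> using nn[of \<omega>] by simp
    then show "(\<integral>\<^sup>+\<omega>. ennreal (norm (X t \<omega> ^ n)) \<partial>M) < \<infinity>"
      using le_less_trans[OF le] by (simp add: ennreal_less_top)
  qed measurable
  have "ennreal (expectation (\<lambda>\<omega>. X t \<omega> ^ n)) \<le> ennreal ?B"
    using le nn_integral_eq_integral[OF i] nn by simp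
  then show "expectation (\<lambda>\<omega>. X t \<omega> ^ n) \<le> ?B" using B by (simp add: ennreal_le_iff)
qed

lemma abs_power_le: "\<bar>z\<bar> ^ n \<le> 1 + z ^ (2 * n)" for z :: real
  using power_le_one_plus[of n "2 * n" "\<bar>z\<bar>"] by (simp add: power_even_abs)

text \<open>Order \<open>n\<close> is dominated by the even order \<open>2 * n\<close>. The bound
  depends on \<open>T\<close> but not on \<open>t\<close>, which later allows dominated convergence
  in time.\<close>

lemma moment_integrable:
  assumes t: "t \<in> {0..T}"
  shows "integrable M (\<lambda>\<omega>. \<bar>X t \<omega>\<bar> ^ n)" "integrable M (\<lambda>\<omega>. X t \<omega> ^ n)"
    and "expectation (\<lambda>\<omega>. \<bar>X t \<omega>\<bar> ^ n) \<le> 1 + (1 + \<bar>x\<bar> ^ (2 * n)) * exp (growth (2 * n) * T)"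
proof -
  have XM [measurable]: "X t \<in> borel_measurable M" using X_measurable t by simp
  have "integrable M (\<lambda>\<omega>. X t \<omega> ^ (2 * n)) \<and>
      expectation (\<lambda>\<omega>. X t \<omega> ^ (2 * n)) \<le> (1 + \<bar>x\<bar> ^ (2 * n)) * exp (growth (2 * n) * T)"
  proof (cases "n = 0")
    case True then show ?thesis by (simp add: prob_space growth_def)
  next
    case False
    then have "0 < 2 * n" "even (2 * n)" by simp_all
    from even_moment_finite[OF this t] show ?thesis by blast
  qed
  then have i: "integrable M (\<lambda>\<omega>. 1 + X t \<omega> ^ (2 * n))"
    and e: "expectation (\<lambda>\<omega>. 1 + X t \<omega> ^ (2 * n)) \<le> 1 + (1 + \<bar>x\<bar> ^ (2 * n)) * exp (growth (2 * n) * T)"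
    by (simp_all add: prob_space)
  show 1: "integrable M (\<lambda>\<omega>. \<bar>X t \<omega>\<bar> ^ n)"
    by (rule Bochner_Integration.integrable_bound[OF i]) (use abs_power_le in \<open>auto intro!: AE_I2 order_trans[OF _ abs_ge_self]\<close>)
  have "integrable M (\<lambda>\<omega>. \<bar>X t \<omega> ^ n\<bar>)" using 1 by (simp add: power_abs)
  then show "integrable M (\<lambda>\<omega>. X t \<omega> ^ n)" by (subst (asm) integrable_abs_iff) auto
  have "expectation (\<lambda>\<omega>. \<bar>X t \<omega>\<bar> ^ n) \<le> expectation (\<lambda>\<omega>. 1 + X t \<omega> ^ (2 * n))"
    by (intro integral_mono 1 i abs_power_le)
  then show "expectation (\<lambda>\<omega>. \<bar>X t \<omega>\<bar> ^ n) \<le> 1 + (1 + \<bar>x\<bar> ^ (2 * n)) * exp (growth (2 * n) * T)"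
    using e by linarith
qed

section \<open>The linear system of the moments\<close>

definition moment :: "nat \<Rightarrow> real \<Rightarrow> real" where
  "moment n t = expectation (\<lambda>\<omega>. X t \<omega> ^ n)"

text \<open>The expected generator of \<open>y ^ n\<close> for nonnegative \<open>y\<close>, where
  the diffusion term loses one degree and joins the \<open>a\<close> term.\<close>

definition moment_rhs :: "nat \<Rightarrow> real \<Rightarrow> real" where
  "moment_rhs n s = (a * real n + \<sigma>\<^sup>2 / 2 * real n * real (n - 1)) * moment (n - 1) s - k * real n * moment n s"

lemma generator_cutoff_power_tendsto:
  assumes n: "0 < n" and y: "0 \<le> y"
  shows "(\<lambda>m. generator (cutoff_power' n (1 / real (Suc m))) (cutoff_power'' n (1 / real (Suc m))) y) \<longlonglongrightarrow>
    (a * real n + \<sigma>\<^sup>2 / 2 * real n * real (n - 1)) * y ^ (n - 1) - k * real n * y ^ n"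
proof -
  have "(\<lambda>m. generator (cutoff_power' n (1 / real (Suc m))) (cutoff_power'' n (1 / real (Suc m))) y) \<longlonglongrightarrow>
      (a - k * y) * (real n * y ^ (n - 1) * 1) +
      \<sigma>\<^sup>2 / 2 * \<bar>y\<bar> * (real n * (real (n - 1) * y ^ (n - 2) * 1\<^sup>2 + y ^ (n - 1) * 0))"
    unfolding generator_def cutoff_power'_def cutoff_power''_def by (intro tendsto_intros cutoff_tendsto)
  also have "(a - k * y) * (real n * y ^ (n - 1) * 1) +
      \<sigma>\<^sup>2 / 2 * \<bar>y\<bar> * (real n * (real (n - 1) * y ^ (n - 2) * 1\<^sup>2 + y ^ (n - 1) * 0)) =
      (a * real n + \<sigma>\<^sup>2 / 2 * real n * real (n - 1)) * y ^ (n - 1) - k * real n * y ^ n"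
  proof (cases n)
    case (Suc l)
    then show ?thesis using y by (cases l) (simp_all add: algebra_simps)
  qed (use n in simp)
  finally show ?thesis .
qed

text \<open>The generator identity for \<open>cutoff \<epsilon> y ^ n\<close> with \<epsilon>
  tending to 0. Dominated convergence is used over outcomes, with dominating function
  \<open>growth n * (1 + \<bar>X s \<omega>\<bar> ^ n)\<close>, and then over time, with the
  constant \<open>D\<close>.\<close>

lemma moment_integral_equation:
  assumes n: "0 < n" and t: "0 < t"
  shows "moment n t = x ^ n + (LINT s:{0..t}|lborel. moment_rhs n s)"
    and "set_integrable lborel {0..t} (moment_rhs n)"
proof -
  let ?e = "\<lambda>m. 1 / real (Suc m)"
  have e: "0 < ?e m" "?e m \<le> 1" for m by auto
  let ?A = "\<lambda>m. generator (cutoff_power' n (?e m)) (cutoff_power'' n (?e m))"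
  have tf: "\<exists>K. test_function (\<lambda>y. cutoff (?e m) y ^ n) (cutoff_power' n (?e m)) (cutoff_power'' n (?e m)) K" for m
    using test_function_cutoff_power[OF e] .
  have Ac: "continuous_on UNIV (?A m)" for m using tf[of m] generator_continuous by blast
  have Am: "?A m \<in> borel_measurable borel" for m using Ac by (rule borel_measurable_continuous_onI)
  have cm: "cutoff c \<in> borel_measurable borel" for c
    unfolding cutoff_def[abs_def] by measurable
  define g where "g m s = expectation (\<lambda>\<omega>. ?A m (X s \<omega>))" for m s
  have gc: "continuous_on {0..t} (g m)" for m
    unfolding g_def
    by (rule continuous_on_subset[OF continuous_expectation[OF Ac generator_cutoff_power_bounded(1)[OF e n]]]) auto
  have I: "expectation (\<lambda>\<omega>. cutoff (?e m) (X t \<omega>) ^ n) = cutoff (?e m) x ^ n + (LINT s:{0..t}|lborel. g m s)" for m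
  proof -
    obtain K where "test_function (\<lambda>y. cutoff (?e m) y ^ n) (cutoff_power' n (?e m)) (cutoff_power'' n (?e m)) K"
      using tf by blast
    from expectation_generator[OF this generator_cutoff_power_bounded(1)[OF e n] t]
    show ?thesis unfolding g_def .
  qed
  have XM: "X s \<in> borel_measurable M" if "s \<in> {0..t}" for s using X_measurable that by simp
  have dom: "integrable M (\<lambda>\<omega>. growth n * (1 + \<bar>X s \<omega>\<bar> ^ n))" if "s \<in> {0..t}" for s
    using moment_integrable(1)[OF that] by simp
  have lim: "(\<lambda>m. g m s) \<longlonglongrightarrow> moment_rhs n s" if s: "s \<in> {0..t}" for s
  proof -
    let ?r = "\<lambda>y. (a * real n + \<sigma>\<^sup>2 / 2 * real n * real (n - 1)) * y ^ (n - 1) - k * real n * y ^ n"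
    note [measurable] = XM[OF s]
    have "(\<lambda>m. g m s) \<longlonglongrightarrow> expectation (\<lambda>\<omega>. ?r (X s \<omega>))"
      unfolding g_def
    proof (rule integral_dominated_convergence[OF _ _ dom[OF s]])
      show "AE \<omega> in M. (\<lambda>m. ?A m (X s \<omega>)) \<longlonglongrightarrow> ?r (X s \<omega>)"
        using X_nonneg
      proof eventually_elim
        case (elim \<omega>) then show ?case using s by (intro generator_cutoff_power_tendsto n) auto
      qed
      show "AE \<omega> in M. norm (?A m (X s \<omega>)) \<le> growth n * (1 + \<bar>X s \<omega>\<bar> ^ n)" for m
        using generator_cutoff_power_bounded(2)[OF e n] by auto
      show "(\<lambda>\<omega>. ?A m (X s \<omega>)) \<in> borel_measurable M" for m
        using measurable_compose[OF XM[OF s] Am] .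
    qed measurable
    also have "expectation (\<lambda>\<omega>. ?r (X s \<omega>)) = moment_rhs n s"
      using moment_integrable(2)[OF s] by (simp add: moment_rhs_def moment_def)
    finally show ?thesis .
  qed
  define D where "D = growth n * (1 + (1 + (1 + \<bar>x\<bar> ^ (2 * n)) * exp (growth (2 * n) * t)))"
  have gD: "\<bar>g m s\<bar> \<le> D" if s: "s \<in> {0..t}" for m s
  proof -
    have "integrable M (\<lambda>\<omega>. ?A m (X s \<omega>))"
      using generator_cutoff_power_bounded(2)[OF e n]
      by (intro Bochner_Integration.integrable_bound[OF dom[OF s]] measurable_compose[OF XM[OF s] Am])
        (auto intro!: AE_I2 order_trans[OF _ abs_ge_self])
    then have "\<bar>g m s\<bar> \<le> expectation (\<lambda>\<omega>. growth n * (1 + \<bar>X s \<omega>\<bar> ^ n))"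
      unfolding g_def by (intro abs_integral_le_integral dom s generator_cutoff_power_bounded(2)[OF e n])
    also have "\<dots> = growth n * (1 + expectation (\<lambda>\<omega>. \<bar>X s \<omega>\<bar> ^ n))"
      using moment_integrable(1)[OF s] by (simp add: prob_space)
    also have "\<dots> \<le> D"
      unfolding D_def using moment_integrable(3)[OF s, of n] growth_nonneg by (intro mult_left_mono add_left_mono) auto
    finally show ?thesis .
  qed
  have Di: "integrable lborel (\<lambda>s. indicator {0..t} s * D)" using t by (simp add: integrable_indicator_iff)
  have gm: "(\<lambda>s. indicator {0..t} s *\<^sub>R g m s) \<in> borel_measurable lborel" for m
    using borel_integrable_atLeastAtMost'[OF gc] unfolding set_integrable_def by (rule borel_measurable_integrable)
  have lim': "(\<lambda>m. indicator {0..t} s *\<^sub>R g m s) \<longlonglongrightarrow> indicator {0..t} s *\<^sub>R moment_rhs n s" for s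
    using lim[of s] by (cases "s \<in> {0..t}") auto
  \<comment> \<open>Measurability in time comes from the pointwise limit of the continuous
    \<open>g m\<close>; continuity of the moments is only derived afterwards.\<close>
  have rm: "(\<lambda>s. indicator {0..t} s *\<^sub>R moment_rhs n s) \<in> borel_measurable lborel"
    using lim' gm by (rule borel_measurable_LIMSEQ_metric[rotated])
  have bd: "AE s in lborel. norm (indicator {0..t} s *\<^sub>R g m s) \<le> indicator {0..t} s * D" for m
    using gD by (auto simp: indicator_def)
  show "set_integrable lborel {0..t} (moment_rhs n)"
    unfolding set_integrable_def
    by (rule integrable_dominated_convergence[OF rm gm Di AE_I2[OF lim'] bd])
  have L1: "(\<lambda>m. LINT s:{0..t}|lborel. g m s) \<longlonglongrightarrow> (LINT s:{0..t}|lborel. moment_rhs n s)"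
    unfolding set_lebesgue_integral_def
    by (rule integral_dominated_convergence[OF rm gm Di AE_I2[OF lim'] bd])
  have tt: "t \<in> {0..t}" using t by simp
  have L2: "(\<lambda>m. expectation (\<lambda>\<omega>. cutoff (?e m) (X t \<omega>) ^ n)) \<longlonglongrightarrow> moment n t"
    unfolding moment_def
  proof (rule integral_dominated_convergence[OF _ _ moment_integrable(1)[OF tt]])
    note [measurable] = XM[OF tt] cm
    show "(\<lambda>\<omega>. X t \<omega> ^ n) \<in> borel_measurable M" by measurable
    show "(\<lambda>\<omega>. cutoff (?e m) (X t \<omega>) ^ n) \<in> borel_measurable M" for m by measurable
    show "AE \<omega> in M. norm (cutoff (?e m) (X t \<omega>) ^ n) \<le> \<bar>X t \<omega>\<bar> ^ n" for m
      using cutoff_bounds(1)[OF e] by (auto simp: power_abs intro!: AE_I2 power_mono)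
    show "AE \<omega> in M. (\<lambda>m. cutoff (?e m) (X t \<omega>) ^ n) \<longlonglongrightarrow> X t \<omega> ^ n"
      by (intro AE_I2 tendsto_power cutoff_tendsto)
  qed
  have "(\<lambda>m. cutoff (?e m) x ^ n + (LINT s:{0..t}|lborel. g m s)) \<longlonglongrightarrow> x ^ n + (LINT s:{0..t}|lborel. moment_rhs n s)"
    by (intro tendsto_add tendsto_power cutoff_tendsto L1)
  then show "moment n t = x ^ n + (LINT s:{0..t}|lborel. moment_rhs n s)"
    using L2 unfolding I by (rule LIMSEQ_unique[rotated])
qed

lemma moment_0: "moment 0 t = 1"
  by (simp add: moment_def prob_space)

lemma moment_at_0: "moment n 0 = x ^ n"
  unfolding moment_def by (rule expectation_X0) measurable

lemma moment_integral_equation':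
  assumes n: "0 < n" and T: "0 < T" and t: "t \<in> {0..T}"
  shows "moment n t = x ^ n + (LINT s:{0..t}|lborel. moment_rhs n s)"
proof (cases "t = 0")
  case True
  then show ?thesis by (simp add: moment_at_0 set_integral_point)
qed (use moment_integral_equation(1)[OF n] t in auto)

text \<open>First half of a bootstrap: integrability of the right-hand side makes each moment an
  indefinite integral, hence continuous. This makes the right-hand side continuous and the moments
  differentiable.\<close>

lemma moment_continuous:
  assumes T: "0 < T"
  shows "continuous_on {0..T} (moment n)"
proof (cases "n = 0")
  case True then show ?thesis by (simp add: moment_0[abs_def])
next
  case False
  then have n: "0 < n" by simp
  have "set_integrable lborel {0..T} (moment_rhs n)" by (rule moment_integral_equation(2)[OF n T])
  then have ih: "moment_rhs n integrable_on {0..T}" by (rule set_borel_integral_eq_integral(1))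
  have eq: "moment n t = x ^ n + integral {0..t} (moment_rhs n)" if t: "t \<in> {0..T}" for t
  proof -
    have "set_integrable lborel {0..t} (moment_rhs n)"
      using set_integrable_subset[OF moment_integral_equation(2)[OF n T], of "{0..t}"] t by auto
    then show ?thesis
      using moment_integral_equation'[OF n T t] set_borel_integral_eq_integral(2) by simp
  qed
  have "continuous_on {0..T} (\<lambda>t. x ^ n + integral {0..t} (moment_rhs n))"
    by (intro continuous_intros indefinite_integral_continuous_1 ih)
  then show ?thesis by (rule continuous_on_eq) (use eq in auto)
qed

lemma moment_has_derivative:
  assumes n: "0 < n" and T: "0 < T" and t: "t \<in> {0..T}"
  shows "(moment n has_real_derivative moment_rhs n t) (at t within {0..T})"
proof (rule primitive_has_real_derivative[OF moment_integral_equation'[OF n T] _ t])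
  show "continuous_on {0..T} (moment_rhs n)"
    unfolding moment_rhs_def by (intro continuous_intros moment_continuous T)
qed

end

section \<open>The closed formula and its differential equation\<close>

definition cir_moment :: "real \<Rightarrow> real \<Rightarrow> real \<Rightarrow> real \<Rightarrow> nat \<Rightarrow> real \<Rightarrow> real" where
  "cir_moment v k \<sigma> x L t =
     (\<Sum>j=0..L. delta_cir j L v * (\<sigma>\<^sup>2 * psi k t / 2) ^ (L - j) * exp (- real j * k * t) * x ^ j)"

lemma psi_has_derivative: "(psi k has_real_derivative 1 - k * psi k t) (at t within S)"
proof (cases "k = 0")
  case True
  then have "psi k = (\<lambda>t. t)" by (auto simp: psi_def)
  then show ?thesis using True by simp
next
  case False
  then have "psi k = (\<lambda>t. (1 - exp (- k * t)) / k)" by (auto simp: psi_def)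
  moreover have "((\<lambda>t. (1 - exp (- k * t)) / k) has_real_derivative 1 - k * ((1 - exp (- k * t)) / k)) (at t within S)"
    using False by (auto intro!: derivative_eq_intros simp: field_simps)
  ultimately show ?thesis by simp
qed

text \<open>Absorption for binomial coefficients, together with splitting off the factor
  \<open>q = n\<close>. The left side appears when the power \<open>Suc n - j\<close> is
  differentiated.\<close>

lemma delta_cir_step:
  assumes "j \<le> n"
  shows "delta_cir j (Suc n) v * real (Suc n - j) = real (Suc n) * (real n + v) * delta_cir j n v"
proof -
  have "real (Suc n choose j) * real (Suc n - j) = real (Suc n) * real (n choose j)"
  proof -
    have "(Suc n choose j) * (Suc n - j) = Suc n * (n choose j)"
      using binomial_absorb_comp[of "Suc n" j] by (simp only: mult.commute diff_Suc_1)
    then show ?thesis by (metis of_nat_mult)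
  qed
  moreover have "(\<Prod>q = j..<Suc n. real q + v) = (\<Prod>q = j..<n. real q + v) * (real n + v)"
    using assms by simp
  ultimately show ?thesis 
  proof -
    assume b: "real (Suc n choose j) * real (Suc n - j) = real (Suc n) * real (n choose j)"
      and p: "(\<Prod>q = j..<Suc n. real q + v) = (\<Prod>q = j..<n. real q + v) * (real n + v)"
    have "delta_cir j (Suc n) v * real (Suc n - j) =
        (real (Suc n choose j) * real (Suc n - j)) * (\<Prod>q = j..<Suc n. real q + v)"
      unfolding delta_cir_def by (simp only: mult_ac)
    then show ?thesis unfolding b p delta_cir_def by (simp only: mult_ac)
  qed
qed

text \<open>Termwise: with c' = \<sigma>^2/2 - k c, the constant part lowers the power and yields
  the order \<open>n\<close> formula by \<open>delta_cir_step\<close>, while \<open>-k * c\<close>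
  restores it with factor \<open>Suc n - j\<close>, to which the exponential adds
  \<open>j\<close>.\<close>

lemma cir_moment_has_derivative:
  "(cir_moment v k \<sigma> x (Suc n) has_real_derivative
     \<sigma>\<^sup>2 / 2 * real (Suc n) * (real n + v) * cir_moment v k \<sigma> x n t - k * real (Suc n) * cir_moment v k \<sigma> x (Suc n) t)
   (at t within S)"
proof -
  define c where "c t = \<sigma>\<^sup>2 * psi k t / 2" for t
  have dc: "(c has_real_derivative \<sigma>\<^sup>2 / 2 - k * c t) (at t within S)"
    using DERIV_cmult[OF psi_has_derivative, of "\<sigma>\<^sup>2 / 2" k t S] unfolding c_def by (simp add: right_diff_distrib mult.left_commute[of k])
  let ?d = "\<lambda>j. delta_cir j (Suc n) v" and ?e = "\<lambda>j t. exp (- real j * k * t)"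
  \<comment> \<open>The index \<open>Suc n\<close> has no partner in the order \<open>n\<close>
    formula, hence the case distinction.\<close>
  define T where "T j = (if j \<le> n then \<sigma>\<^sup>2 / 2 * real (Suc n) * (real n + v) * (delta_cir j n v * c t ^ (n - j) * ?e j t * x ^ j) else 0)
    - k * real (Suc n) * (?d j * c t ^ (Suc n - j) * ?e j t * x ^ j)" for j
  have dj: "((\<lambda>t. ?d j * c t ^ (Suc n - j) * ?e j t * x ^ j) has_real_derivative T j) (at t within S)" if "j \<le> Suc n" for j
  proof -
    let ?D = "?d j * (real (Suc n - j) * c t ^ (Suc n - j - 1) * (\<sigma>\<^sup>2 / 2 - k * c t)) * ?e j t * x ^ j
      + ?d j * c t ^ (Suc n - j) * (?e j t * (- real j * k)) * x ^ j"
    have "((\<lambda>t. ?d j * c t ^ (Suc n - j) * ?e j t * x ^ j) has_real_derivative ?D) (at t within S)"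
      by (rule derivative_eq_intros dc refl)+ (simp add: algebra_simps)
    also have "?D = T j"
    proof (cases "j \<le> n")
      case True
      then obtain m where m: "n = j + m" by (auto simp: le_iff_add)
      have s: "Suc n - j = Suc m" "n - j = m" using m by auto
      have "?D = (?d j * real (Suc n - j)) * (\<sigma>\<^sup>2 / 2 * (c t ^ m * ?e j t * x ^ j)) -
          k * (real (Suc n - j) + real j) * (?d j * c t ^ Suc m * ?e j t * x ^ j)"
        unfolding s by (simp add: algebra_simps)
      also have "real (Suc n - j) + real j = real (Suc n)" using True by simp
      finally show ?thesis
        unfolding delta_cir_step[OF True] T_def using True s by (simp add: mult_ac)
    next
      case False
      then have "j = Suc n" using that by simp
      then show ?thesis by (simp add: T_def algebra_simps)
    qed
    finally show ?thesis .
  qed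
  have "((\<lambda>t. \<Sum>j=0..Suc n. ?d j * c t ^ (Suc n - j) * ?e j t * x ^ j) has_real_derivative (\<Sum>j=0..Suc n. T j)) (at t within S)"
    by (intro DERIV_sum dj) simp
  also have "(\<Sum>j=0..Suc n. T j) =
      \<sigma>\<^sup>2 / 2 * real (Suc n) * (real n + v) * cir_moment v k \<sigma> x n t - k * real (Suc n) * cir_moment v k \<sigma> x (Suc n) t"
  proof -
    have "(\<Sum>j=0..Suc n. if j \<le> n then \<sigma>\<^sup>2 / 2 * real (Suc n) * (real n + v) * (delta_cir j n v * c t ^ (n - j) * ?e j t * x ^ j) else 0)
        = (\<Sum>j=0..n. \<sigma>\<^sup>2 / 2 * real (Suc n) * (real n + v) * (delta_cir j n v * c t ^ (n - j) * ?e j t * x ^ j))"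
      by (simp add: sum.atLeast0_atMost_Suc)
    then show ?thesis
      unfolding T_def sum_subtractf cir_moment_def c_def by (simp only: sum_distrib_left)
  qed
  finally show ?thesis unfolding cir_moment_def[abs_def] c_def .
qed

lemma cir_moment_at_0: "cir_moment v k \<sigma> x L 0 = x ^ L"
proof -
  have "cir_moment v k \<sigma> x L 0 = (\<Sum>j=0..L. if j = L then x ^ L else 0)"
    unfolding cir_moment_def by (intro sum.cong) (auto simp: psi_def delta_cir_def power_0_left)
  then show ?thesis by simp
qed

context cir_process_pos
begin

text \<open>Induction on the order: once the lower moments agree, the difference at order
  \<open>Suc n\<close> solves a homogeneous linear equation with initial value zero.\<close>

lemma moment_eq_cir_moment:
  assumes v: "v = 2 * a / \<sigma>\<^sup>2" and T: "0 < T"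
  shows "t \<in> {0..T} \<Longrightarrow> moment n t = cir_moment v k \<sigma> x n t"
proof (induction n arbitrary: t)
  case 0
  then show ?case by (simp add: moment_0 cir_moment_def delta_cir_def)
next
  case (Suc n)
  let ?M = "cir_moment v k \<sigma> x"
  \<comment> \<open>The difference times its integrating factor; its derivative is zero, so it is
    constant and equals its value at 0.\<close>
  define d where "d s = exp (k * real (Suc n) * s) * (moment (Suc n) s - ?M (Suc n) s)" for s
  have "(d has_real_derivative 0) (at s within {0..T})" if s: "s \<in> {0..T}" for s
  proof -
    \<comment> \<open>The choice of \<open>v\<close> merges drift and diffusion contributions into
      the single factor \<open>real n + v\<close>.\<close>
    have c: "a * real (Suc n) + \<sigma>\<^sup>2 / 2 * real (Suc n) * real n = \<sigma>\<^sup>2 / 2 * real (Suc n) * (real n + v)"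
      using sigma_pos unfolding v by (simp add: field_simps)
    have "moment_rhs (Suc n) s = \<sigma>\<^sup>2 / 2 * real (Suc n) * (real n + v) * ?M n s - k * real (Suc n) * moment (Suc n) s"
      by (simp only: moment_rhs_def diff_Suc_1 c Suc.IH[OF s])
    then have dm: "(moment (Suc n) has_real_derivative
        \<sigma>\<^sup>2 / 2 * real (Suc n) * (real n + v) * ?M n s - k * real (Suc n) * moment (Suc n) s) (at s within {0..T})"
      using moment_has_derivative[OF _ T s, of "Suc n"] by simp
    show ?thesis
      unfolding d_def
      by (rule derivative_eq_intros dm cir_moment_has_derivative refl)+ (simp add: algebra_simps)
  qed
  then obtain c where c: "\<And>s. s \<in> {0..T} \<Longrightarrow> d s = c"
    using has_field_derivative_zero_constant[of "{0..T}" d] by auto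
  have "d t = d 0" using c Suc.prems T by simp
  also have "d 0 = 0" by (simp add: d_def moment_at_0 cir_moment_at_0)
  finally show ?case by (simp add: d_def)
qed

end

theorem propositionB3p3:
  fixes a k \<sigma> v T x :: real
    and M :: "'a measure" and F :: "real \<Rightarrow> 'a measure" and W X :: "real \<Rightarrow> 'a \<Rightarrow> real"
  assumes "a > 0" and "\<sigma> > 0" and "v = 2 * a / \<sigma>\<^sup>2" and "T > 0" and "x \<ge> 0"
    and "cir_process M F W a k \<sigma> x X"
  shows "\<forall>L\<ge>1. \<forall>t\<in>{0..T}.
    integrable M (\<lambda>\<omega>. X t \<omega> ^ L) \<and>
    prob_space.expectation M (\<lambda>\<omega>. X t \<omega> ^ L) =
      (\<Sum>j=0..L. delta_cir j L v * (\<sigma>\<^sup>2 * psi k t / 2) ^ (L - j) * exp (- real j * k * t) * x ^ j)"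
proof -
  interpret cir_process_pos M F W a k \<sigma> x X
    using assms(2,6) by (simp add: cir_process_pos_def cir_process_pos_axioms_def)
  show ?thesis
    using moment_integrable(2) moment_eq_cir_moment[OF assms(3,4)]
    unfolding moment_def cir_moment_def by blast
qed

end
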